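(* Let $\phi_{AB}$ be a spin-1 (Maxwell) field on the Minkowski spacetime with F-gauge components $\phi_0,\phi_1,\phi_2$ admitting the expansion given in the context and satisfying the regularity condition $E^\ast_{p,m}=I^\ast_{p,m}=0$. For each integer $n\ge1$ there is a numerical factor $Q^+(n)$, depending only on $n$, such that the electromagnetic Newman–Penrose constants at $\mathscr I^+$ are given by $$F_m^{n-1}=Q^+(n)\,C_{n+1,n,m},\qquad |m|\le n,$$ where $C_{n+1,n,m}$ is determined by the initial data $a_{0,n+1;n,m}(0)$ and $a_{2,n+1;n,m}(0)$ as specified in the context.
   Context: Geometry. $(\mathcal M,g)$ is the conformal extension of Minkowski space with coordinates $\tau\in[-1,1]$, $\rho\ge0$ and points of $\mathbb S^2$, with $g=d\tau^2-\rho^{-2}(1-\tau^2)d\rho^2+2\rho^{-1}\tau\,d\tau\,d\rho-\sigma=\Theta^2\tilde\eta$, where $\Theta=\rho(1-\tau^2)$, $\sigma$ is the unit round metric and $\tilde\eta=d\tilde t^2-d\tilde\rho^2-\tilde\rho^2\sigma$ is the Minkowski metric, with $\tilde t=\tau/(\rho(1-\tau^2))$, $\tilde\rho=1/(\rho(1-\tau^2))$. $\mathscr I^\pm=\{\tau=\pm1\}$. The F-frame is $e_{00'}=\tfrac{\sqrt2}{2}((1-\tau)\partial_\tau+\rho\partial_\rho)$, $e_{11'}=\tfrac{\sqrt2}{2}((1+\tau)\partial_\tau-\rho\partial_\rho)$, $e_{01'}=\tfrac{\sqrt2}{2}\partial_+$, $e_{10'}=\tfrac{\sqrt2}{2}\partial_-$,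 with $\partial_+=\overline{\partial_-}$ a complex null frame on $\mathbb S^2$, $\sigma^{-1}=\tfrac12(\partial_+\otimes\partial_-+\partial_-\otimes\partial_+)$. Harmonics. $Y_{s;\ell,m}$ are the $L^2(\mathbb S^2)$-orthonormal spin-weighted spherical harmonics, with $\eth Y_{s;\ell,m}=\sqrt{(\ell-s)(\ell+s+1)}\,Y_{s+1;\ell,m}$, $\bar\eth Y_{s;\ell,m}=-\sqrt{(\ell+s)(\ell-s+1)}\,Y_{s-1;\ell,m}$. Field. The Maxwell equations $\nabla_{A'}{}^{A}\phi_{AB}=0$ on $(\mathcal M,g)$, for the components $\phi_0,\phi_1,\phi_2$ (spin weights $1,0,-1$) in the spin dyad adapted to the F-frame, read $(1+\tau)\partial_\tau\phi_0-\rho\partial_\rho\phi_0+\eth\phi_1=-\phi_0$, $\partial_\tau\phi_1+\tfrac12(\eth\phi_2+\bar\eth\phi_0)=0$, $(1-\tau)\partial_\tau\phi_2+\rho\partial_\rho\phi_2+\bar\eth\phi_1=\phi_2$, $\tau\partial_\tau\phi_1-\rho\partial_\rho\phi_1+\tfrac12(\eth\phi_2-\bar\eth\phi_0)=0$. The fields are smooth in $(\tau,\rho)$ and have expansions near $\rho=0$ $$\phi_n=\sum_{p\ge|1-n|}\ \sum_{\ell=|1-n|}^{p}\ \sum_{m=-\ell}^{\ell}\frac1{p!}\,a_{n,p;\ell,m}(\tau)\,Y_{1-n;\ell,m}\,\rho^p,\qquad n=0,1,2,$$ convergent together with all termwise derivatives, locally uniformly for $|\tau|\le1$, $0\le\rho<\rho_0$.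 Regularity condition. For $\ell=p$ one has $a_{0,p;p,m}=(\tfrac{1-\tau}{2})^{p+1}(\tfrac{1+\tau}{2})^{p-1}\big(E_{p,m}+E^\ast_{p,m}\int_0^\tau\frac{ds}{(1+s)^p(1-s)^{p+2}}\big)$ and $a_{2,p;p,m}=(\tfrac{1+\tau}{2})^{p+1}(\tfrac{1-\tau}{2})^{p-1}\big(I_{p,m}+I^\ast_{p,m}\int_0^\tau\frac{ds}{(1-s)^p(1+s)^{p+2}}\big)$ with constants $E,E^\ast,I,I^\ast$; the condition is $E^\ast_{p,m}=I^\ast_{p,m}=0$ for all $p\ge 1$, $|m|\le p$. Constants $C$. For $1\le\ell<p$ put $Q^1_{p,\ell}(\tau)=(\tfrac{1-\tau}{2})^{p+1}P_{\ell-1}^{(p+1,-p+1)}(\tau)$, $Q^3_{p,\ell}(\tau)=(\tfrac{1+\tau}{2})^{p-1}P_{\ell+1}^{(-p-1,p-1)}(\tau)$, where $P_k^{(\alpha,\beta)}(x)=\sum_{s=0}^k\binom{k+\alpha}{k-s}\binom{k+\beta}{s}\left(\tfrac{x-1}{2}\right)^s\left(\tfrac{x+1}{2}\right)^{k-s}$ are Jacobi polynomials (generalized binomial coefficients), and $$X_{p,\ell}(\tau)=\begin{pmatrix}Q^1_{p,\ell}(\tau)&(-1)^{\ell+1}Q^3_{p,\ell}(\tau)\\(-1)^{\ell+1}Q^3_{p,\ell}(-\tau)&Q^1_{p,\ell}(-\tau)\end{pmatrix}.$$ Then $(C_{p,\ell,m},D_{p,\ell,m})^{T}:=X_{p,\ell}(0)^{-1}(a_{0,p;\ell,m}(0),a_{2,p;\ell,m}(0))^{T}$.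 NP constants at $\mathscr I^+$. Let $\phi_0'=\frac{4}{\rho(1+\tau)^2}\phi_2$ and $\tilde\phi_0=\tilde\rho^{-3}\phi_0'$ (the component of the physical Maxwell spinor in the dyad associated with the NP frame at $\mathscr I^+$). At fixed retarded time $\tilde u=\tilde t-\tilde\rho=-1/(\rho(1+\tau))$ and fixed angles, as $\tilde\rho\to\infty$, $\tilde\phi_0=\sum_{k=0}^N\tilde\phi_0^k\,\tilde\rho^{-3-k}+o(\tilde\rho^{-3-N})$ for every $N$, with $\tilde\phi_0^k$ independent of $\tilde\rho$. For $n\ge0$, $|m|\le n+1$, $F^n_m=\int_{\mathcal C}\overline{Y_{-1;n+1,m}}\,\tilde\phi_0^{n+1}\,dS$, where $\mathcal C\cong\mathbb S^2$ is a cut $\{\tau=1,\rho=\rho_\star\}$ of $\mathscr I^+$ with $0<\rho_\star<\rho_0$ ($\tilde u=-1/(2\rho_\star)$), and $dS$ is the area element of $\sigma$; the value is independent of the cut. ($Y_{-1;\ell,m}$ relative to the F-frame is the spin-weight $1$ harmonic relative to the NP frame, whose complex leg is $e'_{01'}=e_{10'}$.) *)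

theory Defs
  imports "HOL-Analysis.Analysis" "HOL-Library.Landau_Symbols" "HOL-Computational_Algebra.Polynomial"
begin

text \<open>
  Functions on the unit sphere are written in spherical coordinates \<open>(\<theta>, \<phi>)\<close> with
  \<open>0 < \<theta> < pi\<close> and \<open>\<phi>\<close> real. Spin-weighted quantities refer to the null frame
  \<open>\<partial>\<^sub>\<plusminus> = - (\<partial>\<^sub>\<theta> \<plusminus> (\<i> / sin \<theta>) \<partial>\<^sub>\<phi>)\<close>, so that
  \<open>\<sigma>\<^sup>-\<^sup>1 = (\<partial>\<^sub>+ \<otimes> \<partial>\<^sub>- + \<partial>\<^sub>- \<otimes> \<partial>\<^sub>+) / 2\<close> and the operators below are
  \<open>\<partial>\<^sub>\<plusminus>\<close> on functions of spin weight 0.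
\<close>

type_synonym sphere_fun = "real \<Rightarrow> real \<Rightarrow> complex"

definition eth :: "int \<Rightarrow> sphere_fun \<Rightarrow> sphere_fun" where
  "eth s f \<theta> \<phi> =
     - (vector_derivative (\<lambda>x. f x \<phi>) (at \<theta>)
        + \<i> / complex_of_real (sin \<theta>) * vector_derivative (\<lambda>y. f \<theta> y) (at \<phi>)
        - of_int s * complex_of_real (cot \<theta>) * f \<theta> \<phi>)"

definition ethbar :: "int \<Rightarrow> sphere_fun \<Rightarrow> sphere_fun" where
  "ethbar s f \<theta> \<phi> =
     - (vector_derivative (\<lambda>x. f x \<phi>) (at \<theta>)
        - \<i> / complex_of_real (sin \<theta>) * vector_derivative (\<lambda>y. f \<theta> y) (at \<phi>)
        + of_int s * complex_of_real (cot \<theta>) * f \<theta> \<phi>)"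

text \<open>
  Associated Legendre functions by Rodrigues' formula with Condon--Shortley phase,
  at \<open>x = cos \<theta>\<close>; the formula covers negative \<open>m \<ge> - l\<close> as well.
\<close>

definition assoc_legendre_cos :: "nat \<Rightarrow> int \<Rightarrow> real \<Rightarrow> real" where
  "assoc_legendre_cos l m \<theta> =
     (-1) powi m / (2 ^ l * fact l) * sin \<theta> powi m
     * poly ((pderiv ^^ nat (int l + m)) ([:-1, 0, 1:] ^ l)) (cos \<theta>)"

definition sph_harm :: "nat \<Rightarrow> int \<Rightarrow> sphere_fun" where
  "sph_harm l m \<theta> \<phi> =
     complex_of_real
       (sqrt ((2 * real l + 1) / (4 * pi) * fact (nat (int l - m)) / fact (nat (int l + m)))
        * assoc_legendre_cos l m \<theta>) * cis (of_int m * \<phi>)"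

primrec eth_pow :: "nat \<Rightarrow> sphere_fun \<Rightarrow> sphere_fun" where
  "eth_pow 0 f = f"
| "eth_pow (Suc k) f = eth (int k) (eth_pow k f)"

primrec ethbar_pow :: "nat \<Rightarrow> sphere_fun \<Rightarrow> sphere_fun" where
  "ethbar_pow 0 f = f"
| "ethbar_pow (Suc k) f = ethbar (- int k) (ethbar_pow k f)"

text \<open>
  \<open>swsh s l m\<close> is \<open>Y\<^sub>s\<^sub>;\<^sub>l\<^sub>,\<^sub>m\<close>. The normalisation is the one for which
  \<open>eth\<close> maps \<open>Y\<^sub>s\<^sub>;\<^sub>l\<^sub>,\<^sub>m\<close> to \<open>sqrt ((l - s) (l + s + 1))\<close> times the harmonic of weight \<open>s + 1\<close>
  and \<open>ethbar\<close> maps it to \<open>- sqrt ((l + s) (l - s + 1))\<close> times the harmonic of weight \<open>s - 1\<close>.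
\<close>

definition swsh :: "int \<Rightarrow> nat \<Rightarrow> int \<Rightarrow> sphere_fun" where
  "swsh s l m \<theta> \<phi> =
     (let k = nat \<bar>s\<bar> in
      if l < k then 0
      else if 0 \<le> s then
        complex_of_real (sqrt (fact (l - k) / fact (l + k))) * eth_pow k (sph_harm l m) \<theta> \<phi>
      else
        (-1) ^ k * complex_of_real (sqrt (fact (l - k) / fact (l + k)))
          * ethbar_pow k (sph_harm l m) \<theta> \<phi>)"

definition sphere_integral :: "sphere_fun \<Rightarrow> complex" where
  "sphere_integral f =
     set_lebesgue_integral lborel ({0<..<pi} \<times> {0<..<2 * pi})
       (\<lambda>(\<theta>, \<phi>). sin \<theta> *\<^sub>R f \<theta> \<phi>)"

text \<open>
  A field is given by its components: \<open>F n \<tau> \<rho> \<theta> \<phi>\<close> for \<open>n = 0, 1, 2\<close>, the component of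
  index \<open>n\<close> having spin weight \<open>1 - n\<close>. Other values of \<open>n\<close> play no role.
\<close>

type_synonym field = "nat \<Rightarrow> real \<Rightarrow> real \<Rightarrow> sphere_fun"

definition d_tau :: "(real \<Rightarrow> real \<Rightarrow> sphere_fun) \<Rightarrow> real \<Rightarrow> real \<Rightarrow> sphere_fun" where
  "d_tau f \<tau> \<rho> \<theta> \<phi> = vector_derivative (\<lambda>t. f t \<rho> \<theta> \<phi>) (at \<tau>)"

definition d_rho :: "(real \<Rightarrow> real \<Rightarrow> sphere_fun) \<Rightarrow> real \<Rightarrow> real \<Rightarrow> sphere_fun" where
  "d_rho f \<tau> \<rho> \<theta> \<phi> = vector_derivative (\<lambda>r. f \<tau> r \<theta> \<phi>) (at \<rho>)"

definition maxwell_equations :: "real \<Rightarrow> field \<Rightarrow> bool" where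
  "maxwell_equations \<rho>0 F \<longleftrightarrow>
     (\<forall>\<tau> \<rho> \<theta> \<phi>. -1 < \<tau> \<and> \<tau> < 1 \<and> 0 < \<rho> \<and> \<rho> < \<rho>0 \<and> 0 < \<theta> \<and> \<theta> < pi \<longrightarrow>
        (1 + of_real \<tau>) * d_tau (F 0) \<tau> \<rho> \<theta> \<phi> - of_real \<rho> * d_rho (F 0) \<tau> \<rho> \<theta> \<phi>
          + eth 0 (F 1 \<tau> \<rho>) \<theta> \<phi> = - F 0 \<tau> \<rho> \<theta> \<phi>
      \<and> d_tau (F 1) \<tau> \<rho> \<theta> \<phi>
          + 1 / 2 * (eth (-1) (F 2 \<tau> \<rho>) \<theta> \<phi> + ethbar 1 (F 0 \<tau> \<rho>) \<theta> \<phi>) = 0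
      \<and> (1 - of_real \<tau>) * d_tau (F 2) \<tau> \<rho> \<theta> \<phi> + of_real \<rho> * d_rho (F 2) \<tau> \<rho> \<theta> \<phi>
          + ethbar 0 (F 1 \<tau> \<rho>) \<theta> \<phi> = F 2 \<tau> \<rho> \<theta> \<phi>
      \<and> of_real \<tau> * d_tau (F 1) \<tau> \<rho> \<theta> \<phi> - of_real \<rho> * d_rho (F 1) \<tau> \<rho> \<theta> \<phi>
          + 1 / 2 * (eth (-1) (F 2 \<tau> \<rho>) \<theta> \<phi> - ethbar 1 (F 0 \<tau> \<rho>) \<theta> \<phi>) = 0)"

text \<open>
  \<open>a n p l m\<close> is the coefficient \<open>a\<^sub>n\<^sub>,\<^sub>p\<^sub>;\<^sub>l\<^sub>,\<^sub>m\<close> as a function of \<open>\<tau>\<close>.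
\<close>

type_synonym coeffs = "nat \<Rightarrow> nat \<Rightarrow> nat \<Rightarrow> int \<Rightarrow> real \<Rightarrow> complex"

definition spin_weight :: "nat \<Rightarrow> int" where
  "spin_weight n = 1 - int n"

text \<open>
  Invariant angular derivatives: words in \<open>eth\<close> (\<open>True\<close>) and \<open>ethbar\<close> (\<open>False\<close>), applied from the
  head of the list. Their absolute values do not depend on the choice of null frame, so
  uniformity in \<open>(\<theta>, \<phi>)\<close> is uniformity over the whole sphere.
\<close>

primrec ang_deriv :: "bool list \<Rightarrow> int \<Rightarrow> sphere_fun \<Rightarrow> sphere_fun" where
  "ang_deriv [] s f = f"
| "ang_deriv (b # w) s f =
     (if b then ang_deriv w (s + 1) (eth s f) else ang_deriv w (s - 1) (ethbar s f))"

definition nth_deriv :: "nat \<Rightarrow> (real \<Rightarrow> complex) \<Rightarrow> real \<Rightarrow> complex" where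
  "nth_deriv i f = ((\<lambda>g t. vector_derivative g (at t)) ^^ i) f"

text \<open>
  The degree \<open>p\<close> term of the expansion of component \<open>n\<close>, differentiated \<open>i\<close> times in \<open>\<tau>\<close>,
  \<open>j\<close> times in \<open>\<rho>\<close> and by the word \<open>w\<close> in the angles. If \<open>p < \<bar>1 - n\<bar>\<close> the sum is empty.
\<close>

definition term_deriv ::
  "coeffs \<Rightarrow> nat \<Rightarrow> nat \<Rightarrow> nat \<Rightarrow> nat \<Rightarrow> bool list \<Rightarrow> real \<Rightarrow> real \<Rightarrow> sphere_fun" where
  "term_deriv a n p i j w \<tau> \<rho> \<theta> \<phi> =
     (\<Sum>l = nat \<bar>spin_weight n\<bar>..p. \<Sum>m = - int l..int l.
        1 / fact p * nth_deriv i (a n p l m) \<tau>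
        * ang_deriv w (spin_weight n) (swsh (spin_weight n) l m) \<theta> \<phi>
        * complex_of_real ((deriv ^^ j) (\<lambda>x. x ^ p) \<rho>))"

text \<open>
  Only interior smoothness and continuity up to \<open>\<tau> = \<plusminus>1\<close> are required of the coefficients.
  Smoothness at \<open>\<tau> = \<plusminus>1\<close> would already exclude the logarithmic terms in the modes \<open>l = p\<close>,
  and so make the regularity condition redundant.
\<close>

definition has_expansion :: "real \<Rightarrow> field \<Rightarrow> coeffs \<Rightarrow> bool" where
  "has_expansion \<rho>0 F a \<longleftrightarrow>
     (\<forall>n\<le>2.
        (\<forall>p l m. nat \<bar>spin_weight n\<bar> \<le> l \<and> l \<le> p \<and> \<bar>m\<bar> \<le> int l \<longrightarrow>
           continuous_on {-1..1} (a n p l m)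
         \<and> (\<forall>i. nth_deriv i (a n p l m) differentiable_on {-1<..<1}))
      \<and> (\<forall>r. 0 < r \<and> r < \<rho>0 \<longrightarrow>
           uniform_limit ({-1..1} \<times> {0..r} \<times> {0<..<pi} \<times> UNIV)
             (\<lambda>N (\<tau>, \<rho>, \<theta>, \<phi>). \<Sum>p<N. term_deriv a n p 0 0 [] \<tau> \<rho> \<theta> \<phi>)
             (\<lambda>(\<tau>, \<rho>, \<theta>, \<phi>). F n \<tau> \<rho> \<theta> \<phi>) sequentially
         \<and> (\<forall>i j w. uniformly_convergent_on ({-1<..<1} \<times> {0..r} \<times> {0<..<pi} \<times> UNIV)
             (\<lambda>N (\<tau>, \<rho>, \<theta>, \<phi>). \<Sum>p<N. term_deriv a n p i j w \<tau> \<rho> \<theta> \<phi>))))"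

text \<open>The constants \<open>E, E\<^sup>*, I, I\<^sup>*\<close> of the modes \<open>l = p\<close>, written \<open>E, Es, J, Js\<close>.\<close>

definition top_mode_constants ::
  "coeffs \<Rightarrow> (nat \<Rightarrow> int \<Rightarrow> complex) \<Rightarrow> (nat \<Rightarrow> int \<Rightarrow> complex)
     \<Rightarrow> (nat \<Rightarrow> int \<Rightarrow> complex) \<Rightarrow> (nat \<Rightarrow> int \<Rightarrow> complex) \<Rightarrow> bool" where
  "top_mode_constants a E Es J Js \<longleftrightarrow>
     (\<forall>p m \<tau>. 1 \<le> p \<and> \<bar>m\<bar> \<le> int p \<and> -1 < \<tau> \<and> \<tau> < 1 \<longrightarrow>
        a 0 p p m \<tau> =
          complex_of_real (((1 - \<tau>) / 2) ^ (p + 1) * ((1 + \<tau>) / 2) ^ (p - 1))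
          * (E p m + Es p m *
              complex_of_real (LBINT s=ereal 0..ereal \<tau>. 1 / ((1 + s) ^ p * (1 - s) ^ (p + 2))))
      \<and> a 2 p p m \<tau> =
          complex_of_real (((1 + \<tau>) / 2) ^ (p + 1) * ((1 - \<tau>) / 2) ^ (p - 1))
          * (J p m + Js p m *
              complex_of_real (LBINT s=ereal 0..ereal \<tau>. 1 / ((1 - s) ^ p * (1 + s) ^ (p + 2)))))"

definition jacobi :: "nat \<Rightarrow> real \<Rightarrow> real \<Rightarrow> real \<Rightarrow> real" where
  "jacobi k \<alpha> \<beta> x =
     (\<Sum>s = 0..k. ((real k + \<alpha>) gchoose (k - s)) * ((real k + \<beta>) gchoose s)
        * ((x - 1) / 2) ^ s * ((x + 1) / 2) ^ (k - s))"

definition Q1 :: "nat \<Rightarrow> nat \<Rightarrow> real \<Rightarrow> real" where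
  "Q1 p l \<tau> = ((1 - \<tau>) / 2) ^ (p + 1) * jacobi (l - 1) (real p + 1) (- real p + 1) \<tau>"

definition Q3 :: "nat \<Rightarrow> nat \<Rightarrow> real \<Rightarrow> real" where
  "Q3 p l \<tau> = ((1 + \<tau>) / 2) ^ (p - 1) * jacobi (l + 1) (- real p - 1) (real p - 1) \<tau>"

definition X_mat :: "nat \<Rightarrow> nat \<Rightarrow> real \<Rightarrow> complex ^ 2 ^ 2" where
  "X_mat p l \<tau> =
     vector [vector [of_real (Q1 p l \<tau>), of_real ((-1) ^ (l + 1) * Q3 p l \<tau>)],
             vector [of_real ((-1) ^ (l + 1) * Q3 p l (- \<tau>)), of_real (Q1 p l (- \<tau>))]]"

definition CD_vec :: "coeffs \<Rightarrow> nat \<Rightarrow> nat \<Rightarrow> int \<Rightarrow> complex ^ 2" where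
  "CD_vec a p l m = matrix_inv (X_mat p l 0) *v vector [a 0 p l m 0, a 2 p l m 0]"

definition C_const :: "coeffs \<Rightarrow> nat \<Rightarrow> nat \<Rightarrow> int \<Rightarrow> complex" where
  "C_const a p l m = CD_vec a p l m $ 1"

definition t_tilde :: "real \<Rightarrow> real \<Rightarrow> real" where
  "t_tilde \<tau> \<rho> = \<tau> / (\<rho> * (1 - \<tau>\<^sup>2))"

definition rho_tilde :: "real \<Rightarrow> real \<Rightarrow> real" where
  "rho_tilde \<tau> \<rho> = 1 / (\<rho> * (1 - \<tau>\<^sup>2))"

definition u_tilde :: "real \<Rightarrow> real \<Rightarrow> real" where
  "u_tilde \<tau> \<rho> = t_tilde \<tau> \<rho> - rho_tilde \<tau> \<rho>"

text \<open>The coordinates \<open>\<tau>, \<rho>\<close> as functions of the physical retarded time \<open>u\<close> and radius \<open>r\<close>.\<close>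

definition tau_of :: "real \<Rightarrow> real \<Rightarrow> real" where
  "tau_of u r = (u + r) / r"

definition rho_of :: "real \<Rightarrow> real \<Rightarrow> real" where
  "rho_of u r = r / (r\<^sup>2 - (u + r)\<^sup>2)"

lemma u_tilde_eq:
  assumes "\<bar>\<tau>\<bar> < 1" "0 < \<rho>"
  shows "u_tilde \<tau> \<rho> = - 1 / (\<rho> * (1 + \<tau>))"
proof -
  have nz: "1 - \<tau> \<noteq> 0" "1 + \<tau> \<noteq> 0" "\<rho> \<noteq> 0" using assms by auto
  have "1 - \<tau>\<^sup>2 = (1 - \<tau>) * (1 + \<tau>)" by (simp add: power2_eq_square algebra_simps)
  with nz show ?thesis
    unfolding u_tilde_def t_tilde_def rho_tilde_def
    by (simp add: divide_simps)
qed

lemma physical_coordinates_inverse: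
  assumes "\<bar>\<tau>\<bar> < 1" "0 < \<rho>"
  shows "tau_of (u_tilde \<tau> \<rho>) (rho_tilde \<tau> \<rho>) = \<tau>"
    and "rho_of (u_tilde \<tau> \<rho>) (rho_tilde \<tau> \<rho>) = \<rho>"
proof -
  define d where "d = \<rho> * (1 - \<tau>\<^sup>2)"
  have t2: "\<tau>\<^sup>2 < 1" using assms by (simp add: abs_square_less_1)
  then have d: "d \<noteq> 0" using assms unfolding d_def by simp
  have sum: "u_tilde \<tau> \<rho> + rho_tilde \<tau> \<rho> = \<tau> / d"
    by (simp add: u_tilde_def t_tilde_def d_def)
  have r: "rho_tilde \<tau> \<rho> = 1 / d" by (simp add: rho_tilde_def d_def)
  show "tau_of (u_tilde \<tau> \<rho>) (rho_tilde \<tau> \<rho>) = \<tau>"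
    unfolding tau_of_def by (subst sum, subst r) (use d in simp)
  have "(1 / d)\<^sup>2 - (\<tau> / d)\<^sup>2 = (1 - \<tau>\<^sup>2) / d\<^sup>2"
    by (simp add: power_divide diff_divide_distrib)
  then have "rho_of (u_tilde \<tau> \<rho>) (rho_tilde \<tau> \<rho>) = (1 / d) / ((1 - \<tau>\<^sup>2) / d\<^sup>2)"
    unfolding rho_of_def by (subst sum, (subst r)+) simp
  also have "\<dots> = d / (1 - \<tau>\<^sup>2)" using d by (simp add: power2_eq_square)
  also have "\<dots> = \<rho>" using t2 by (simp add: d_def)
  finally show "rho_of (u_tilde \<tau> \<rho>) (rho_tilde \<tau> \<rho>) = \<rho>" .
qed

definition phi0_prime :: "field \<Rightarrow> real \<Rightarrow> real \<Rightarrow> sphere_fun" where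
  "phi0_prime F \<tau> \<rho> \<theta> \<phi> = complex_of_real (4 / (\<rho> * (1 + \<tau>)\<^sup>2)) * F 2 \<tau> \<rho> \<theta> \<phi>"

text \<open>The physical component \<open>\<phi>\<^sub>0\<close> of the NP frame, as a function of \<open>(u, r)\<close>.\<close>

definition phi0_phys :: "field \<Rightarrow> real \<Rightarrow> real \<Rightarrow> sphere_fun" where
  "phi0_phys F u r \<theta> \<phi> =
     complex_of_real (r powi (-3)) * phi0_prime F (tau_of u r) (rho_of u r) \<theta> \<phi>"

definition is_asymptotic_expansion :: "(real \<Rightarrow> complex) \<Rightarrow> (nat \<Rightarrow> complex) \<Rightarrow> bool" where
  "is_asymptotic_expansion f c \<longleftrightarrow>
     (\<forall>N. (\<lambda>r. f r - (\<Sum>k\<le>N. c k * complex_of_real (r powi (-3 - int k))))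
            \<in> o[at_top](\<lambda>r. complex_of_real (r powi (-3 - int N))))"

text \<open>Coefficients of such an expansion are unique, so the definite description is apt.\<close>

definition phi0_phys_coeff :: "field \<Rightarrow> real \<Rightarrow> nat \<Rightarrow> sphere_fun" where
  "phi0_phys_coeff F u k \<theta> \<phi> =
     (THE c. is_asymptotic_expansion (\<lambda>r. phi0_phys F u r \<theta> \<phi>) c) k"

text \<open>
  Evaluated at the cut \<open>\<tau> = 1, \<rho> = \<rho>s\<close> of future null infinity,
  where \<open>u = - 1 / (2 \<rho>s)\<close>.
\<close>

definition NP_const :: "field \<Rightarrow> real \<Rightarrow> nat \<Rightarrow> int \<Rightarrow> complex" where
  "NP_const F \<rho>s n m =
     sphere_integral (\<lambda>\<theta> \<phi>.
       cnj (swsh (-1) (n + 1) m \<theta> \<phi>) * phi0_phys_coeff F (- 1 / (2 * \<rho>s)) (n + 1) \<theta> \<phi>)"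

end

theory Submission
  imports Defs
begin

text \<open>
  Along the outgoing null curve of retarded time \<open>u = - 1 / (2 \<rho>\<^sub>s)\<close> one has \<open>\<rho> (1 + \<tau>) = 2 \<rho>\<^sub>s\<close>, and
  \<open>x = 1 - \<tau>\<close> is \<open>1 / (2 \<rho>\<^sub>s r)\<close>, so the coefficient of \<open>r\<^sup>-\<^sup>3\<^sup>-\<^sup>n\<close> is an \<open>n\<close>-th Taylor coefficient in \<open>x\<close>.
  Projected on \<open>Y\<^sub>-\<^sub>1\<^sub>;\<^sub>n\<^sub>,\<^sub>m\<close> only the modes \<open>l = n\<close>, \<open>p \<ge> n\<close> of \<open>\<phi>\<^sub>2\<close> count. For \<open>l < p\<close> the Maxwell equations reduce
  to a linear system for \<open>(a\<^sub>0, a\<^sub>2)\<close> with fundamental matrix \<open>X\<close>. After multiplication by \<open>\<rho>\<^sup>p / (1 + \<tau>)\<close>, its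
  \<open>D\<close> part is a polynomial in \<open>x\<close> of degree \<open>l - 1 < n\<close>, and its \<open>C\<close> part is \<open>O(x\<^sup>p\<^sup>-\<^sup>1)\<close>; the regular modes \<open>l = p\<close>
  are exact powers \<open>x\<^sup>p\<^sup>-\<^sup>1\<close>. Hence \<open>p = n + 1\<close> alone contributes, through \<open>C\<close>. Orthogonality of the harmonics
  uses only that their norm is nonzero and does not depend on \<open>m\<close>, so the norm is left inside the factor.
\<close>

section \<open>Jacobi polynomials and the mode system\<close>

text \<open>Three obstacles shape the argument. (1) \<open>C_const\<close> is read off through
  \<open>matrix_inv\<close>, which is informative only if \<open>X_mat p l 0\<close> is invertible.
  The determinant at 0 has no convenient closed form; the Wronskian transports the question to
  \<tau> = 1, where it factors into generalized binomial coefficients. (2) Derivatives of the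
  coefficients are controlled only for |\<tau>| < 1, while the Taylor coefficients live at \<tau> =
  1. The modes of component 2 turn out to be polynomials in \<tau>, for l < p by the explicit
  columns of X and for l = p by the regularity condition, and bounds on polynomials pass to the
  closed interval. (3) Taylor expansion in x, summation over p and integration over the sphere have
  to commute. On the curve \<rho> = 2 \<rho>s / (2 - x) exceeds \<rho>s for x > 0, so the bounds are
  taken at a radius strictly between \<rho>s and \<rho>0. The gap yields a geometric factor
  \<open>q ^ p\<close>, which absorbs the polynomial growth in p caused by differentiating (2 -
  x)^(-p-1).\<close>

lemma gchoose_Suc_mult: "(real (Suc j)) * (a gchoose Suc j) = (a - real j) * (a gchoose j)" for a :: real
  using gbinomial_mult_1[of a j] by (simp add: algebra_simps)

text \<open>The derivative is left as an unsimplified sum because two different rearrangements of it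
  are wanted: one lowering the degree, one raising it.\<close>

lemma jacobi_has_derivative_raw:
  "(jacobi k \<alpha> \<beta> has_real_derivative
     (\<Sum>s = 0..k. ((real k + \<alpha>) gchoose (k - s)) * ((real k + \<beta>) gchoose s)
         * (1/2 * (real s * ((x - 1) / 2) ^ (s - 1) * ((x + 1) / 2) ^ (k - s)
         + real (k - s) * ((x - 1) / 2) ^ s * ((x + 1) / 2) ^ (k - s - 1))))) (at x)"
proof -
  have "((\<lambda>x. c * ((x - 1) / 2) ^ s * ((x + 1) / 2) ^ j) has_real_derivative
      c * (1/2 * (real s * ((x - 1) / 2) ^ (s - 1) * ((x + 1) / 2) ^ j
         + real j * ((x - 1) / 2) ^ s * ((x + 1) / 2) ^ (j - 1)))) (at x)" for c s j
    by (rule derivative_eq_intros refl | simp add: algebra_simps)+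
  then show ?thesis unfolding jacobi_def[abs_def] by (intro DERIV_sum)
qed

text \<open>After an index shift both halves of the raw derivative carry the same monomials.
  Absorption in each binomial produces the factors k + \<beta> - s and k + \<alpha> - (k - 1 - s),
  whose sum k + \<alpha> + \<beta> + 1 is independent of s.\<close>

lemma jacobi_has_derivative:
  assumes "k > 0"
  shows "(jacobi k \<alpha> \<beta> has_real_derivative
           (real k + \<alpha> + \<beta> + 1) / 2 * jacobi (k - 1) (\<alpha> + 1) (\<beta> + 1) x) (at x)"
proof -
  obtain n where k: "k = Suc n" using assms by (cases k) auto
  define u v where "u = (x - 1) / 2" and "v = (x + 1) / 2"
  define c where "c = (\<lambda>s. ((real k + \<alpha>) gchoose (k - s)) * ((real k + \<beta>) gchoose s))"
  have 1: "(jacobi k \<alpha> \<beta> has_real_derivative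
     (\<Sum>s = 0..k. c s * (1/2 * (real s * u ^ (s - 1) * v ^ (k - s)
         + real (k - s) * u ^ s * v ^ (k - s - 1))))) (at x)"
    unfolding c_def u_def v_def by (rule jacobi_has_derivative_raw)
  let ?lhs = "\<Sum>s = 0..k. c s * (1/2 * (real s * u ^ (s - 1) * v ^ (k - s)
         + real (k - s) * u ^ s * v ^ (k - s - 1)))"
  let ?rhs = "(real k + \<alpha> + \<beta> + 1) / 2 * jacobi (k - 1) (\<alpha> + 1) (\<beta> + 1) x"
  have "?lhs
     = 1/2 * ((\<Sum>s = 0..Suc n. real s * c s * u ^ (s - 1) * v ^ (k - s))
         + (\<Sum>s = 0..Suc n. real (k - s) * c s * u ^ s * v ^ (k - s - 1)))"
    unfolding k by (simp only: sum_distrib_left sum.distrib [symmetric]) (simp add: algebra_simps)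
  also have "(\<Sum>s = 0..Suc n. real s * c s * u ^ (s - 1) * v ^ (k - s))
      = (\<Sum>s = 0..n. real (Suc s) * c (Suc s) * u ^ s * v ^ (n - s))"
    unfolding k by (subst sum.atLeast0_atMost_Suc_shift) simp
  also have "(\<Sum>s = 0..Suc n. real (k - s) * c s * u ^ s * v ^ (k - s - 1))
      = (\<Sum>s = 0..n. real (k - s) * c s * u ^ s * v ^ (n - s))"
    unfolding k by (subst sum.atLeast0_atMost_Suc) simp
  also have "1/2 * ((\<Sum>s = 0..n. real (Suc s) * c (Suc s) * u ^ s * v ^ (n - s))
      + (\<Sum>s = 0..n. real (k - s) * c s * u ^ s * v ^ (n - s)))
     = (\<Sum>s = 0..n. 1/2 * (real (Suc s) * c (Suc s) + real (k - s) * c s) * u ^ s * v ^ (n - s))"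
    by (simp only: sum_distrib_left sum.distrib [symmetric]) (simp add: algebra_simps)
  also have "\<dots> = (\<Sum>s = 0..n. (real k + \<alpha> + \<beta> + 1) / 2 *
     ((((real n + (\<alpha> + 1)) gchoose (n - s)) * ((real n + (\<beta> + 1)) gchoose s)) * u ^ s * v ^ (n - s)))"
  proof (rule sum.cong[OF refl], goal_cases)
    case (1 s)
    then have s: "s \<le> n" by simp
    have ks: "k - s = Suc (n - s)" "k - Suc s = n - s" using s k by auto
    have e1: "real (Suc s) * ((real k + \<beta>) gchoose Suc s) = (real k + \<beta> - real s) * ((real k + \<beta>) gchoose s)"
      by (rule gchoose_Suc_mult)
    have e2: "real (k - s) * ((real k + \<alpha>) gchoose (k - s))
       = (real k + \<alpha> - real (n - s)) * ((real k + \<alpha>) gchoose (n - s))"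
      unfolding ks by (rule gchoose_Suc_mult)
    define A B where "A = ((real k + \<alpha>) gchoose (n - s))" and "B = ((real k + \<beta>) gchoose s)"
    have c1: "real (Suc s) * c (Suc s) = A * ((real k + \<beta> - real s) * B)"
      unfolding c_def ks A_def B_def e1[symmetric] by simp
    have c2: "real (k - s) * c s = (real k + \<alpha> - real (n - s)) * A * B"
      unfolding c_def A_def B_def e2[symmetric] by simp
    have r: "real (n - s) = real n - real s" "real k = real n + 1" using s k by auto
    have AB: "((real n + (\<alpha> + 1)) gchoose (n - s)) = A" "((real n + (\<beta> + 1)) gchoose s) = B"
      unfolding A_def B_def k by (simp_all add: algebra_simps)
    show ?case unfolding AB c1 c2 r by (simp add: field_simps)
  qed
  also have "\<dots> = (real k + \<alpha> + \<beta> + 1) / 2 * jacobi (k - 1) (\<alpha> + 1) (\<beta> + 1) x"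
    unfolding jacobi_def k u_def v_def by (simp add: sum_distrib_left)
  finally have eq: "?lhs = ?rhs" .
  show ?thesis using 1 unfolding eq .
qed

text \<open>This is the derivative of (1 - x)^\<alpha> (1 + x)^\<beta> times the Jacobi polynomial,
  with the weight divided out so that negative exponents do no harm. In the variables
  \<open>u\<close>, \<open>v\<close> the two sums acquire the weights k + 1 - s and s, which add up
  to k + 1.\<close>

lemma jacobi_raise:
  assumes "(jacobi k \<alpha> \<beta> has_real_derivative d) (at x)"
  shows "(1 - x\<^sup>2) * d + (\<beta> * (1 - x) - \<alpha> * (1 + x)) * jacobi k \<alpha> \<beta> x
     = - 2 * (real k + 1) * jacobi (k + 1) (\<alpha> - 1) (\<beta> - 1) x"
proof -
  define u v where "u = (x - 1) / 2" and "v = (x + 1) / 2"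
  define c where "c = (\<lambda>s. ((real k + \<alpha>) gchoose (k - s)) * ((real k + \<beta>) gchoose s))"
  define e where "e = (\<lambda>s. ((real k + \<alpha>) gchoose (Suc k - s)) * ((real k + \<beta>) gchoose s))"
  have "(jacobi k \<alpha> \<beta> has_real_derivative
     (\<Sum>s = 0..k. c s * (1/2 * (real s * u ^ (s - 1) * v ^ (k - s)
         + real (k - s) * u ^ s * v ^ (k - s - 1))))) (at x)"
    unfolding c_def u_def v_def by (rule jacobi_has_derivative_raw)
  with assms have d: "d = (\<Sum>s = 0..k. c s * (1/2 * (real s * u ^ (s - 1) * v ^ (k - s)
         + real (k - s) * u ^ s * v ^ (k - s - 1))))" by (rule DERIV_unique)
  have x: "1 - x\<^sup>2 = -4 * u * v" "1 - x = - 2 * u" "1 + x = 2 * v"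
    unfolding u_def v_def by (simp_all add: field_simps power2_eq_square)
  have P: "jacobi k \<alpha> \<beta> x = (\<Sum>s = 0..k. c s * u ^ s * v ^ (k - s))"
    unfolding jacobi_def c_def u_def v_def by simp
  have "(1 - x\<^sup>2) * d + (\<beta> * (1 - x) - \<alpha> * (1 + x)) * jacobi k \<alpha> \<beta> x
    = (\<Sum>s = 0..k. -2 * ((real s + \<alpha>) * c s * (u ^ s * v ^ (Suc k - s))
        + (real (k - s) + \<beta>) * c s * (u ^ Suc s * v ^ (k - s))))"
    unfolding d P x sum_distrib_left sum.distrib[symmetric]
  proof (rule sum.cong[OF refl], goal_cases)
    case (1 s)
    have a: "real s * u ^ (s - 1) * u = real s * u ^ s" by (cases s) auto
    have b: "real (k - s) * v ^ (k - s - 1) * v = real (k - s) * v ^ (k - s)"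
      by (cases "k - s") auto
    have "v ^ (Suc k - s) = v * v ^ (k - s)" using 1 by (simp add: Suc_diff_le)
    moreover have "-4 * u * v * (c s * (1/2 * (real s * u ^ (s - 1) * v ^ (k - s)
         + real (k - s) * u ^ s * v ^ (k - s - 1))))
       = -2 * c s * ((real s * u ^ (s - 1) * u) * v * v ^ (k - s)
          + (real (k - s) * v ^ (k - s - 1) * v) * u * u ^ s)" by (simp add: algebra_simps)
    ultimately show ?case unfolding a b by (simp add: algebra_simps)
  qed
  also have "\<dots> = -2 * ((\<Sum>s = 0..k. (real s + \<alpha>) * c s * (u ^ s * v ^ (Suc k - s)))
        + (\<Sum>s = 0..k. (real (k - s) + \<beta>) * c s * (u ^ Suc s * v ^ (k - s))))"
    by (simp only: sum_distrib_left sum.distrib [symmetric])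
  also have "(\<Sum>s = 0..k. (real s + \<alpha>) * c s * (u ^ s * v ^ (Suc k - s)))
     = (\<Sum>s = 0..Suc k. real (Suc k - s) * e s * (u ^ s * v ^ (Suc k - s)))"
  proof -
    have "(real s + \<alpha>) * c s = real (Suc k - s) * e s" if "s \<le> k" for s
    proof -
      have "real (Suc (k - s)) * ((real k + \<alpha>) gchoose Suc (k - s))
         = (real k + \<alpha> - real (k - s)) * ((real k + \<alpha>) gchoose (k - s))"
        by (rule gchoose_Suc_mult)
      then show ?thesis using that unfolding c_def e_def
        by (simp add: Suc_diff_le of_nat_diff algebra_simps)
    qed
    then show ?thesis by (simp add: sum.atLeast0_atMost_Suc)
  qed
  also have "(\<Sum>s = 0..k. (real (k - s) + \<beta>) * c s * (u ^ Suc s * v ^ (k - s)))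
     = (\<Sum>s = 0..Suc k. real s * e s * (u ^ s * v ^ (Suc k - s)))"
  proof -
    have "(real (k - s) + \<beta>) * c s = real (Suc s) * e (Suc s)" if "s \<le> k" for s
    proof -
      have "real (Suc s) * ((real k + \<beta>) gchoose Suc s)
         = (real k + \<beta> - real s) * ((real k + \<beta>) gchoose s)"
        by (rule gchoose_Suc_mult)
      moreover have "real (k - s) + \<beta> = real k + \<beta> - real s" using that by (simp add: of_nat_diff)
      ultimately show ?thesis unfolding c_def e_def diff_Suc_Suc
        by (metis mult.assoc mult.commute)
    qed
    then show ?thesis by (subst sum.atLeast0_atMost_Suc_shift) simp
  qed
  also have "- 2 * ((\<Sum>s = 0..Suc k. real (Suc k - s) * e s * (u ^ s * v ^ (Suc k - s)))
      + (\<Sum>s = 0..Suc k. real s * e s * (u ^ s * v ^ (Suc k - s))))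
     = -2 * (real k + 1) * (\<Sum>s = 0..Suc k. e s * u ^ s * v ^ (Suc k - s))"
    unfolding sum_distrib_left sum.distrib[symmetric]
    by (rule sum.cong[OF refl]) (auto simp: of_nat_diff algebra_simps)
  also have "(\<Sum>s = 0..Suc k. e s * u ^ s * v ^ (Suc k - s)) = jacobi (k + 1) (\<alpha> - 1) (\<beta> - 1) x"
    unfolding jacobi_def e_def u_def v_def by (simp add: add.commute[of _ \<alpha>] add.commute[of _ \<beta>])
  finally show ?thesis .
qed

text \<open>Reversing the summation swaps (x - 1)/2 and (x + 1)/2; the k factors contribute one sign
  each.\<close>

lemma jacobi_minus: "jacobi k \<alpha> \<beta> (- x) = (-1) ^ k * jacobi k \<beta> \<alpha> x"
proof -
  have "jacobi k \<alpha> \<beta> (- x) = (\<Sum>s = 0..k. ((real k + \<alpha>) gchoose s) * ((real k + \<beta>) gchoose (k - s))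
        * ((- x - 1) / 2) ^ (k - s) * ((- x + 1) / 2) ^ s)"
    unfolding jacobi_def
    by (rule sum.reindex_bij_witness[of _ "\<lambda>s. k - s" "\<lambda>s. k - s"]) auto
  also have "\<dots> = (\<Sum>s = 0..k. (-1) ^ k * (((real k + \<beta>) gchoose (k - s)) * ((real k + \<alpha>) gchoose s)
        * ((x - 1) / 2) ^ s * ((x + 1) / 2) ^ (k - s)))"
  proof (rule sum.cong[OF refl], goal_cases)
    case (1 s)
    have "(- x - 1) / 2 = (-1) * ((x + 1) / 2)" "(- x + 1) / 2 = (-1) * ((x - 1) / 2)"
      by (simp_all add: field_simps)
    then have "((- x - 1) / 2) ^ (k - s) * ((- x + 1) / 2) ^ s
       = (-1) ^ (k - s) * (-1) ^ s * ((x + 1) / 2) ^ (k - s) * ((x - 1) / 2) ^ s"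
      by (simp only: power_mult_distrib mult_ac)
    also have "(-1) ^ (k - s) * (-1) ^ s = ((-1) ^ k :: real)"
      using 1 by (simp flip: power_add)
    finally show ?case by (simp add: mult_ac)
  qed
  finally show ?thesis unfolding jacobi_def by (simp add: sum_distrib_left)
qed

lemma jacobi_at_1: "jacobi k \<alpha> \<beta> 1 = ((real k + \<alpha>) gchoose k)"
proof -
  have "jacobi k \<alpha> \<beta> 1 = (\<Sum>s = 0..k. if s = 0 then ((real k + \<alpha>) gchoose k) else 0)"
    unfolding jacobi_def by (rule sum.cong) auto
  then show ?thesis by simp
qed

text \<open>Eliminating \<open>a\<^sub>1\<close> from the mode equations leaves this system for \<open>(a\<^sub>0, a\<^sub>2)\<close>.\<close>

abbreviation mode_coupling :: "nat \<Rightarrow> nat \<Rightarrow> real" where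
  "mode_coupling p l \<equiv> real l * (real l + 1) / (2 * real p)"

abbreviation mode_system_at ::
  "nat \<Rightarrow> nat \<Rightarrow> (real \<Rightarrow> complex) \<Rightarrow> (real \<Rightarrow> complex) \<Rightarrow> real \<Rightarrow> complex \<Rightarrow> complex \<Rightarrow> bool" where
  "mode_system_at p l f g t f' g' \<equiv>
     (f has_vector_derivative f') (at t) \<and> (g has_vector_derivative g') (at t) \<and>
     (1 + t) *\<^sub>R f' = (real p - 1) *\<^sub>R f t - mode_coupling p l *\<^sub>R ((1 + t) *\<^sub>R f t + (1 - t) *\<^sub>R g t) \<and>
     (1 - t) *\<^sub>R g' = - (real p - 1) *\<^sub>R g t + mode_coupling p l *\<^sub>R ((1 + t) *\<^sub>R f t + (1 - t) *\<^sub>R g t)"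

text \<open>Only the open interval is asked for, since the coefficients are merely known to be
  differentiable there.\<close>

definition mode_system :: "nat \<Rightarrow> nat \<Rightarrow> (real \<Rightarrow> complex) \<Rightarrow> (real \<Rightarrow> complex) \<Rightarrow> bool" where
  "mode_system p l f g \<longleftrightarrow> (\<forall>t. -1 < t \<and> t < 1 \<longrightarrow> (\<exists>f' g'. mode_system_at p l f g t f' g'))"

text \<open>Time reversal exchanges the two components and fixes their combination (1 + t) f + (1 -
  t) g up to reflection. It turns the first column of X into the second.\<close>

lemma mode_system_reflect:
  assumes "mode_system p l f g"
  shows "mode_system p l (\<lambda>t. g (- t)) (\<lambda>t. f (- t))"
  unfolding mode_system_def
proof safe
  fix t :: real assume "-1 < t" "t < 1"
  then have "-1 < - t" "- t < 1" by auto
  with assms obtain f' g' where *: "(f has_vector_derivative f') (at (- t))"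
      "(g has_vector_derivative g') (at (- t))"
      "(1 - t) *\<^sub>R f' = (real p - 1) *\<^sub>R f (- t)
        - mode_coupling p l *\<^sub>R ((1 - t) *\<^sub>R f (- t) + (1 + t) *\<^sub>R g (- t))"
      "(1 + t) *\<^sub>R g' = - (real p - 1) *\<^sub>R g (- t)
        + mode_coupling p l *\<^sub>R ((1 - t) *\<^sub>R f (- t) + (1 + t) *\<^sub>R g (- t))"
    unfolding mode_system_def by (auto dest!: spec[of _ "- t"])
  have m: "(uminus has_vector_derivative -1) (at t)" for t :: real
    by (auto intro!: derivative_eq_intros simp flip: has_real_derivative_iff_has_vector_derivative)
  have "((\<lambda>t. g (- t)) has_vector_derivative - g') (at t)"
       "((\<lambda>t. f (- t)) has_vector_derivative - f') (at t)"
    using vector_diff_chain_at[OF m *(1)] vector_diff_chain_at[OF m *(2)] by (simp_all add: o_def)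
  then show "\<exists>f' g'. mode_system_at p l (\<lambda>t. g (- t)) (\<lambda>t. f (- t)) t f' g'"
    using *(3,4)
    by (intro exI[of _ "- g'"] exI[of _ "- f'"]) (auto simp: algebra_simps)
qed

lemma Q3_minus: "(-1) ^ (l + 1) * Q3 p l (- t)
    = ((1 - t) / 2) ^ (p - 1) * jacobi (l + 1) (real p - 1) (- real p - 1) t"
  unfolding Q3_def jacobi_minus by (simp flip: power_mult_distrib)

text \<open>The polynomials \<open>f\<close>, \<open>h\<close>, \<open>g\<close> form a ladder:
  degrees l - 1, l, l + 1 with parameters (p+1, -p+1), (p, -p), (p-1, -p-1). Differentiation
  descends the ladder and \<open>jacobi_raise\<close> climbs it. The middle rung plays the role of
  the eliminated \<open>a 1\<close>, being proportional to it after multiplication by ((1 -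
  t)/2)^p.\<close>

lemma mode_system_column1:
  assumes "1 \<le> l" "l < p"
  shows "mode_system p l (\<lambda>t. of_real (Q1 p l t)) (\<lambda>t. of_real ((-1) ^ (l + 1) * Q3 p l (- t)))"
  unfolding mode_system_def Q3_minus
proof safe
  fix t :: real assume t: "-1 < t" "t < 1"
  obtain j where p: "p = Suc j" and j: "j > 0" using assms by (cases p) auto
  define f g h where "f = jacobi (l - 1) (real p + 1) (- real p + 1)"
    and "g = jacobi (l + 1) (real p - 1) (- real p - 1)" and "h = jacobi l (real p) (- real p)"
  have df: "\<exists>d. (f has_real_derivative d) (at t)"
    unfolding f_def using jacobi_has_derivative_raw by blast
  then obtain f' where f': "(f has_real_derivative f') (at t)" ..
  have h': "(h has_real_derivative (real l + 1) / 2 * f t) (at t)"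
    unfolding h_def f_def using jacobi_has_derivative[of l "real p" "- real p" t] assms by simp
  have g': "(g has_real_derivative real l / 2 * h t) (at t)"
    unfolding h_def g_def using jacobi_has_derivative[of "l + 1" "real p - 1" "- real p - 1" t] by simp
  have r1: "(1 - t\<^sup>2) * f' + ((1 - real p) * (1 - t) - (real p + 1) * (1 + t)) * f t = - 2 * real l * h t"
    using jacobi_raise[of "l-1" "real p + 1" "- real p + 1", folded f_def, OF f'] assms
    by (simp add: h_def of_nat_diff add.commute)
  have r2: "(1 - t\<^sup>2) * ((real l + 1) / 2 * f t) + (- real p * (1 - t) - real p * (1 + t)) * h t
      = - 2 * (real l + 1) * g t"
    using jacobi_raise[of "l" "real p" "- real p", folded h_def, OF h'] by (simp add: g_def)
  define y0 y2 where "y0 = (\<lambda>t. ((1 - t) / 2) ^ (p + 1) * f t)" and "y2 = (\<lambda>t. ((1 - t) / 2) ^ (p - 1) * g t)"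
  define w where "w = ((1 - t) / 2) ^ j"
  define w1 where "w1 = ((1 - t) / 2) ^ (j - 1)"
  have w: "w = (1 - t) / 2 * w1" unfolding w_def w1_def using j by (cases j) auto
  define d0 d2 where "d0 = - (real p + 1) / 2 * ((1 - t) / 2 * w) * f t + ((1 - t) / 2)^2 * w * f'"
    and "d2 = - (real p - 1) / 2 * w1 * g t + w * (real l / 2 * h t)"
  have D0: "(y0 has_real_derivative d0) (at t)"
    unfolding y0_def d0_def
    by (rule derivative_eq_intros f' refl | simp add: p w_def power2_eq_square field_simps)+
  have D2: "(y2 has_real_derivative d2) (at t)"
    unfolding y2_def d2_def
    by (rule derivative_eq_intros g' refl | simp add: p w_def w1_def field_simps)+
  have Y: "y0 t = ((1 - t) / 2)^2 * w * f t" "y2 t = w * g t"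
    unfolding y0_def y2_def w_def p by (simp_all add: power2_eq_square)
  define S where "S = (1 + t) * y0 t + (1 - t) * y2 t"
  have pp: "real p > 0" using p by simp
  \<comment> \<open>Because the parameters of \<open>h\<close> are opposite, the linear coefficient
    in \<open>r2\<close> collapses to the constant -2p, so \<open>f\<close> and \<open>g\<close>
    combine to a multiple of \<open>h\<close> alone.\<close>
  have S: "mode_coupling p l * S = (1 - t) * w * (real l / 2 * h t)"
  proof -
    have "2 * (real l + 1) * (4 * g t + (1 - t\<^sup>2) * f t) = 8 * real p * h t"
    proof -
      have "2 * (real l + 1) * (4 * g t + (1 - t\<^sup>2) * f t)
        = 4 * ((1 - t\<^sup>2) * ((real l + 1) / 2 * f t) + 2 * (real l + 1) * g t)"
        by (simp add: field_simps)
      also have "(1 - t\<^sup>2) * ((real l + 1) / 2 * f t) + 2 * (real l + 1) * g t = 2 * real p * h t"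
        using r2 by (simp add: left_diff_distrib right_diff_distrib distrib_left distrib_right)
      finally show ?thesis by simp
    qed
    moreover have "S = (1 - t) * w / 4 * (4 * g t + (1 - t\<^sup>2) * f t)"
      unfolding S_def Y by (simp add: field_simps power2_eq_square)
    ultimately have "2 * (real l + 1) * S = (1 - t) * w / 4 * (8 * real p * h t)"
      by (metis mult.left_commute)
    then have e: "2 * (real l + 1) * S = 2 * real p * ((1 - t) * w * h t)" by simp
    have "mode_coupling p l * S = real l / (4 * real p) * (2 * (real l + 1) * S)"
      using pp by (simp add: field_simps)
    then show ?thesis unfolding e using pp by simp
  qed
  have E2: "(1 - t) * d2 = - (real p - 1) * y2 t + mode_coupling p l * S"
    unfolding S d2_def Y unfolding w by (simp add: field_simps)
  have E0: "(1 + t) * d0 = (real p - 1) * y0 t - mode_coupling p l * S"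
  proof -
    have "(1 + t) * d0 - (real p - 1) * y0 t + (1 - t) * w * (real l / 2 * h t)
      = (1 - t) * w / 4 * ((1 - t\<^sup>2) * f' + ((1 - real p) * (1 - t) - (real p + 1) * (1 + t)) * f t + 2 * real l * h t)"
      unfolding d0_def Y by (simp add: field_simps power2_eq_square)
    then show ?thesis unfolding S r1 by simp
  qed
  let ?f = "\<lambda>t. complex_of_real (Q1 p l t)"
  let ?g = "\<lambda>t. complex_of_real (((1 - t) / 2) ^ (p - 1) * jacobi (l + 1) (real p - 1) (- real p - 1) t)"
  have F0: "(?f has_vector_derivative of_real d0) (at t)"
    using D0 unfolding y0_def Q1_def f_def
    by (intro has_vector_derivative_of_real) (simp add: has_real_derivative_iff_has_vector_derivative)
  have F2: "(?g has_vector_derivative of_real d2) (at t)"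
    using D2 unfolding y2_def g_def
    by (intro has_vector_derivative_of_real) (simp add: has_real_derivative_iff_has_vector_derivative)
  show "\<exists>f' g'. mode_system_at p l ?f ?g t f' g'"
    using F0 F2 arg_cong[OF E0, of complex_of_real] arg_cong[OF E2, of complex_of_real]
    unfolding S_def y0_def y2_def Q1_def f_def g_def
    by (intro exI[of _ "of_real d0"] exI[of _ "of_real d2"]) (simp add: scaleR_conv_of_real)
qed

lemma mode_system_column2:
  assumes "1 \<le> l" "l < p"
  shows "mode_system p l (\<lambda>t. of_real ((-1) ^ (l + 1) * Q3 p l t)) (\<lambda>t. of_real (Q1 p l (- t)))"
  using mode_system_reflect[OF mode_system_column1[OF assms]] by simp

text \<open>Abel's formula. The trace of the system is (p-1)/(1+t) - (p-1)/(1-t), since the coupling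
  terms cancel, and its integral gives (1 - t^2)^(p-1) whatever l is. The proof shows that the
  quotient by this power has zero derivative.\<close>

lemma mode_system_wronskian:
  assumes "mode_system p l f1 g1" "mode_system p l f2 g2" "1 \<le> p" "-1 < t" "t < 1"
  shows "f1 t * g2 t - f2 t * g1 t = (f1 0 * g2 0 - f2 0 * g1 0) * of_real ((1 - t\<^sup>2) ^ (p - 1))"
proof -
  define W where "W = (\<lambda>t. f1 t * g2 t - f2 t * g1 t)"
  define w where "w = (\<lambda>t::real. (1 - t\<^sup>2) ^ (p - 1))"
  have pos: "1 - s\<^sup>2 > 0" if "-1 < s" "s < 1" for s :: real
    using that by (simp add: abs_square_less_1 abs_less_iff)
  have "((\<lambda>s. W s / of_real (w s)) has_vector_derivative 0) (at s)" if s: "-1 < s" "s < 1" for s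
  proof -
    define c where "c = real l * (real l + 1) / (2 * real p)"
    obtain f1' g1' where 1: "(f1 has_vector_derivative f1') (at s)" "(g1 has_vector_derivative g1') (at s)"
      "(1 + s) *\<^sub>R f1' = (real p - 1) *\<^sub>R f1 s - c *\<^sub>R ((1 + s) *\<^sub>R f1 s + (1 - s) *\<^sub>R g1 s)"
      "(1 - s) *\<^sub>R g1' = - (real p - 1) *\<^sub>R g1 s + c *\<^sub>R ((1 + s) *\<^sub>R f1 s + (1 - s) *\<^sub>R g1 s)"
      using assms(1) s unfolding mode_system_def c_def by blast
    obtain f2' g2' where 2: "(f2 has_vector_derivative f2') (at s)" "(g2 has_vector_derivative g2') (at s)"
      "(1 + s) *\<^sub>R f2' = (real p - 1) *\<^sub>R f2 s - c *\<^sub>R ((1 + s) *\<^sub>R f2 s + (1 - s) *\<^sub>R g2 s)"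
      "(1 - s) *\<^sub>R g2' = - (real p - 1) *\<^sub>R g2 s + c *\<^sub>R ((1 + s) *\<^sub>R f2 s + (1 - s) *\<^sub>R g2 s)"
      using assms(2) s unfolding mode_system_def c_def by blast
    define S :: complex where "S = of_real s"
    define P :: complex where "P = of_nat p"
    define K :: complex where "K = of_real c"
    define W' where "W' = f1 s * g2' + f1' * g2 s - (f2 s * g1' + f2' * g1 s)"
    have dW: "(W has_vector_derivative W') (at s)"
      unfolding W_def W'_def
      by (intro has_vector_derivative_diff has_vector_derivative_mult 1 2)
    have eqs: "(1 + S) * f1' = (P - 1) * f1 s - K * ((1 + S) * f1 s + (1 - S) * g1 s)"
      "(1 - S) * g1' = - (P - 1) * g1 s + K * ((1 + S) * f1 s + (1 - S) * g1 s)"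
      "(1 + S) * f2' = (P - 1) * f2 s - K * ((1 + S) * f2 s + (1 - S) * g2 s)"
      "(1 - S) * g2' = - (P - 1) * g2 s + K * ((1 + S) * f2 s + (1 - S) * g2 s)"
      using 1(3,4) 2(3,4) unfolding S_def P_def K_def by (simp_all add: scaleR_conv_of_real)
    have "(1 - S\<^sup>2) * W' = (1 + S) * (f1 s * ((1 - S) * g2') - f2 s * ((1 - S) * g1'))
        + (1 - S) * (((1 + S) * f1') * g2 s - ((1 + S) * f2') * g1 s)"
      unfolding W'_def by (simp add: algebra_simps power2_eq_square)
    also have "\<dots> = - 2 * S * (P - 1) * W s"
      unfolding eqs W_def by (simp add: algebra_simps power2_eq_square)
    finally have W': "(1 - S\<^sup>2) * W' = - 2 * S * (P - 1) * W s" .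
    define w' where "w' = real (p - 1) * (- 2 * s) * (1 - s\<^sup>2) ^ (p - 1 - 1)"
    have dw: "(w has_real_derivative w') (at s)"
      unfolding w_def w'_def by (rule derivative_eq_intros refl | simp)+
    have ww: "(1 - s\<^sup>2) * w' = - 2 * s * (real p - 1) * w s"
      unfolding w_def w'_def using assms(3) by (cases "p - 1") (auto simp: of_nat_diff)
    have wpos: "w s > 0" unfolding w_def using pos[OF s] by simp
    have nz: "1 - S\<^sup>2 \<noteq> 0" unfolding S_def using pos[OF s]
      by (metis of_real_1 of_real_diff of_real_eq_0_iff of_real_power less_irrefl)
    have "(1 - S\<^sup>2) * (of_real w' :: complex) = - 2 * S * (P - 1) * of_real (w s)"
      using arg_cong[OF ww, of complex_of_real] unfolding S_def P_def by simp
    then have "(1 - S\<^sup>2) * (W' * of_real (w s)) = (1 - S\<^sup>2) * (W s * of_real w')"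
      using W' by (metis mult.assoc mult.commute)
    then have cross: "W' * of_real (w s) = W s * of_real w'" using nz by simp
    have "((\<lambda>s. inverse (w s)) has_real_derivative - inverse (w s) * w' * inverse (w s)) (at s)"
      using DERIV_inverse_fun[OF dw] wpos by (simp add: mult_ac)
    then have "((\<lambda>s. complex_of_real (inverse (w s))) has_vector_derivative
        of_real (- inverse (w s) * w' * inverse (w s))) (at s)"
      by (intro has_vector_derivative_of_real) (simp add: has_real_derivative_iff_has_vector_derivative)
    from has_vector_derivative_mult[OF dW this]
    have "((\<lambda>s. W s * inverse (complex_of_real (w s))) has_vector_derivative
        W s * (- inverse (of_real (w s)) * of_real w' * inverse (of_real (w s))) + W' * inverse (of_real (w s))) (at s)"
      by simp
    moreover have "W s * (- inverse (of_real (w s)) * of_real w' * inverse (of_real (w s))) + W' * inverse (of_real (w s)) = 0"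
      using cross wpos by (simp add: field_simps)
    ultimately show ?thesis unfolding divide_inverse by (simp only:)
  qed
  then have "\<And>s. s \<in> {-1<..<1} \<Longrightarrow> ((\<lambda>s. W s / of_real (w s)) has_vector_derivative 0) (at s within {-1<..<1})"
    by (auto intro: has_vector_derivative_at_within)
  then obtain k where k: "\<And>s. s \<in> {-1<..<1} \<Longrightarrow> W s / of_real (w s) = k"
    using has_vector_derivative_zero_constant[of "{-1<..<1::real}" "\<lambda>s. W s / of_real (w s)"] by auto
  have "W t / of_real (w t) = W 0 / of_real (w 0)" using k[of t] k[of 0] assms by simp
  moreover have "w t > 0" "w 0 = 1" unfolding w_def using pos[of t] assms by simp_all
  ultimately have "W t = W 0 * of_real (w t)" by (simp add: field_simps)
  then show ?thesis unfolding W_def w_def .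
qed

section \<open>Invertibility of the fundamental matrix and solution of the mode system\<close>

lemma gchoose_nonzero: "(\<And>i. i < k \<Longrightarrow> a \<noteq> real i) \<Longrightarrow> a gchoose k \<noteq> 0"
  by (auto simp: gbinomial_prod_rev)

text \<open>If the determinant vanished at 0, it would vanish for all |t| < 1 by the Wronskian
  formula. Dividing by ((1 - t^2)/4)^(p-1) leaves a polynomial expression \<open>G\<close>, whose
  first summand still contains (1 - t^2)^2. At t = 1 only the product of the two end values of
  \<open>R\<close> remains.\<close>

lemma Q_det_nonzero:
  assumes "1 \<le> l" "l < p"
  shows "Q1 p l 0 * Q1 p l 0 - Q3 p l 0 * Q3 p l 0 \<noteq> 0"
proof
  assume 0: "Q1 p l 0 * Q1 p l 0 - Q3 p l 0 * Q3 p l 0 = 0"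
  define f R where "f = jacobi (l - 1) (real p + 1) (- real p + 1)"
    and "R = jacobi (l + 1) (- real p - 1) (real p - 1)"
  have cont: "continuous_on UNIV (jacobi k \<alpha> \<beta>)" for k \<alpha> \<beta>
    unfolding jacobi_def[abs_def] by (intro continuous_intros) auto
  define G where "G = (\<lambda>t. ((1 - t\<^sup>2) / 4)\<^sup>2 * f t * f (- t) - R t * R (- t))"
  have G0: "G t = 0" if t: "t \<in> {0..<1}" for t
  proof -
    have t1: "1 - t\<^sup>2 > 0" using t by (simp add: abs_square_less_1 abs_less_iff)
    have "complex_of_real (Q1 p l t * Q1 p l (- t) - Q3 p l t * Q3 p l (- t))
      = of_real (Q1 p l 0 * Q1 p l 0 - Q3 p l 0 * Q3 p l 0) * of_real ((1 - t\<^sup>2) ^ (p - 1))"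
      using mode_system_wronskian[OF mode_system_column1[OF assms] mode_system_column2[OF assms], of t] assms t
      by (simp add: mult_ac power_mult_distrib[symmetric])
    then have "Q1 p l t * Q1 p l (- t) - Q3 p l t * Q3 p l (- t) = 0"
      unfolding 0 by (metis of_real_0 mult_zero_left of_real_eq_0_iff)
    moreover have "Q1 p l t * Q1 p l (- t) - Q3 p l t * Q3 p l (- t) = ((1 - t\<^sup>2) / 4) ^ (p - 1) * G t"
    proof -
      obtain j where p: "p = Suc j" using assms by (cases p) auto
      have e: "(1 - t\<^sup>2) / 4 = (1 - t) / 2 * ((1 + t) / 2)" by (simp add: field_simps power2_eq_square)
      have Q: "Q1 p l s = ((1 - s) / 2)\<^sup>2 * ((1 - s) / 2) ^ j * f s" "Q3 p l s = ((1 + s) / 2) ^ j * R s" for s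
        unfolding Q1_def Q3_def f_def R_def using p by (simp_all add: power2_eq_square)
      have pj: "p - 1 = j" using p by simp
      define a b u v where "a = (1 - t) / 2" and "b = (1 + t) / 2" and "u = ((1 - t) / 2) ^ j" and "v = ((1 + t) / 2) ^ j"
      show ?thesis unfolding G_def e Q minus_minus diff_minus_eq_add power_mult_distrib pj
        add_uminus_conv_diff a_def[symmetric] b_def[symmetric] u_def[symmetric] v_def[symmetric]
        by (simp add: algebra_simps)
    qed
    ultimately show ?thesis using t1 by simp
  qed
  have "continuous_on {0..1} G"
    unfolding G_def f_def R_def
    by (intro continuous_intros continuous_on_compose2[OF cont] continuous_on_subset[OF cont]) auto
  \<comment> \<open>At t = 1 itself the divided power is zero, so the vanishing of \<open>G\<close>
    has to be carried there by continuity.\<close>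
  then have "G 1 = 0"
    using continuous_constant_on_closure[of "{0..<1}" G 0 1] G0 by simp
  then have "R 1 * R (- 1) = 0" unfolding G_def by simp
  \<comment> \<open>The upper entry of the binomial is l - p < 0 at t = 1 and l + p > l at t = -1;
    neither is one of 0, ..., l.\<close>
  moreover have "R 1 \<noteq> 0" unfolding R_def jacobi_at_1
    by (rule gchoose_nonzero) (use assms in auto)
  moreover have "R (- 1) \<noteq> 0" unfolding R_def jacobi_minus jacobi_at_1
    using gchoose_nonzero[of "l + 1" "real (l + 1) + (real p - 1)"] assms by auto
  ultimately show False by simp
qed

text \<open>No uniqueness theorem for differential equations is invoked. The Wronskians of (f, g)
  with the two columns and of the columns with each other all carry the same factor
  \<open>w\<close>, so Cramer's rule at time t has coefficients independent of t, namely those of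
  the data at 0. Only the second component is recorded, because the constants at future null
  infinity are built from component 2.\<close>

lemma mode_system_solution:
  assumes "mode_system p l f g" "1 \<le> l" "l < p" "-1 < t" "t < 1"
  defines "v \<equiv> matrix_inv (X_mat p l 0) *v vector [f 0, g 0]"
  shows "g t = v $ 1 * of_real ((-1) ^ (l + 1) * Q3 p l (- t)) + v $ 2 * of_real (Q1 p l (- t))"
proof -
  define x1 x2 z1 z2 where "x1 = (\<lambda>t. complex_of_real (Q1 p l t))"
    and "x2 = (\<lambda>t. complex_of_real ((-1) ^ (l + 1) * Q3 p l (- t)))"
    and "z1 = (\<lambda>t. complex_of_real ((-1) ^ (l + 1) * Q3 p l t))"
    and "z2 = (\<lambda>t. complex_of_real (Q1 p l (- t)))"
  have c1: "mode_system p l x1 x2" and c2: "mode_system p l z1 z2"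
    unfolding x1_def x2_def z1_def z2_def
    using mode_system_column1[OF assms(2,3)] mode_system_column2[OF assms(2,3)] by auto
  define w where "w = complex_of_real ((1 - t\<^sup>2) ^ (p - 1))"
  have "1 - t\<^sup>2 > 0" using assms by (simp add: abs_square_less_1 abs_less_iff)
  then have w: "w \<noteq> 0" unfolding w_def of_real_eq_0_iff by simp
  define D where "D = x1 0 * z2 0 - z1 0 * x2 0"
  have De: "D = of_real (Q1 p l 0 * Q1 p l 0 - Q3 p l 0 * Q3 p l 0)"
    unfolding D_def x1_def x2_def z1_def z2_def by (simp add: mult_ac power_mult_distrib[symmetric])
  have D: "D \<noteq> 0" unfolding De of_real_eq_0_iff by (rule Q_det_nonzero[OF assms(2,3)])
  have X: "X_mat p l 0 = vector [vector [x1 0, z1 0], vector [x2 0, z2 0]]"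
    unfolding X_mat_def x1_def x2_def z1_def z2_def by simp
  have "det (X_mat p l 0) = D" unfolding X det_2 D_def by simp
  \<comment> \<open>\<open>matrix_inv\<close> is defined by choice and is an inverse only once the
    determinant is known to be nonzero.\<close>
  then have "invertible (X_mat p l 0)" using D by (simp add: invertible_det_nz)
  then have "X_mat p l 0 ** matrix_inv (X_mat p l 0) = mat 1"
    unfolding invertible_def matrix_inv_def by (rule someI2_ex) auto
  then have "X_mat p l 0 *v v = vector [f 0, g 0]"
    unfolding v_def by (simp add: matrix_vector_mul_assoc)
  then have "(X_mat p l 0 *v v) $ 1 = f 0" "(X_mat p l 0 *v v) $ 2 = g 0" by simp_all
  then have fg: "f 0 = x1 0 * v $ 1 + z1 0 * v $ 2" "g 0 = x2 0 * v $ 1 + z2 0 * v $ 2"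
    unfolding X matrix_vector_mult_def by (simp_all add: sum_2)
  have p: "1 \<le> p" using assms by simp
  have W1: "f t * z2 t - z1 t * g t = v $ 1 * D * w"
    unfolding mode_system_wronskian[OF assms(1) c2 p assms(4,5)] w_def[symmetric] fg D_def
    by (simp add: algebra_simps)
  have W2: "x1 t * g t - f t * x2 t = v $ 2 * D * w"
    unfolding mode_system_wronskian[OF c1 assms(1) p assms(4,5)] w_def[symmetric] fg D_def
    by (simp add: algebra_simps)
  have W: "x1 t * z2 t - z1 t * x2 t = D * w"
    unfolding mode_system_wronskian[OF c1 c2 p assms(4,5)] w_def[symmetric] D_def ..
  have "D * w * g t = x2 t * (f t * z2 t - z1 t * g t) + z2 t * (x1 t * g t - f t * x2 t)"
    unfolding W[symmetric] by (simp add: algebra_simps)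
  also have "\<dots> = D * w * (v $ 1 * x2 t + v $ 2 * z2 t)"
    unfolding W1 W2 by (simp add: algebra_simps)
  finally show ?thesis using D w unfolding x2_def z2_def by simp
qed

section \<open>Associated Legendre functions\<close>

text \<open>The index k counts derivatives. Order m corresponds to k = l + m, and k = l gives 2^l l!
  times the Legendre polynomial.\<close>

definition legendre_poly :: "nat \<Rightarrow> nat \<Rightarrow> real poly" where
  "legendre_poly l k = (pderiv ^^ k) ([:-1, 0, 1:] ^ l)"

lemma legendre_poly_Suc: "legendre_poly l (Suc k) = pderiv (legendre_poly l k)"
  by (simp add: legendre_poly_def)

text \<open>The power u = (x^2 - 1)^l satisfies (x^2 - 1) u' = 2 l x u. Differentiating this
  identity once gives k = 0, and each further differentiation raises k by one.\<close>

lemma legendre_poly_ode: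
  "(x\<^sup>2 - 1) * poly (legendre_poly l (k + 2)) x
   + (2 * (real k + 1) - 2 * real l) * x * poly (legendre_poly l (k + 1)) x
   + (real k + 1) * (real k - 2 * real l) * poly (legendre_poly l k) x = 0"
proof -
  let ?D = "legendre_poly l"
  have "[:-1, 0, 1:] * ?D (k + 2) + [:0, 2 * (real k + 1) - 2 * real l:] * ?D (k + 1)
    + [:(real k + 1) * (real k - 2 * real l):] * ?D k = 0"
  proof (induction k)
    case 0
    have "[:-1, 0, 1:] * pderiv ([:-1, 0, 1:] ^ l) = [:0, 2 * real l:] * ([:-1, 0, 1::real:] ^ l)"
    proof (cases l)
      case (Suc j)
      show ?thesis unfolding Suc pderiv_power_Suc
        by (rule poly_eq_poly_eq_iff[THEN iffD1], rule ext) (simp add: pderiv_pCons algebra_simps)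
    qed simp
    then have "pderiv ([:-1, 0, 1:] * ?D 1) = pderiv ([:0, 2 * real l:] * ?D 0)"
      by (simp add: legendre_poly_def)
    then have "poly (pderiv ([:-1, 0, 1:] * ?D 1)) x = poly (pderiv ([:0, 2 * real l:] * ?D 0)) x" for x
      by simp
    then have "poly ([:-1, 0, 1:] * ?D (0 + 2) + [:0, 2 * (real 0 + 1) - 2 * real l:] * ?D (0 + 1)
      + [:(real 0 + 1) * (real 0 - 2 * real l):] * ?D 0) x = poly 0 x" for x
      by (simp add: pderiv_mult pderiv_add pderiv_diff pderiv_smult pderiv_pCons legendre_poly_Suc numeral_2_eq_2 algebra_simps)
    then show ?case by (intro poly_eq_poly_eq_iff[THEN iffD1] ext)
  next
    case (Suc k)
    let ?P = "[:-1, 0, 1:] * ?D (k + 2) + [:0, 2 * (real k + 1) - 2 * real l:] * ?D (k + 1)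
        + [:(real k + 1) * (real k - 2 * real l):] * ?D k"
    have "poly (pderiv ?P) x = 0" for x using Suc.IH by simp
    then have "poly ([:-1, 0, 1:] * ?D (Suc k + 2) + [:0, 2 * (real (Suc k) + 1) - 2 * real l:] * ?D (Suc k + 1)
      + [:(real (Suc k) + 1) * (real (Suc k) - 2 * real l):] * ?D (Suc k)) x = poly 0 x" for x
      by (simp add: pderiv_mult pderiv_add pderiv_diff pderiv_pCons pderiv_smult legendre_poly_Suc numeral_2_eq_2 algebra_simps)
    then show ?case by (intro poly_eq_poly_eq_iff[THEN iffD1] ext)
  qed
  from arg_cong[OF this, of "\<lambda>p. poly p x"] show ?thesis
    by (simp add: algebra_simps power2_eq_square)
qed

text \<open>Each differentiation costs at most one factor. For negative m the surviving factors are
  what compensates the negative power of the sine.\<close>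

lemma power_dvd_higher_pderiv:
  fixes p :: "real poly"
  shows "k \<le> l \<Longrightarrow> p ^ (l - k) dvd (pderiv ^^ k) (p ^ l)"
proof (induction k)
  case (Suc k)
  then have "p ^ (l - k) dvd (pderiv ^^ k) (p ^ l)" by simp
  then obtain r where r: "(pderiv ^^ k) (p ^ l) = p ^ Suc (l - Suc k) * r"
    using Suc.prems by (metis Suc_diff_Suc Suc_le_lessD dvdE)
  show ?case
    by (simp add: r pderiv_mult pderiv_power_Suc del: power_Suc)
      (intro dvd_add dvd_smult dvd_mult dvd_mult2 dvd_refl, auto simp: algebra_simps intro: dvd_mult2 dvd_mult)
qed simp

section \<open>The Legendre equation and regularity at the poles\<close>

definition leg_norm :: "nat \<Rightarrow> int \<Rightarrow> real" where
  "leg_norm l m = sqrt ((2 * real l + 1) / (4 * pi) * fact (nat (int l - m)) / fact (nat (int l + m)))"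

definition leg :: "nat \<Rightarrow> int \<Rightarrow> real \<Rightarrow> real" where
  "leg l m t = leg_norm l m * assoc_legendre_cos l m t"

definition dleg :: "nat \<Rightarrow> int \<Rightarrow> real \<Rightarrow> real" where
  "dleg l m t = leg_norm l m * ((-1) powi m / (2 ^ l * fact l)) *
     (of_int m * sin t powi (m - 1) * cos t * poly (legendre_poly l (nat (int l + m))) (cos t)
      - sin t powi (m + 1) * poly (legendre_poly l (Suc (nat (int l + m)))) (cos t))"

lemma leg_eq: "leg l m t = leg_norm l m * ((-1) powi m / (2 ^ l * fact l)) *
     (sin t powi m * poly (legendre_poly l (nat (int l + m))) (cos t))"
  by (simp add: leg_def assoc_legendre_cos_def legendre_poly_def)

lemma leg_has_derivative:
  assumes "0 < t" "t < pi"
  shows "(leg l m has_real_derivative dleg l m t) (at t)"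
proof -
  have s: "sin t > 0" using assms by (rule sin_gt_zero)
  have e: "sin t powi (m + 1) = sin t powi m * sin t" using s by (simp add: power_int_add_1)
  show ?thesis unfolding leg_eq[abs_def] dleg_def e legendre_poly_Suc
    by (rule derivative_eq_intros refl | use s in \<open>simp add: algebra_simps\<close>)+
qed

text \<open>The associated Legendre equation in Sturm-Liouville form, the form in which it enters
  integrations by parts. It is \<open>legendre_poly_ode\<close> at x = cos t and k = l + m,
  rewritten with x^2 = 1 - (sin t)^2.\<close>

lemma sin_dleg_has_derivative:
  assumes "0 < t" "t < pi" "\<bar>m\<bar> \<le> int l"
  shows "((\<lambda>t. sin t * dleg l m t) has_real_derivative
     ((of_int m)\<^sup>2 / sin t - real l * (real l + 1) * sin t) * leg l m t) (at t)"
proof -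
  have s: "sin t > 0" using assms by (intro sin_gt_zero)
  define k where "k = nat (int l + m)"
  have k: "real k = real l + of_int m" using assms(3) unfolding k_def by simp
  define K where "K = leg_norm l m * ((-1) powi m / (2 ^ l * fact l))"
  define z where "z = sin t powi (m - 1)"
  define A B C where "A = poly (legendre_poly l k) (cos t)" and "B = poly (legendre_poly l (Suc k)) (cos t)"
    and "C = poly (legendre_poly l (Suc (Suc k))) (cos t)"
  have pw: "sin t powi m = z * sin t" "sin t powi (m + 1) = z * sin t ^ 2" "sin t powi (m + 2) = z * sin t ^ 3"
    unfolding z_def using s power_int_add[of "sin t" "m - 1" 1] power_int_add[of "sin t" "m - 1" 2]
      power_int_add[of "sin t" "m - 1" 3] by (simp_all add: algebra_simps)
  have eq: "sin t * dleg l m t = K * (of_int m * sin t powi m * cos t * poly (legendre_poly l k) (cos t)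
      - sin t powi (m + 2) * poly (legendre_poly l (Suc k)) (cos t))" if "t \<in> {0<..<pi}" for t
  proof -
    have st: "sin t > 0" using that by (auto intro: sin_gt_zero)
    have a: "sin t powi m = sin t powi (m - 1) * sin t" "sin t powi (m + 2) = sin t powi (m + 1) * sin t"
      using st power_int_add[of "sin t" "m - 1" 1] power_int_add[of "sin t" "m + 1" 1]
      by (simp_all add: algebra_simps)
    show ?thesis unfolding dleg_def k_def[symmetric] K_def[symmetric] a by (simp add: algebra_simps)
  qed
  have "((\<lambda>t. K * (of_int m * sin t powi m * cos t * poly (legendre_poly l k) (cos t)
      - sin t powi (m + 2) * poly (legendre_poly l (Suc k)) (cos t))) has_real_derivative
     K * ((of_int m * (of_int m * sin t powi (m - 1) * cos t) * cos t * A + of_int m * sin t powi m * (- sin t) * A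
         + of_int m * sin t powi m * cos t * (B * (- sin t)))
      - ((of_int m + 2) * sin t powi (m + 1) * cos t * B + sin t powi (m + 2) * (C * (- sin t))))) (at t)"
    unfolding A_def B_def C_def legendre_poly_Suc
    by (rule derivative_eq_intros refl | use s in \<open>simp add: algebra_simps\<close>)+
  note this[unfolded pw, folded z_def]
  moreover have "K * ((of_int m * (of_int m * z * cos t) * cos t * A + of_int m * (z * sin t) * (- sin t) * A
         + of_int m * (z * sin t) * cos t * (B * (- sin t)))
      - ((of_int m + 2) * (z * sin t ^ 2) * cos t * B + z * sin t ^ 3 * (C * (- sin t))))
      = ((of_int m)\<^sup>2 / sin t - real l * (real l + 1) * sin t) * leg l m t"
  proof -
    define M :: real where "M = of_int m"
    define L :: real where "L = real l"
    define x where "x = cos t"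
    define y where "y = sin t"
    have xy: "x\<^sup>2 = 1 - y\<^sup>2" unfolding x_def y_def by (simp add: cos_squared_eq)
    have ode: "y\<^sup>2 * C = 2 * (M + 1) * x * B + (L + M + 1) * (M - L) * A"
      using legendre_poly_ode[of x l k] xy unfolding k A_def B_def C_def M_def L_def x_def
      by (simp add: algebra_simps)
    have "leg l m t = K * (z * y * A)" unfolding leg_eq K_def k_def[symmetric] A_def pw y_def by simp
    then have R: "(M\<^sup>2 / y - L * (L + 1) * y) * leg l m t = K * (z * ((M\<^sup>2 - L * (L + 1) * y\<^sup>2) * A))"
      using s unfolding y_def[symmetric] by (simp add: field_simps power2_eq_square)
    have "(M * (M * z * x) * x * A + M * (z * y) * (- y) * A + M * (z * y) * x * (B * (- y)))
      - ((M + 2) * (z * y ^ 2) * x * B + z * y ^ 3 * (C * (- y)))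
      = z * (M\<^sup>2 * x\<^sup>2 * A - M * y\<^sup>2 * A - (2 * M + 2) * y\<^sup>2 * x * B + y\<^sup>2 * (y\<^sup>2 * C))"
      by (simp add: algebra_simps power2_eq_square power3_eq_cube)
    also have "\<dots> = z * ((M\<^sup>2 - L * (L + 1) * y\<^sup>2) * A)"
      unfolding ode xy by (simp add: algebra_simps power2_eq_square)
    finally show ?thesis unfolding M_def[symmetric] L_def[symmetric] x_def[symmetric] y_def[symmetric] R
      by (rule arg_cong)
  qed
  ultimately have "((\<lambda>t. K * (of_int m * sin t powi m * cos t * poly (legendre_poly l k) (cos t)
      - sin t powi (m + 2) * poly (legendre_poly l (Suc k)) (cos t))) has_real_derivative
     ((of_int m)\<^sup>2 / sin t - real l * (real l + 1) * sin t) * leg l m t) (at t)" by simp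
  then show ?thesis
    by (rule has_field_derivative_transform_within_open[of _ _ _ "{0<..<pi}"]) (use assms eq in auto)
qed

text \<open>The second derivative as the Legendre equation expresses it, so that no polynomial
  beyond those in \<open>leg\<close> and \<open>dleg\<close> appears.\<close>

definition d2leg :: "nat \<Rightarrow> int \<Rightarrow> real \<Rightarrow> real" where
  "d2leg l m t = ((of_int m)\<^sup>2 / (sin t)\<^sup>2 - real l * (real l + 1)) * leg l m t - cot t * dleg l m t"

lemma dleg_has_derivative:
  assumes "0 < t" "t < pi" "\<bar>m\<bar> \<le> int l"
  shows "(dleg l m has_real_derivative d2leg l m t) (at t)"
proof -
  have s: "sin t > 0" using assms by (intro sin_gt_zero)
  have "((\<lambda>t. sin t * dleg l m t / sin t) has_real_derivative d2leg l m t) (at t)"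
    by (rule DERIV_cong[OF DERIV_divide[OF sin_dleg_has_derivative[OF assms] DERIV_sin]])
      (use s in \<open>simp_all add: d2leg_def cot_def field_simps power2_eq_square\<close>)
  then show ?thesis
    by (rule has_field_derivative_transform_within_open[of _ _ _ "{0<..<pi}"])
      (use assms sin_gt_zero in \<open>auto simp: less_imp_neq[symmetric]\<close>)
qed

text \<open>For m >= 0 this is Rodrigues' formula. For m < 0 the polynomial contains (x^2 - 1)^|m|,
  which at x = cos t is (-1)^|m| (sin t)^(2|m|) and turns (sin t)^(-|m|) into (sin t)^|m|.\<close>

lemma leg_representation:
  assumes "\<bar>m\<bar> \<le> int l"
  obtains q :: "real poly" where
    "\<And>t. 0 < t \<Longrightarrow> t < pi \<Longrightarrow> leg l m t = sin t ^ nat \<bar>m\<bar> * poly q (cos t)"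
    "\<And>t. 0 < t \<Longrightarrow> t < pi \<Longrightarrow> dleg l m t = real (nat \<bar>m\<bar>) * sin t ^ (nat \<bar>m\<bar> - 1) * cos t * poly q (cos t)
        - sin t ^ Suc (nat \<bar>m\<bar>) * poly (pderiv q) (cos t)"
proof -
  define j where "j = nat \<bar>m\<bar>"
  define K where "K = leg_norm l m * ((-1) powi m / (2 ^ l * fact l))"
  have "\<exists>q. \<forall>t. 0 < t \<and> t < pi \<longrightarrow> leg l m t = sin t ^ j * poly q (cos t)"
  proof (cases "m \<ge> 0")
    case True
    then have "leg l m t = sin t ^ j * poly (smult K (legendre_poly l (nat (int l + m)))) (cos t)" for t
      unfolding leg_eq K_def[symmetric] j_def by (simp add: power_int_def)
    then show ?thesis by blast
  next
    case False
    then have k: "nat (int l + m) = l - j" "j \<le> l" unfolding j_def using assms by auto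
    then obtain r where r: "legendre_poly l (l - j) = [:-1, 0, 1:] ^ j * r"
      using power_dvd_higher_pderiv[of "l - j" l "[:-1,0,1:]"] unfolding legendre_poly_def
      by (auto elim!: dvdE)
    have "leg l m t = sin t ^ j * poly (smult (K * (-1) ^ j) r) (cos t)" if "0 < t" "t < pi" for t
    proof -
      have s: "sin t > 0" using that by (intro sin_gt_zero)
      have "poly [:-1, 0, 1:] (cos t) = - (sin t * sin t)"
        using sin_cos_squared_add[of t] by (simp add: power2_eq_square algebra_simps)
      then have "poly ([:-1, 0, 1:] ^ j) (cos t) = (- (sin t * sin t)) ^ j"
        by (simp only: poly_power)
      also have "\<dots> = (-1) ^ j * sin t ^ j * sin t ^ j"
        by (simp add: power_minus[of "sin t * sin t"] power_mult_distrib mult.assoc)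
      finally have "poly ([:-1, 0, 1:] ^ j) (cos t) = (-1) ^ j * sin t ^ j * sin t ^ j" .
      moreover have "sin t powi m = inverse (sin t ^ j)"
        using False unfolding j_def by (simp add: power_int_def power_inverse)
      ultimately show ?thesis unfolding leg_eq k r K_def[symmetric] using s by simp
    qed
    then show ?thesis by blast
  qed
  then obtain q where q: "\<And>t. 0 < t \<Longrightarrow> t < pi \<Longrightarrow> leg l m t = sin t ^ j * poly q (cos t)" by blast
  have "dleg l m t = real j * sin t ^ (j - 1) * cos t * poly q (cos t)
        - sin t ^ Suc j * poly (pderiv q) (cos t)" if t: "0 < t" "t < pi" for t
  proof -
    have "((\<lambda>t. sin t ^ j * poly q (cos t)) has_real_derivative (real j * sin t ^ (j - 1) * cos t * poly q (cos t)
        - sin t ^ Suc j * poly (pderiv q) (cos t))) (at t)"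
      by (rule derivative_eq_intros refl | simp)+
    moreover have "((\<lambda>t. sin t ^ j * poly q (cos t)) has_real_derivative dleg l m t) (at t)"
      by (rule has_field_derivative_transform_within_open[OF leg_has_derivative[OF t], of "{0<..<pi}"])
        (use t q in auto)
    ultimately show ?thesis using DERIV_unique by blast
  qed
  with q show ?thesis using that unfolding j_def by blast
qed

text \<open>
  At the poles \<open>1 / sin t\<close> has the junk value \<open>0\<close>, so the boundary values needed for integration by parts
  come from a continuous extension rather than from the functions themselves.
\<close>

definition cont_ext :: "(real \<Rightarrow> real) \<Rightarrow> bool" where
  "cont_ext f \<longleftrightarrow> (\<exists>g. continuous_on {0..pi} g \<and> (\<forall>t\<in>{0<..<pi}. f t = g t))"

definition vanishing_ext :: "(real \<Rightarrow> real) \<Rightarrow> bool" where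
  "vanishing_ext f \<longleftrightarrow> (\<exists>g. continuous_on {0..pi} g \<and> g 0 = 0 \<and> g pi = 0 \<and> (\<forall>t\<in>{0<..<pi}. f t = g t))"

lemma cont_ext_continuous: "continuous_on {0..pi} f \<Longrightarrow> cont_ext f"
  by (auto simp: cont_ext_def)

lemma cont_ext_diff:
  assumes "cont_ext f" "cont_ext g" shows "cont_ext (\<lambda>x. f x - g x)"
proof -
  from assms obtain f' g' where "continuous_on {0..pi} f'" "continuous_on {0..pi} g'"
    "\<forall>x\<in>{0<..<pi}. f x = f' x" "\<forall>x\<in>{0<..<pi}. g x = g' x" unfolding cont_ext_def vanishing_ext_def by blast
  then show ?thesis unfolding cont_ext_def
    by (intro exI[of _ "\<lambda>x. f' x - g' x"]) (auto intro!: continuous_intros)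
qed

lemma cont_ext_mult:
  assumes "cont_ext f" "cont_ext g" shows "cont_ext (\<lambda>x. f x * g x)"
proof -
  from assms obtain f' g' where "continuous_on {0..pi} f'" "continuous_on {0..pi} g'"
    "\<forall>x\<in>{0<..<pi}. f x = f' x" "\<forall>x\<in>{0<..<pi}. g x = g' x" unfolding cont_ext_def vanishing_ext_def by blast
  then show ?thesis unfolding cont_ext_def
    by (intro exI[of _ "\<lambda>x. f' x * g' x"]) (auto intro!: continuous_intros)
qed

lemma vanishing_ext_add:
  assumes "vanishing_ext f" "vanishing_ext g" shows "vanishing_ext (\<lambda>x. f x + g x)"
proof -
  from assms obtain f' g' where "continuous_on {0..pi} f'" "continuous_on {0..pi} g'" "f' 0 = 0" "f' pi = 0" "g' 0 = 0" "g' pi = 0"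
    "\<forall>x\<in>{0<..<pi}. f x = f' x" "\<forall>x\<in>{0<..<pi}. g x = g' x" unfolding cont_ext_def vanishing_ext_def by blast
  then show ?thesis unfolding vanishing_ext_def
    by (intro exI[of _ "\<lambda>x. f' x + g' x"]) (auto intro!: continuous_intros)
qed

lemma vanishing_ext_diff:
  assumes "vanishing_ext f" "vanishing_ext g" shows "vanishing_ext (\<lambda>x. f x - g x)"
proof -
  from assms obtain f' g' where "continuous_on {0..pi} f'" "continuous_on {0..pi} g'" "f' 0 = 0" "f' pi = 0" "g' 0 = 0" "g' pi = 0"
    "\<forall>x\<in>{0<..<pi}. f x = f' x" "\<forall>x\<in>{0<..<pi}. g x = g' x" unfolding cont_ext_def vanishing_ext_def by blast
  then show ?thesis unfolding vanishing_ext_def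
    by (intro exI[of _ "\<lambda>x. f' x - g' x"]) (auto intro!: continuous_intros)
qed

lemma vanishing_ext_mult:
  assumes "vanishing_ext f" "cont_ext g" shows "vanishing_ext (\<lambda>x. f x * g x)"
proof -
  from assms obtain f' g' where "continuous_on {0..pi} f'" "continuous_on {0..pi} g'" "f' 0 = 0" "f' pi = 0"
    "\<forall>x\<in>{0<..<pi}. f x = f' x" "\<forall>x\<in>{0<..<pi}. g x = g' x" unfolding cont_ext_def vanishing_ext_def by blast
  then show ?thesis unfolding vanishing_ext_def
    by (intro exI[of _ "\<lambda>x. f' x * g' x"]) (auto intro!: continuous_intros)
qed

lemma cont_ext_integrable:
  assumes "cont_ext f" shows "f integrable_on {0<..<pi}"
proof -
  obtain g where g: "continuous_on {0..pi} g" "\<forall>t\<in>{0<..<pi}. f t = g t"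
    using assms unfolding cont_ext_def by blast
  have "g integrable_on {0..pi}" using g(1) by (rule integrable_continuous_interval)
  then have "g integrable_on {0<..<pi}" unfolding integrable_on_def has_integral_Icc_iff_Ioo .
  then show ?thesis using g(2) by (metis integrable_cong)
qed

text \<open>The common pattern of the integral identities below: exhibit a primitive that tends to
  zero at both poles, and the integral of its derivative is zero.\<close>

lemma vanishing_ext_has_integral_0:
  assumes "vanishing_ext H" "\<And>t. 0 < t \<Longrightarrow> t < pi \<Longrightarrow> (H has_real_derivative h t) (at t)"
  shows "(h has_integral 0) {0<..<pi}"
proof -
  obtain g where g: "continuous_on {0..pi} g" "g 0 = 0" "g pi = 0" "\<forall>t\<in>{0<..<pi}. H t = g t"
    using assms(1) unfolding vanishing_ext_def by blast
  have "(g has_real_derivative h t) (at t)" if "t \<in> {0<..<pi}" for t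
    by (rule has_field_derivative_transform_within_open[OF assms(2), of _ "{0<..<pi}"]) (use that g in auto)
  then have "(h has_integral (g pi - g 0)) {0..pi}"
    by (intro fundamental_theorem_of_calculus_interior g)
      (auto simp: has_real_derivative_iff_has_vector_derivative)
  then show ?thesis unfolding g has_integral_Icc_iff_Ioo by simp
qed

text \<open>The factor \<open>of_int m\<close> is essential in the third and fourth claims. If m = 0
  it kills the expression; otherwise \<open>leg l m\<close> has a positive power of the sine to
  spare. In the last claim the sine does the same for the derivative.\<close>

lemma leg_extensions:
  assumes "\<bar>m\<bar> \<le> int l"
  shows "cont_ext (leg l m)" "cont_ext (dleg l m)" "cont_ext (\<lambda>t. of_int m * leg l m t / sin t)"
    "vanishing_ext (\<lambda>t. of_int m * leg l m t)" "vanishing_ext (\<lambda>t. sin t * dleg l m t)"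
proof -
  define j where "j = nat \<bar>m\<bar>"
  obtain q where q: "\<And>t. 0 < t \<Longrightarrow> t < pi \<Longrightarrow> leg l m t = sin t ^ j * poly q (cos t)"
    and dq: "\<And>t. 0 < t \<Longrightarrow> t < pi \<Longrightarrow> dleg l m t = real j * sin t ^ (j - 1) * cos t * poly q (cos t)
        - sin t ^ Suc j * poly (pderiv q) (cos t)"
    using leg_representation[OF assms] unfolding j_def by metis
  show "cont_ext (leg l m)" unfolding cont_ext_def
    by (intro exI[of _ "\<lambda>t. sin t ^ j * poly q (cos t)"] conjI)
      (auto intro!: continuous_intros simp: q)
  show "cont_ext (dleg l m)" unfolding cont_ext_def
    by (intro exI[of _ "\<lambda>t. real j * sin t ^ (j - 1) * cos t * poly q (cos t)
        - sin t ^ Suc j * poly (pderiv q) (cos t)"] conjI)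
      (auto intro!: continuous_intros simp: dq)
  show "cont_ext (\<lambda>t. of_int m * leg l m t / sin t)"
  proof (cases "m = 0")
    case True then show ?thesis by (auto intro: cont_ext_continuous)
  next
    case False
    then obtain i where i: "j = Suc i" unfolding j_def by (cases "nat \<bar>m\<bar>") auto
    have "of_int m * leg l m t / sin t = of_int m * (sin t ^ i * poly q (cos t))" if "t \<in> {0<..<pi}" for t
      using that sin_gt_zero[of t] by (simp add: q i)
    then show ?thesis unfolding cont_ext_def
      by (intro exI[of _ "\<lambda>t. of_int m * (sin t ^ i * poly q (cos t))"] conjI)
        (auto intro!: continuous_intros)
  qed
  show "vanishing_ext (\<lambda>t. of_int m * leg l m t)"
    unfolding vanishing_ext_def
    by (intro exI[of _ "\<lambda>t. of_int m * (sin t ^ j * poly q (cos t))"] conjI)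
      (auto intro!: continuous_intros simp: q j_def power_0_left)
  have *: "sin t * dleg l m t = real j * sin t ^ j * cos t * poly q (cos t)
        - sin t ^ Suc (Suc j) * poly (pderiv q) (cos t)" if "t \<in> {0<..<pi}" for t
    using that by (cases j) (auto simp: dq algebra_simps)
  show "vanishing_ext (\<lambda>t. sin t * dleg l m t)"
    unfolding vanishing_ext_def
    by (intro exI[of _ "\<lambda>t. real j * sin t ^ j * cos t * poly q (cos t)
        - sin t ^ Suc (Suc j) * poly (pderiv q) (cos t)"] conjI)
      (auto intro!: continuous_intros simp: * power_0_left)
qed

text \<open>Self-adjointness: in the derivative of the Wronskian-like primitive the m^2 terms and
  the products of derivatives cancel, leaving the difference of the eigenvalues l (l + 1) and k (k +
  1).\<close>

lemma leg_orthogonal: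
  assumes "\<bar>m\<bar> \<le> int l" "\<bar>m\<bar> \<le> int k" "l \<noteq> k"
  shows "integral {0<..<pi} (\<lambda>t. sin t * leg l m t * leg k m t) = 0"
proof -
  let ?c = "real k * (real k + 1) - real l * (real l + 1)"
  have "((\<lambda>t. ?c * (sin t * leg l m t * leg k m t)) has_integral 0) {0<..<pi}"
  proof (rule vanishing_ext_has_integral_0)
    show "vanishing_ext (\<lambda>t. sin t * dleg l m t * leg k m t - sin t * dleg k m t * leg l m t)"
      by (intro vanishing_ext_diff vanishing_ext_mult leg_extensions assms)
    fix t assume t: "0 < t" "t < pi"
    show "((\<lambda>t. sin t * dleg l m t * leg k m t - sin t * dleg k m t * leg l m t) has_real_derivative
       ?c * (sin t * leg l m t * leg k m t)) (at t)"
      by (rule DERIV_cong[OF DERIV_diff[OF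
        DERIV_mult[OF sin_dleg_has_derivative[OF t assms(1)] leg_has_derivative[OF t, of k m]]
        DERIV_mult[OF sin_dleg_has_derivative[OF t assms(2)] leg_has_derivative[OF t, of l m]]]])
        (simp add: algebra_simps)
  qed
  then have "integral {0<..<pi} (\<lambda>t. ?c * (sin t * leg l m t * leg k m t)) = 0"
    by (rule integral_unique)
  moreover have "?c \<noteq> 0"
  proof -
    have "?c = (real k - real l) * (real k + real l + 1)" by (simp add: algebra_simps)
    then show ?thesis using assms(3) by simp
  qed
  ultimately show ?thesis by simp
qed

section \<open>Inner products of the polar factors and their independence of the order\<close>

lemma integral_eq_of_difference:
  fixes f g :: "real \<Rightarrow> real"
  assumes "((\<lambda>x. f x - g x) has_integral 0) S" "g integrable_on S"
  shows "integral S f = integral S g"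
  using has_integral_add[OF assms(1) integrable_integral[OF assms(2)]] by (simp add: integral_unique)

text \<open>Up to sign, the polar factor of \<open>ethbar 0\<close> applied to a harmonic of weight
  0.\<close>

abbreviation lowered_leg :: "nat \<Rightarrow> int \<Rightarrow> real \<Rightarrow> real" where
  "lowered_leg l m t \<equiv> dleg l m t + of_int m * leg l m t / sin t"

text \<open>This reduces weight -1 to weight 0. The cross terms of the product are the derivative of
  m \<open>leg l m\<close> \<open>leg k m\<close>, and the m^2 / sin t term is the one that the
  Legendre equation produces when sin t \<open>dleg l m\<close> \<open>leg k m\<close> is
  differentiated.\<close>

lemma dleg_inner_product:
  assumes "\<bar>m\<bar> \<le> int l" "\<bar>m\<bar> \<le> int k"
  shows "integral {0<..<pi} (\<lambda>t. sin t * lowered_leg l m t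
            * lowered_leg k m t)
     = real l * (real l + 1) * integral {0<..<pi} (\<lambda>t. sin t * leg l m t * leg k m t)"
proof -
  have "integral {0<..<pi} (\<lambda>t. sin t * lowered_leg l m t
            * lowered_leg k m t)
    = integral {0<..<pi} (\<lambda>t. real l * (real l + 1) * (sin t * leg l m t * leg k m t))"
  proof (rule integral_eq_of_difference)
    show "((\<lambda>t. sin t * lowered_leg l m t
            * lowered_leg k m t
        - real l * (real l + 1) * (sin t * leg l m t * leg k m t)) has_integral 0) {0<..<pi}"
    proof (rule vanishing_ext_has_integral_0)
      show "vanishing_ext (\<lambda>t. sin t * dleg l m t * leg k m t + of_int m * leg l m t * leg k m t)"
        by (intro vanishing_ext_add vanishing_ext_mult leg_extensions assms)
      fix t assume t: "0 < t" "t < pi"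
      have s: "sin t > 0" using t by (rule sin_gt_zero)
      show "((\<lambda>t. sin t * dleg l m t * leg k m t + of_int m * leg l m t * leg k m t) has_real_derivative
         sin t * lowered_leg l m t
            * lowered_leg k m t
          - real l * (real l + 1) * (sin t * leg l m t * leg k m t)) (at t)"
        by (rule DERIV_cong[OF DERIV_add[OF
          DERIV_mult[OF sin_dleg_has_derivative[OF t assms(1)] leg_has_derivative[OF t, of k m]]
          DERIV_mult[OF DERIV_cmult[OF leg_has_derivative[OF t, of l m]] leg_has_derivative[OF t, of k m]]]])
         (use s in \<open>simp add: field_simps power2_eq_square\<close>)
    qed
    show "(\<lambda>t. real l * (real l + 1) * (sin t * leg l m t * leg k m t)) integrable_on {0<..<pi}"
      by (intro cont_ext_integrable cont_ext_mult leg_extensions assms cont_ext_continuous continuous_intros)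
  qed
  then show ?thesis by simp
qed

lemma leg_norm_pos: "leg_norm l m > 0"
  unfolding leg_norm_def by simp

text \<open>In \<open>dleg\<close> the term where the polynomial is differentiated already has the
  shape of order m + 1; subtracting m cot t \<open>leg l m\<close> removes the other term.\<close>

lemma leg_raise:
  assumes "- int l \<le> m" "m < int l" "0 < t" "t < pi"
  shows "leg l (m + 1) t = leg_norm l (m + 1) / leg_norm l m * (dleg l m t - of_int m * cot t * leg l m t)"
proof -
  have s: "sin t > 0" using assms by (intro sin_gt_zero)
  have n: "nat (int l + (m + 1)) = Suc (nat (int l + m))" using assms by simp
  have a: "sin t powi m = sin t powi (m - 1) * sin t" "sin t powi (m + 1) = sin t powi (m - 1) * sin t * sin t"
    using s power_int_add[of "sin t" "m - 1" 1] power_int_add[of "sin t" "m - 1" 2]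
    by (simp_all add: algebra_simps power2_eq_square)
  have b: "(-1) powi (m + 1) = - ((-1) powi m :: real)" by (simp add: power_int_add)
  show ?thesis
    unfolding leg_eq dleg_def n b a cot_def using s leg_norm_pos[of l m]
    by (simp add: field_simps)
qed

text \<open>The ladder operator of \<open>leg_raise\<close> multiplies the squared norm by c = (l -
  m)(l + m + 1), and the ratio of the factorials in \<open>leg_norm\<close> is exactly 1 /
  c.\<close>

lemma leg_sq_integral_step:
  assumes "- int l \<le> m" "m < int l"
  shows "integral {0<..<pi} (\<lambda>t. sin t * (leg l (m + 1) t)\<^sup>2) = integral {0<..<pi} (\<lambda>t. sin t * (leg l m t)\<^sup>2)"
proof -
  have m: "\<bar>m\<bar> \<le> int l" using assms by simp
  define c where "c = real l * (real l + 1) - of_int m * (of_int m + 1)"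
  define \<kappa> where "\<kappa> = leg_norm l (m + 1) / leg_norm l m"
  have \<kappa>: "\<kappa>\<^sup>2 * c = 1"
  proof -
    define a b where "a = nat (int l - (m + 1))" and "b = nat (int l + m)"
    have n: "nat (int l - m) = Suc a" "nat (int l + (m + 1)) = Suc b" "nat (int l - (m + 1)) = a" "nat (int l + m) = b"
      unfolding a_def b_def using assms by auto
    have r: "real a = real l - of_int m - 1" "real b = real l + of_int m"
      unfolding a_def b_def using assms by simp_all
    have "c = (real a + 1) * (real b + 1)" unfolding c_def r by (simp add: algebra_simps)
    moreover have "\<kappa>\<^sup>2 = 1 / ((real a + 1) * (real b + 1))"
    proof -
      define K where "K = (2 * real l + 1) / (4 * pi)"
      have "K > 0" unfolding K_def by simp
      then have "\<kappa>\<^sup>2 = (K * fact a / fact (Suc b)) / (K * fact (Suc a) / fact b)"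
        unfolding \<kappa>_def leg_norm_def n power_divide K_def[symmetric] by simp
      also have "\<dots> = 1 / ((real a + 1) * (real b + 1))"
        using \<open>K > 0\<close> by (simp add: divide_simps) (simp add: algebra_simps)
      finally show ?thesis .
    qed
    moreover have "(real a + 1) * (real b + 1) \<noteq> 0" by simp
    ultimately show ?thesis by simp
  qed
  have "integral {0<..<pi} (\<lambda>t. sin t * (dleg l m t - of_int m * cot t * leg l m t)\<^sup>2)
    = integral {0<..<pi} (\<lambda>t. c * (sin t * (leg l m t)\<^sup>2))"
  proof (rule integral_eq_of_difference)
    show "((\<lambda>t. sin t * (dleg l m t - of_int m * cot t * leg l m t)\<^sup>2 - c * (sin t * (leg l m t)\<^sup>2)) has_integral 0) {0<..<pi}"
    proof (rule vanishing_ext_has_integral_0)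
      \<comment> \<open>Differentiating sin t T T' - m cos t T^2 with T = \<open>leg l m\<close>
        reproduces the expanded square: the cosine term supplies the mixed product, and the Legendre
        equation the rest.\<close>
      show "vanishing_ext (\<lambda>t. sin t * dleg l m t * leg l m t - of_int m * leg l m t * (cos t * leg l m t))"
        by (intro vanishing_ext_diff vanishing_ext_mult cont_ext_mult leg_extensions m cont_ext_continuous continuous_intros)
      fix t assume t: "0 < t" "t < pi"
      have s: "sin t > 0" using t by (rule sin_gt_zero)
      have cs: "cos t * cos t = 1 - sin t * sin t" using cos_squared_eq[of t] by (simp add: power2_eq_square)
      define x y T D M where "x = cos t" and "y = sin t" and "T = leg l m t" and "D = dleg l m t"
        and "M = real_of_int m"
      have xy: "x * x = 1 - y * y" using cs unfolding x_def y_def .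
      have "y * (D - M * (x / y) * T)\<^sup>2 - c * (y * T\<^sup>2)
        = y * D * D - 2 * M * x * T * D + M * M * (x * x) / y * T * T - c * (y * T\<^sup>2)"
        using s unfolding y_def[symmetric] by (simp add: field_simps power2_eq_square)
      also have "\<dots> = y * D * D - 2 * M * x * T * D + (M\<^sup>2 / y - M * M * y) * T * T - c * (y * T\<^sup>2)"
        unfolding xy using s unfolding y_def[symmetric] by (simp add: field_simps power2_eq_square)
      finally have e: "y * (D - M * (x / y) * T)\<^sup>2 - c * (y * T\<^sup>2)
        = y * D * D - 2 * M * x * T * D + (M\<^sup>2 / y - M * M * y) * T * T - c * (y * T\<^sup>2)" .
      show "((\<lambda>t. sin t * dleg l m t * leg l m t - of_int m * leg l m t * (cos t * leg l m t)) has_real_derivative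
         sin t * (dleg l m t - of_int m * cot t * leg l m t)\<^sup>2 - c * (sin t * (leg l m t)\<^sup>2)) (at t)"
        by (rule DERIV_cong[OF DERIV_diff[OF
          DERIV_mult[OF sin_dleg_has_derivative[OF t m] leg_has_derivative[OF t, of l m]]
          DERIV_mult[OF DERIV_cmult[OF leg_has_derivative[OF t, of l m]]
             DERIV_mult[OF DERIV_cos leg_has_derivative[OF t, of l m]]]]])
          (unfold cot_def x_def[symmetric] y_def[symmetric] T_def[symmetric] D_def[symmetric] M_def[symmetric] e,
            simp add: c_def M_def algebra_simps power2_eq_square)
    qed
    show "(\<lambda>t. c * (sin t * (leg l m t)\<^sup>2)) integrable_on {0<..<pi}" unfolding power2_eq_square
      by (intro cont_ext_integrable cont_ext_mult leg_extensions m cont_ext_continuous continuous_intros)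
  qed
  then have e: "integral {0<..<pi} (\<lambda>t. sin t * (dleg l m t - of_int m * cot t * leg l m t)\<^sup>2)
    = c * integral {0<..<pi} (\<lambda>t. sin t * (leg l m t)\<^sup>2)" by simp
  have "integral {0<..<pi} (\<lambda>t. sin t * (leg l (m + 1) t)\<^sup>2)
    = integral {0<..<pi} (\<lambda>t. \<kappa>\<^sup>2 * (sin t * (dleg l m t - of_int m * cot t * leg l m t)\<^sup>2))"
    by (rule integral_cong) (simp add: leg_raise[OF assms] \<kappa>_def[symmetric] power_mult_distrib)
  also have "\<dots> = \<kappa>\<^sup>2 * c * integral {0<..<pi} (\<lambda>t. sin t * (leg l m t)\<^sup>2)"
    by (simp add: e)
  finally show ?thesis unfolding \<kappa> by simp
qed

definition harm_norm :: "nat \<Rightarrow> real" where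
  "harm_norm l = integral {0<..<pi} (\<lambda>t. sin t * (leg l (int l) t)\<^sup>2)"

text \<open>Descent from the top order m = l, at which \<open>harm_norm\<close> is defined, in at
  most 2 l steps.\<close>

lemma leg_sq_integral:
  assumes "\<bar>m\<bar> \<le> int l"
  shows "integral {0<..<pi} (\<lambda>t. sin t * (leg l m t)\<^sup>2) = harm_norm l"
proof -
  have "k \<le> 2 * l \<Longrightarrow> integral {0<..<pi} (\<lambda>t. sin t * (leg l (int l - int k) t)\<^sup>2) = harm_norm l" for k
  proof (induction k)
    case (Suc k)
    have "int l - int (Suc k) + 1 = int l - int k" by simp
    with leg_sq_integral_step[of l "int l - int (Suc k)"] Suc show ?case by auto
  qed (simp add: harm_norm_def)
  moreover have "nat (int l - m) \<le> 2 * l" "int l - int (nat (int l - m)) = m" using assms by auto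
  ultimately show ?thesis by metis
qed

text \<open>A nonnegative continuous integrand with zero integral vanishes everywhere. At m = l,
  however, the polynomial factor is the 2l-th derivative of a monic polynomial of degree 2l, hence
  the constant (2l)!.\<close>

lemma harm_norm_nonzero: "harm_norm l \<noteq> 0"
proof
  assume 0: "harm_norm l = 0"
  have m: "\<bar>int l\<bar> \<le> int l" by simp
  have "cont_ext (\<lambda>t. sin t * (leg l (int l) t)\<^sup>2)" unfolding power2_eq_square
    by (intro cont_ext_mult leg_extensions m cont_ext_continuous continuous_intros)
  then obtain g where g: "continuous_on {0..pi} g" "\<forall>t\<in>{0<..<pi}. sin t * (leg l (int l) t)\<^sup>2 = g t"
    unfolding cont_ext_def by blast
  have "integral {0<..<pi} g = 0" using 0 g(2) unfolding harm_norm_def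
    by (metis (no_types, lifting) integral_cong)
  then have i0: "integral {0..pi} g = 0" by (simp add: integral_open_interval_real)
  have "(g has_integral 0) (cbox 0 pi)"
    using integrable_integral[OF integrable_continuous_interval[OF g(1)]] i0 by simp
  have nn: "0 \<le> g x" if x: "x \<in> {0..pi}" for x
  proof -
    have "closure {0<..<pi} = {0..pi}" using pi_gt_zero by simp
    moreover have "0 \<le> g y" if "y \<in> {0<..<pi}" for y using that g(2) sin_ge_zero[of y] by (metis
      greaterThanLessThan_iff less_imp_le mult_nonneg_nonneg zero_le_power2)
    ultimately show ?thesis using continuous_ge_on_closure[of "{0<..<pi}" g x 0] g(1) x by simp
  qed
  \<comment> \<open>At the equator sin t = 1 and cos t = 0, so \<open>leg\<close> reduces to nonzero
    constants times the polynomial at 0.\<close>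
  have "g (pi / 2) = 0"
    by (rule has_integral_0_cbox_imp_0[of 0 pi g]) (use g(1) nn \<open>(g has_integral 0) (cbox 0 pi)\<close> in \<open>auto simp: pi_gt_zero[unfolded not_le[symmetric]]\<close>)
  then have "leg l (int l) (pi / 2) = 0" using g(2) pi_gt_zero by (auto dest!: bspec[of _ _ "pi/2"])
  moreover have nl: "nat (int l + int l) = 2 * l" by simp
  ultimately have "poly (legendre_poly l (2 * l)) 0 = 0"
    unfolding leg_eq nl using leg_norm_pos[of l "int l"] by simp
  moreover have "poly (legendre_poly l (2 * l)) 0 = pochhammer 1 (2 * l) * coeff ([:-1, 0, 1:] ^ l) (2 * l)"
    unfolding legendre_poly_def poly_0_coeff_0 coeff_higher_pderiv by simp
  moreover have "coeff ([:-1, 0, 1:] ^ l) (2 * l) = (1::real)"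
  proof -
    have "degree ([:-1, 0, 1::real:] ^ l) = 2 * l" by (simp add: degree_power_eq)
    then have "coeff ([:-1, 0, 1:] ^ l) (2 * l) = lead_coeff ([:-1, 0, 1::real:] ^ l)" by simp
    then show ?thesis by (simp add: lead_coeff_power)
  qed
  ultimately show False by (simp add: pochhammer_fact[symmetric])
qed

section \<open>Spin-weighted harmonics of weight at most one\<close>

definition separated :: "sphere_fun \<Rightarrow> (real \<Rightarrow> real) \<Rightarrow> int \<Rightarrow> bool" where
  "separated F f m \<longleftrightarrow> (\<forall>\<theta> \<phi>. 0 < \<theta> \<and> \<theta> < pi \<longrightarrow> F \<theta> \<phi> = of_real (f \<theta>) * cis (of_int m * \<phi>))"

lemma separatedD: "separated F f m \<Longrightarrow> 0 < \<theta> \<Longrightarrow> \<theta> < pi \<Longrightarrow> F \<theta> \<phi> = of_real (f \<theta>) * cis (of_int m * \<phi>)"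
  by (simp add: separated_def)

lemma separated_theta_derivative:
  assumes "separated F f m" "0 < \<theta>" "\<theta> < pi" "(f has_real_derivative f') (at \<theta>)"
  shows "((\<lambda>x. F x \<phi>) has_vector_derivative of_real f' * cis (of_int m * \<phi>)) (at \<theta>)"
proof -
  have "((\<lambda>x. complex_of_real (f x)) has_vector_derivative of_real f') (at \<theta>)"
    using assms(4) by (intro has_vector_derivative_of_real) (simp add: has_real_derivative_iff_has_vector_derivative)
  then have "((\<lambda>x. complex_of_real (f x) * cis (of_int m * \<phi>)) has_vector_derivative of_real f' * cis (of_int m * \<phi>)) (at \<theta>)"
    by (rule has_vector_derivative_mult_left)
  then show ?thesis
    by (rule has_vector_derivative_transform_within_open[of _ _ _ "{0<..<pi}"])
      (use assms in \<open>auto simp: separatedD\<close>)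
qed

lemma cis_has_vector_derivative:
  "((\<lambda>y. cis (c * y)) has_vector_derivative \<i> * of_real c * cis (c * y)) (at y)"
proof -
  have "((\<lambda>y. exp (\<i> * of_real c * of_real y)) has_vector_derivative \<i> * of_real c * exp (\<i> * of_real c * of_real y)) (at y)"
    by (rule has_vector_derivative_eq_rhs[OF field_vector_diff_chain_at[where g = exp and f = "\<lambda>y. \<i> * of_real c * of_real y", unfolded o_def]])
      (auto intro!: derivative_eq_intros)
  then show ?thesis by (simp add: cis_conv_exp mult_ac)
qed

lemma separated_phi_derivative:
  assumes "separated F f m" "0 < \<theta>" "\<theta> < pi"
  shows "((\<lambda>y. F \<theta> y) has_vector_derivative \<i> * of_int m * of_real (f \<theta>) * cis (of_int m * \<phi>)) (at \<phi>)"
proof -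
  have "((\<lambda>y. complex_of_real (f \<theta>) * cis (of_int m * y)) has_vector_derivative
      complex_of_real (f \<theta>) * (\<i> * of_real (of_int m) * cis (of_int m * \<phi>))) (at \<phi>)"
    by (intro has_vector_derivative_mult_right cis_has_vector_derivative)
  moreover have "(\<lambda>y. F \<theta> y) = (\<lambda>y. complex_of_real (f \<theta>) * cis (of_int m * y))"
    using assms by (auto simp: separatedD)
  ultimately show ?thesis by (simp add: mult_ac)
qed

lemma eth_separated:
  assumes "separated F f m" "0 < \<theta>" "\<theta> < pi" "(f has_real_derivative f') (at \<theta>)"
  shows "eth s F \<theta> \<phi> = of_real (- (f' - of_int m * f \<theta> / sin \<theta> - of_int s * cot \<theta> * f \<theta>)) * cis (of_int m * \<phi>)"
  unfolding eth_def
  by (simp only: vector_derivative_at[OF separated_theta_derivative[OF assms]]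
     vector_derivative_at[OF separated_phi_derivative[OF assms(1-3)]] separatedD[OF assms(1-3)])
    (simp add: algebra_simps)

lemma ethbar_separated:
  assumes "separated F f m" "0 < \<theta>" "\<theta> < pi" "(f has_real_derivative f') (at \<theta>)"
  shows "ethbar s F \<theta> \<phi> = of_real (- (f' + of_int m * f \<theta> / sin \<theta> + of_int s * cot \<theta> * f \<theta>)) * cis (of_int m * \<phi>)"
  unfolding ethbar_def
  by (simp only: vector_derivative_at[OF separated_theta_derivative[OF assms]]
     vector_derivative_at[OF separated_phi_derivative[OF assms(1-3)]] separatedD[OF assms(1-3)])
    (simp add: algebra_simps)

text \<open>One formula serves both s = 1 and s = -1. At l = 0 the division by zero yields 0, in
  agreement with the value 0 that \<open>swsh\<close> has there.\<close>

definition spin_leg :: "int \<Rightarrow> nat \<Rightarrow> int \<Rightarrow> real \<Rightarrow> real" where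
  "spin_leg s l m \<theta> = (if s = 0 then leg l m \<theta>
     else - of_int s * (dleg l m \<theta> - of_int s * (of_int m * leg l m \<theta> / sin \<theta>)) / sqrt (real l * (real l + 1)))"

definition dspin_leg :: "int \<Rightarrow> nat \<Rightarrow> int \<Rightarrow> real \<Rightarrow> real" where
  "dspin_leg s l m \<theta> = (if s = 0 then dleg l m \<theta>
     else - of_int s * (d2leg l m \<theta> - of_int s * of_int m * (dleg l m \<theta> / sin \<theta> - leg l m \<theta> * cos \<theta> / (sin \<theta>)\<^sup>2))
        / sqrt (real l * (real l + 1)))"

lemma spin_leg_has_derivative:
  assumes "0 < \<theta>" "\<theta> < pi" "\<bar>m\<bar> \<le> int l"
  shows "(spin_leg s l m has_real_derivative dspin_leg s l m \<theta>) (at \<theta>)"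
proof (cases "s = 0")
  case True
  then show ?thesis unfolding spin_leg_def[abs_def] dspin_leg_def using leg_has_derivative[OF assms(1,2)] by simp
next
  case False
  have s: "sin \<theta> \<noteq> 0" using sin_gt_zero[OF assms(1,2)] by simp
  have "((\<lambda>\<theta>. of_int m * leg l m \<theta> / sin \<theta>) has_real_derivative
      of_int m * (dleg l m \<theta> / sin \<theta> - leg l m \<theta> * cos \<theta> / (sin \<theta>)\<^sup>2)) (at \<theta>)"
    by (rule DERIV_cong[OF DERIV_divide[OF DERIV_cmult[OF leg_has_derivative[OF assms(1,2)]] DERIV_sin s]])
      (use s in \<open>simp add: field_simps power2_eq_square\<close>)
  from DERIV_cdivide[OF DERIV_cmult[OF DERIV_diff[OF dleg_has_derivative[OF assms] DERIV_cmult[OF this, of "of_int s"]]],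
      of "- of_int s" "sqrt (real l * (real l + 1))"]
  show ?thesis using False unfolding spin_leg_def[abs_def] dspin_leg_def by (simp add: mult.assoc)
qed

lemma sph_harm_separated: "separated (sph_harm l m) (leg l m) m"
  unfolding separated_def sph_harm_def leg_def leg_norm_def by simp

lemma swsh_separated:
  assumes "s \<in> {-1, 0, 1}"
  shows "separated (swsh s l m) (spin_leg s l m) m"
  unfolding separated_def
proof safe
  fix \<theta> \<phi> :: real assume \<theta>: "0 < \<theta>" "\<theta> < pi"
  show "swsh s l m \<theta> \<phi> = of_real (spin_leg s l m \<theta>) * cis (of_int m * \<phi>)"
  proof (cases "s = 0")
    case True
    then show ?thesis using separatedD[OF sph_harm_separated \<theta>] by (simp add: swsh_def spin_leg_def)
  next
    case False
    show ?thesis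
    proof (cases l)
      case 0
      then show ?thesis using False assms by (auto simp: swsh_def spin_leg_def)
    next
      case (Suc j)
      have q: "sqrt (fact (l - 1) / fact (l + 1)) = 1 / sqrt (real l * (real l + 1))"
      proof -
        have "fact (l - 1) / fact (l + 1) = 1 / (real l * (real l + 1))"
          unfolding Suc by (simp add: divide_simps)
        then show ?thesis by (simp add: real_sqrt_divide)
      qed
      have e: "eth 0 (sph_harm l m) \<theta> \<phi> = of_real (- (dleg l m \<theta> - of_int m * leg l m \<theta> / sin \<theta>)) * cis (of_int m * \<phi>)"
        using eth_separated[OF sph_harm_separated \<theta> leg_has_derivative[OF \<theta>], of 0] by simp
      have b: "ethbar 0 (sph_harm l m) \<theta> \<phi> = of_real (- (dleg l m \<theta> + of_int m * leg l m \<theta> / sin \<theta>)) * cis (of_int m * \<phi>)"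
        using ethbar_separated[OF sph_harm_separated \<theta> leg_has_derivative[OF \<theta>], of 0] by simp
      have l: "\<not> l < 1" using Suc by simp
      from False assms consider "s = 1" | "s = -1" by blast
      then show ?thesis
      proof cases
        case 1
        have "swsh 1 l m \<theta> \<phi> = of_real (sqrt (fact (l - 1) / fact (l + 1))) * eth 0 (sph_harm l m) \<theta> \<phi>"
          using l by (simp add: swsh_def del: fact_Suc)
        then show ?thesis unfolding 1 q e by (simp add: spin_leg_def)
      next
        case 2
        have "swsh (-1) l m \<theta> \<phi> = - of_real (sqrt (fact (l - 1) / fact (l + 1))) * ethbar 0 (sph_harm l m) \<theta> \<phi>"
          using l by (simp add: swsh_def del: fact_Suc)
        then show ?thesis unfolding 2 q b by (simp add: spin_leg_def algebra_simps add_divide_distrib diff_divide_distrib)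
      qed
    qed
  qed
qed

lemmas swsh_derivs =
  separated_theta_derivative[OF swsh_separated _ _ spin_leg_has_derivative]
  separated_phi_derivative[OF swsh_separated]

lemma ethbar_swsh_0:
  assumes "0 < \<theta>" "\<theta> < pi" "\<bar>m\<bar> \<le> int l"
  shows "ethbar 0 (swsh 0 l m) \<theta> \<phi> = - of_real (sqrt (real l * (real l + 1))) * swsh (-1) l m \<theta> \<phi>"
proof -
  have e: "ethbar 0 (swsh 0 l m) \<theta> \<phi> = of_real (- (dleg l m \<theta> + of_int m * leg l m \<theta> / sin \<theta>)) * cis (of_int m * \<phi>)"
    using ethbar_separated[OF swsh_separated assms(1,2) spin_leg_has_derivative[OF assms], of 0 0]
    by (simp add: spin_leg_def dspin_leg_def)
  show ?thesis
  proof (cases l)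
    case 0
    then have m: "m = 0" using assms by simp
    have "dleg 0 0 \<theta> = 0" by (simp add: dleg_def legendre_poly_def)
    then show ?thesis unfolding e by (simp add: 0 m)
  next
    case (Suc j)
    define c where "c = sqrt (real l * (real l + 1))"
    have "c > 0" unfolding c_def Suc by simp
    then have "dleg l m \<theta> + of_int m * leg l m \<theta> / sin \<theta> = c * spin_leg (-1) l m \<theta>"
      unfolding spin_leg_def c_def[symmetric] by simp
    then show ?thesis unfolding e c_def[symmetric]
      by (simp add: separatedD[OF swsh_separated assms(1,2)])
  qed
qed

text \<open>Passing from weight 0 to weight s and back is the spherical Laplacian, so this is the
  Legendre equation again, with eigenvalue l (l + 1) split into two square roots.\<close>

lemma dspin_leg_lowering:
  assumes "0 < \<theta>" "\<theta> < pi" "s = 1 \<or> s = -1"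
  shows "dspin_leg s l m \<theta> + of_int s * of_int m * spin_leg s l m \<theta> / sin \<theta> + cot \<theta> * spin_leg s l m \<theta>
     = of_int s * sqrt (real l * (real l + 1)) * leg l m \<theta>"
proof -
  have s: "sin \<theta> > 0" using sin_gt_zero[OF assms(1,2)] by simp
  have s1: "of_int s * of_int s = (1::real)" "s \<noteq> 0" using assms by auto
  define c where "c = sqrt (real l * (real l + 1))"
  have c0: "c \<ge> 0" unfolding c_def by simp
  have l2: "c * c = real l * (real l + 1)" unfolding c_def by simp
  define x y T D M S where "x = cos \<theta>" and "y = sin \<theta>" and "T = leg l m \<theta>" and "D = dleg l m \<theta>"
        and "M = real_of_int m" and "S = real_of_int s"
  have S: "S * S = 1" using s1 unfolding S_def by simp
  \<comment> \<open>The identity is first stated for arbitrary S; the defect S^2 - 1 shows where s =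
    1 or s = -1 enters.\<close>
  have "- S * ((M\<^sup>2 / y\<^sup>2 - c * c) * T - x / y * D - S * M * (D / y - T * x / y\<^sup>2))
     + S * M * (- S * (D - S * (M * T / y))) / y + x / y * (- S * (D - S * (M * T / y)))
    = S * (c * c) * T + (S * S - 1) * (S * M\<^sup>2 * T / y\<^sup>2)"
    using s unfolding y_def[symmetric]
    by (simp add: field_simps power2_eq_square)
  then have key: "- S * ((M\<^sup>2 / y\<^sup>2 - c * c) * T - x / y * D - S * M * (D / y - T * x / y\<^sup>2))
     + S * M * (- S * (D - S * (M * T / y))) / y + x / y * (- S * (D - S * (M * T / y)))
    = S * (c * c) * T" unfolding S by simp
  have "dspin_leg s l m \<theta> + of_int s * of_int m * spin_leg s l m \<theta> / sin \<theta> + cot \<theta> * spin_leg s l m \<theta>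
    = (- S * ((M\<^sup>2 / y\<^sup>2 - c * c) * T - x / y * D - S * M * (D / y - T * x / y\<^sup>2))
     + S * M * (- S * (D - S * (M * T / y))) / y + x / y * (- S * (D - S * (M * T / y)))) / c"
    using s1(2) unfolding dspin_leg_def spin_leg_def d2leg_def cot_def c_def[symmetric] l2[symmetric]
      x_def[symmetric] y_def[symmetric] T_def[symmetric] D_def[symmetric] M_def[symmetric] S_def[symmetric]
    by (simp add: abs_of_nonneg[OF c0] power2_eq_square add_divide_distrib diff_divide_distrib algebra_simps)
  also have "\<dots> = S * c * T" unfolding key by simp
  finally show ?thesis unfolding S_def T_def c_def .
qed

lemma eth_swsh_minus1:
  assumes "0 < \<theta>" "\<theta> < pi" "\<bar>m\<bar> \<le> int l"
  shows "eth (-1) (swsh (-1) l m) \<theta> \<phi> = of_real (sqrt (real l * (real l + 1))) * swsh 0 l m \<theta> \<phi>"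
proof -
  have "- (dspin_leg (-1) l m \<theta> - of_int m * spin_leg (-1) l m \<theta> / sin \<theta> - of_int (-1) * cot \<theta> * spin_leg (-1) l m \<theta>)
     = sqrt (real l * (real l + 1)) * leg l m \<theta>"
    using dspin_leg_lowering[OF assms(1,2), of "-1" l m] by simp
  then have "eth (-1) (swsh (-1) l m) \<theta> \<phi> = of_real (sqrt (real l * (real l + 1)) * leg l m \<theta>) * cis (of_int m * \<phi>)"
    using eth_separated[OF swsh_separated assms(1,2) spin_leg_has_derivative[OF assms], of "-1" "-1" \<phi>] by simp
  then show ?thesis by (simp add: separatedD[OF swsh_separated assms(1,2)] spin_leg_def)
qed

lemma ethbar_swsh_1:
  assumes "0 < \<theta>" "\<theta> < pi" "\<bar>m\<bar> \<le> int l"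
  shows "ethbar 1 (swsh 1 l m) \<theta> \<phi> = - of_real (sqrt (real l * (real l + 1))) * swsh 0 l m \<theta> \<phi>"
proof -
  have "- (dspin_leg 1 l m \<theta> + of_int m * spin_leg 1 l m \<theta> / sin \<theta> + of_int 1 * cot \<theta> * spin_leg 1 l m \<theta>)
     = - (sqrt (real l * (real l + 1)) * leg l m \<theta>)"
    using dspin_leg_lowering[OF assms(1,2), of 1 l m] by simp
  then have "ethbar 1 (swsh 1 l m) \<theta> \<phi> = of_real (- (sqrt (real l * (real l + 1)) * leg l m \<theta>)) * cis (of_int m * \<phi>)"
    using ethbar_separated[OF swsh_separated assms(1,2) spin_leg_has_derivative[OF assms], of 1 1 \<phi>] by simp
  then show ?thesis by (simp add: separatedD[OF swsh_separated assms(1,2)] spin_leg_def)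
qed

lemma spin_leg_cont_ext:
  assumes "\<bar>m\<bar> \<le> int l"
  shows "cont_ext (spin_leg s l m)"
proof (cases "s = 0")
  case True
  then show ?thesis using leg_extensions(1)[OF assms] by (simp add: spin_leg_def[abs_def])
next
  case False
  have "cont_ext (\<lambda>\<theta>. - of_int s / sqrt (real l * (real l + 1)) *
      (dleg l m \<theta> - of_int s * (of_int m * leg l m \<theta> / sin \<theta>)))"
    by (intro cont_ext_mult cont_ext_diff leg_extensions assms cont_ext_continuous continuous_intros)
  then show ?thesis using False by (simp add: spin_leg_def[abs_def])
qed

lemma spin_leg_inner_product:
  assumes "s = 0 \<or> s = -1 \<and> 1 \<le> l \<and> 1 \<le> k" "\<bar>m\<bar> \<le> int l" "\<bar>m\<bar> \<le> int k"
  shows "integral {0<..<pi} (\<lambda>\<theta>. sin \<theta> * spin_leg s l m \<theta> * spin_leg s k m \<theta>) = (if l = k then harm_norm l else 0)"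
proof -
  have 0: "integral {0<..<pi} (\<lambda>\<theta>. sin \<theta> * leg l m \<theta> * leg k m \<theta>) = (if l = k then harm_norm l else 0)"
    using leg_orthogonal[OF assms(2,3)] leg_sq_integral[OF assms(2)]
    by (auto simp: power2_eq_square mult.assoc)
  show ?thesis
  proof (cases "s = 0")
    case True
    then show ?thesis using 0 by (simp add: spin_leg_def)
  next
    case False
    then have s: "s = -1" and l: "1 \<le> l" "1 \<le> k" using assms(1) by auto
    define a b where "a = sqrt (real l * (real l + 1))" and "b = sqrt (real k * (real k + 1))"
    have ab: "a > 0" "b > 0" unfolding a_def b_def using l by auto
    have "integral {0<..<pi} (\<lambda>\<theta>. sin \<theta> * spin_leg s l m \<theta> * spin_leg s k m \<theta>)
      = integral {0<..<pi} (\<lambda>\<theta>. 1 / (a * b) * (sin \<theta> * (dleg l m \<theta> + of_int m * leg l m \<theta> / sin \<theta>)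
            * (dleg k m \<theta> + of_int m * leg k m \<theta> / sin \<theta>)))"
      by (rule integral_cong) (simp add: spin_leg_def s a_def b_def)
    also have "\<dots> = 1 / (a * b) * (a * a * (if l = k then harm_norm l else 0))"
      unfolding integral_mult_right dleg_inner_product[OF assms(2,3)] 0 by (simp add: a_def)
    also have "\<dots> = (if l = k then harm_norm l else 0)"
      using ab by (auto simp: a_def b_def)
    finally show ?thesis .
  qed
qed

section \<open>Orthogonality on the sphere\<close>

lemma integral_cis:
  fixes k :: int
  shows "integral {0<..<2 * pi} (\<lambda>y. cis (of_int k * y)) = (if k = 0 then of_real (2 * pi) else 0)"
proof (cases "k = 0")
  case True
  have "((\<lambda>y::real. 1 :: complex) has_integral (2 * pi - 0) *\<^sub>R 1) {0..2 * pi}"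
    using has_integral_const_real[of "1::complex" 0 "2 * pi"] by (simp add: scaleR_conv_of_real)
  then have "((\<lambda>y::real. 1 :: complex) has_integral (2 * pi - 0) *\<^sub>R 1) {0<..<2 * pi}"
    unfolding has_integral_Icc_iff_Ioo .
  from integral_unique[OF this] show ?thesis using True by (simp add: scaleR_conv_of_real)
next
  case False
  have "((\<lambda>y. cis (of_int k * y) / (\<i> * of_int k)) has_vector_derivative cis (of_int k * y)) (at y within {0..2*pi})" for y
    using has_vector_derivative_divide[OF cis_has_vector_derivative[of "of_int k" y], of "\<i> * of_int k"] False
    by (auto intro: has_vector_derivative_at_within)
  then have "((\<lambda>y. cis (of_int k * y)) has_integral
      (cis (of_int k * (2 * pi)) / (\<i> * of_int k) - cis (of_int k * 0) / (\<i> * of_int k))) {0..2 * pi}"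
    by (intro fundamental_theorem_of_calculus) auto
  moreover have "cis (of_int k * (2 * pi)) = 1"
    using cis_multiple_2pi[of "of_int k"] by (simp add: mult_ac)
  ultimately have "((\<lambda>y. cis (of_int k * y)) has_integral 0) {0<..<2 * pi}"
    by (simp add: has_integral_Icc_iff_Ioo)
  from integral_unique[OF this] show ?thesis using False by simp
qed

lemma separated_sphere_integral:
  fixes k :: int
  assumes "continuous_on {0..pi} g"
  shows "set_integrable lborel ({0<..<pi} \<times> {0<..<2 * pi}) (\<lambda>(\<theta>, \<phi>). of_real (g \<theta>) * cis (of_int k * \<phi>))" (is ?A)
    and "set_lebesgue_integral lborel ({0<..<pi} \<times> {0<..<2 * pi}) (\<lambda>(\<theta>, \<phi>). of_real (g \<theta>) * cis (of_int k * \<phi>))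
      = (if k = 0 then of_real (2 * pi * integral {0<..<pi} g) else 0)" (is ?B)
proof -
  define f :: "real \<times> real \<Rightarrow> complex" where "f = (\<lambda>(\<theta>, \<phi>). of_real (g \<theta>) * cis (of_int k * \<phi>))"
  have "continuous_on ({0..pi} \<times> {0..2 * pi}) f"
    unfolding f_def case_prod_unfold
    by (intro continuous_intros continuous_on_compose2[OF assms]) auto
  then have "set_integrable lborel ({0..pi} \<times> {0..2 * pi}) f"
    unfolding set_integrable_def by (intro borel_integrable_compact compact_Times) auto
  then have I: "set_integrable lborel ({0<..<pi} \<times> {0<..<2 * pi}) f"
    by (rule set_integrable_subset) (auto intro!: borel_open open_Times)
  then show ?A unfolding f_def .
  have i1: "set_integrable lborel {0<..<pi} (\<lambda>x. complex_of_real (g x))"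
    by (rule set_integrable_subset[of _ "{0..pi}"])
      (auto simp: set_integrable_def intro!: borel_integrable_compact continuous_intros assms)
  have i2: "set_integrable lborel {0<..<2 * pi} (\<lambda>y. cis (of_int k * y))"
    by (rule set_integrable_subset[of _ "{0..2 * pi}"])
      (auto simp: set_integrable_def intro!: borel_integrable_compact continuous_intros)
  have "g integrable_on {0<..<pi}"
    by (intro cont_ext_integrable cont_ext_continuous assms)
  then have r: "integral {0<..<pi} (\<lambda>x. complex_of_real (g x)) = of_real (integral {0<..<pi} g)"
    using integral_linear[OF _ bounded_linear_of_real] by (simp add: o_def)
  have int: "integrable (lborel \<Otimes>\<^sub>M lborel) (\<lambda>z. indicator ({0<..<pi} \<times> {0<..<2 * pi}) z *\<^sub>R f z)"
    using I unfolding set_integrable_def lborel_prod .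
  have "set_lebesgue_integral lborel ({0<..<pi} \<times> {0<..<2 * pi}) f
     = (LINT z|(lborel \<Otimes>\<^sub>M lborel). indicator ({0<..<pi} \<times> {0<..<2 * pi}) z *\<^sub>R f z)"
    unfolding set_lebesgue_integral_def lborel_prod ..
  also have "\<dots> = (LINT x|lborel. LINT y|lborel. indicator ({0<..<pi} \<times> {0<..<2 * pi}) (x, y) *\<^sub>R f (x, y))"
    using lborel_pair.integral_fst'[OF int] by simp
  also have "\<dots> = (LINT x|lborel. LINT y|lborel. (indicator {0<..<pi} x *\<^sub>R complex_of_real (g x)) * (indicator {0<..<2 * pi} y *\<^sub>R cis (of_int k * y)))"
    unfolding f_def by (intro Bochner_Integration.integral_cong refl) (auto simp: indicator_def)
  also have "\<dots> = (LINT x:{0<..<pi}|lborel. complex_of_real (g x)) * (LINT y:{0<..<2 * pi}|lborel. cis (of_int k * y))"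
    unfolding set_lebesgue_integral_def by (simp only: integral_mult_right_zero integral_mult_left_zero)
  also have "\<dots> = of_real (integral {0<..<pi} g) * (if k = 0 then of_real (2 * pi) else 0)"
    unfolding set_borel_integral_eq_integral(2)[OF i1] set_borel_integral_eq_integral(2)[OF i2] integral_cis r ..
  finally show ?B unfolding f_def by (simp add: mult_ac)
qed

abbreviation sphere_dom :: "(real \<times> real) set" where
  "sphere_dom \<equiv> {0<..<pi} \<times> {0<..<2 * pi}"

definition proj_integrand :: "int \<Rightarrow> nat \<Rightarrow> int \<Rightarrow> sphere_fun \<Rightarrow> real \<times> real \<Rightarrow> complex" where
  "proj_integrand s l m f = (\<lambda>(\<theta>, \<phi>). sin \<theta> *\<^sub>R (cnj (swsh s l m \<theta> \<phi>) * f \<theta> \<phi>))"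

text \<open>The azimuthal integral forces m = j. Only then does orthogonality in l apply, because
  the polar factors are related by a common differential equation only for equal order.\<close>

lemma swsh_orthogonality:
  assumes "s = 0 \<or> s = -1 \<and> 1 \<le> l \<and> 1 \<le> k" "\<bar>m\<bar> \<le> int l" "\<bar>j\<bar> \<le> int k"
  shows "set_integrable lborel sphere_dom (proj_integrand s l m (swsh s k j))"
    and "set_lebesgue_integral lborel sphere_dom (proj_integrand s l m (swsh s k j))
      = (if l = k \<and> m = j then of_real (2 * pi * harm_norm l) else 0)"
proof -
  have "cont_ext (\<lambda>\<theta>. sin \<theta> * spin_leg s l m \<theta> * spin_leg s k j \<theta>)"
    by (intro cont_ext_mult spin_leg_cont_ext assms cont_ext_continuous continuous_intros)
  then obtain g where g: "continuous_on {0..pi} g"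
    and gg: "\<And>\<theta>. \<theta> \<in> {0<..<pi} \<Longrightarrow> sin \<theta> * spin_leg s l m \<theta> * spin_leg s k j \<theta> = g \<theta>"
    unfolding cont_ext_def by blast
  have s: "s \<in> {-1, 0, 1}" using assms(1) by auto
  have eq: "proj_integrand s l m (swsh s k j) z = (\<lambda>(\<theta>, \<phi>). of_real (g \<theta>) * cis (of_int (j - m) * \<phi>)) z"
    if "z \<in> sphere_dom" for z
  proof -
    obtain \<theta> \<phi> where z: "z = (\<theta>, \<phi>)" "0 < \<theta>" "\<theta> < pi" using \<open>z \<in> sphere_dom\<close> by (cases z) auto
    have "proj_integrand s l m (swsh s k j) z
        = of_real (sin \<theta> * spin_leg s l m \<theta> * spin_leg s k j \<theta>) * (cnj (cis (of_int m * \<phi>)) * cis (of_int j * \<phi>))"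
      unfolding proj_integrand_def z(1)
      by (simp add: separatedD[OF swsh_separated[OF s] z(2,3)] scaleR_conv_of_real)
    also have "cnj (cis (of_int m * \<phi>)) * cis (of_int j * \<phi>) = cis (of_int (j - m) * \<phi>)"
      by (simp add: cis_cnj cis_mult algebra_simps)
    finally show ?thesis using z gg[of \<theta>] by simp
  qed
  have meas: "sphere_dom \<in> sets lborel" by (auto intro!: borel_open open_Times)
  show "set_integrable lborel sphere_dom (proj_integrand s l m (swsh s k j))"
    using separated_sphere_integral(1)[OF g, of "j - m"]
    by (subst set_integrable_cong[OF refl refl eq]) auto
  have "set_lebesgue_integral lborel sphere_dom (proj_integrand s l m (swsh s k j))
     = (if j - m = 0 then of_real (2 * pi * integral {0<..<pi} g) else 0)"
    unfolding separated_sphere_integral(2)[OF g, symmetric]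
    by (rule set_lebesgue_integral_cong[OF meas]) (use eq in blast)
  moreover have "integral {0<..<pi} g = (if l = k then harm_norm l else 0)" if "j = m"
    unfolding spin_leg_inner_product[OF assms(1,2) assms(3)[unfolded that], symmetric]
    by (rule integral_cong) (simp add: gg[unfolded that])
  ultimately show "set_lebesgue_integral lborel sphere_dom (proj_integrand s l m (swsh s k j))
      = (if l = k \<and> m = j then of_real (2 * pi * harm_norm l) else 0)" by auto
qed

definition harm_sum :: "int \<Rightarrow> nat \<Rightarrow> nat \<Rightarrow> (nat \<Rightarrow> int \<Rightarrow> complex) \<Rightarrow> sphere_fun" where
  "harm_sum s i p c \<theta> \<phi> = (\<Sum>l = i..p. \<Sum>m = - int l..int l. c l m * swsh s l m \<theta> \<phi>)"

lemma harm_sum_projection: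
  assumes "s = 0 \<or> s = -1 \<and> 1 \<le> i \<and> 1 \<le> n" "\<bar>m\<bar> \<le> int n"
  shows "set_integrable lborel sphere_dom (proj_integrand s n m (harm_sum s i p c))"
    and "set_lebesgue_integral lborel sphere_dom (proj_integrand s n m (harm_sum s i p c))
      = (if i \<le> n \<and> n \<le> p then of_real (2 * pi * harm_norm n) * c n m else 0)"
proof -
  have e: "proj_integrand s n m (harm_sum s i p c) = (\<lambda>z. \<Sum>l = i..p. \<Sum>j = - int l..int l. c l j * proj_integrand s n m (swsh s l j) z)"
    unfolding proj_integrand_def harm_sum_def
    by (auto simp: fun_eq_iff sum_distrib_left scaleR_sum_right scaleR_conv_of_real mult_ac intro!: sum.cong)
  define v where "v = (\<lambda>l j. c l j * (if n = l \<and> m = j then of_real (2 * pi * harm_norm n) else 0))"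
  have "has_bochner_integral lborel (\<lambda>z. indicator sphere_dom z *\<^sub>R (c l j * proj_integrand s n m (swsh s l j) z)) (v l j)"
    if "i \<le> l" "\<bar>j\<bar> \<le> int l" for l j
  proof -
    have "s = 0 \<or> s = -1 \<and> 1 \<le> n \<and> 1 \<le> l" using assms(1) that(1) by auto
    note o = swsh_orthogonality[OF this assms(2) that(2)]
    have "has_bochner_integral lborel (\<lambda>z. indicator sphere_dom z *\<^sub>R proj_integrand s n m (swsh s l j) z)
        (if n = l \<and> m = j then of_real (2 * pi * harm_norm n) else 0)"
      using o unfolding has_bochner_integral_iff set_integrable_def set_lebesgue_integral_def by simp
    from has_bochner_integral_mult_right[OF this, of "c l j"] show ?thesis
      unfolding v_def by (simp add: mult_scaleR_right)
  qed
  then have "has_bochner_integral lborel (\<lambda>z. \<Sum>l = i..p. \<Sum>j = - int l..int l.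
      indicator sphere_dom z *\<^sub>R (c l j * proj_integrand s n m (swsh s l j) z)) (\<Sum>l = i..p. \<Sum>j = - int l..int l. v l j)"
    by (intro has_bochner_integral_sum) auto
  then have b: "has_bochner_integral lborel (\<lambda>z. indicator sphere_dom z *\<^sub>R proj_integrand s n m (harm_sum s i p c) z)
      (\<Sum>l = i..p. \<Sum>j = - int l..int l. v l j)"
    unfolding e scaleR_sum_right .
  then show "set_integrable lborel sphere_dom (proj_integrand s n m (harm_sum s i p c))"
    unfolding set_integrable_def has_bochner_integral_iff by blast
  have "set_lebesgue_integral lborel sphere_dom (proj_integrand s n m (harm_sum s i p c))
    = (\<Sum>l = i..p. \<Sum>j = - int l..int l. c l j * (if n = l \<and> m = j then of_real (2 * pi * harm_norm n) else 0))"
    using b unfolding set_lebesgue_integral_def has_bochner_integral_iff v_def by blast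
  also have "\<dots> = (\<Sum>l = i..p. if n = l then c n m * of_real (2 * pi * harm_norm n) else 0)"
  proof (rule sum.cong[OF refl])
    fix l
    have "(\<Sum>j = - int l..int l. c l j * (if n = l \<and> m = j then of_real (2 * pi * harm_norm n) else 0))
      = (\<Sum>j = - int l..int l. if m = j then (if n = l then c l j * of_real (2 * pi * harm_norm n) else 0) else 0)"
      by (rule sum.cong) auto
    then show "(\<Sum>j = - int l..int l. c l j * (if n = l \<and> m = j then of_real (2 * pi * harm_norm n) else 0))
      = (if n = l then c n m * of_real (2 * pi * harm_norm n) else 0)"
      using assms(2) by (auto simp: sum.delta)
  qed
  also have "\<dots> = (if i \<le> n \<and> n \<le> p then of_real (2 * pi * harm_norm n) * c n m else 0)"
    by (auto simp: sum.delta)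
  finally show "set_lebesgue_integral lborel sphere_dom (proj_integrand s n m (harm_sum s i p c))
      = (if i \<le> n \<and> n \<le> p then of_real (2 * pi * harm_norm n) * c n m else 0)" .
qed

text \<open>Projecting a vanishing sum on one harmonic leaves its coefficient times a norm, and the
  norm is nonzero.\<close>

lemma harm_sum_eq_0_imp:
  assumes "s = 0 \<or> s = -1 \<and> 1 \<le> i" "i \<le> l" "l \<le> p" "\<bar>m\<bar> \<le> int l"
    and "\<And>\<theta> \<phi>. 0 < \<theta> \<Longrightarrow> \<theta> < pi \<Longrightarrow> harm_sum s i p c \<theta> \<phi> = 0"
  shows "c l m = 0"
proof -
  have "set_lebesgue_integral lborel sphere_dom (proj_integrand s l m (harm_sum s i p c)) = set_lebesgue_integral lborel sphere_dom (\<lambda>z. 0)"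
    by (rule set_lebesgue_integral_cong) (auto intro!: borel_open open_Times simp: proj_integrand_def assms(5))
  then have "of_real (2 * pi * harm_norm l) * c l m = 0"
    using harm_sum_projection(2)[of s i l m p c] assms by (auto simp: set_lebesgue_integral_def)
  then show ?thesis using harm_norm_nonzero[of l] by simp
qed

lemma swsh_bounded:
  assumes "s \<in> {-1, 0, 1}" "\<bar>m\<bar> \<le> int l"
  obtains B where "\<And>\<theta> \<phi>. 0 < \<theta> \<Longrightarrow> \<theta> < pi \<Longrightarrow> norm (swsh s l m \<theta> \<phi>) \<le> B"
proof -
  obtain g where g: "continuous_on {0..pi} g" "\<forall>\<theta>\<in>{0<..<pi}. spin_leg s l m \<theta> = g \<theta>"
    using spin_leg_cont_ext[OF assms(2)] unfolding cont_ext_def by blast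
  have "bounded (g ` {0..pi})" by (intro compact_imp_bounded compact_continuous_image g) simp
  then obtain B where B: "\<And>x. x \<in> {0..pi} \<Longrightarrow> \<bar>g x\<bar> \<le> B" unfolding bounded_iff by force
  have "norm (swsh s l m \<theta> \<phi>) \<le> B" if "0 < \<theta>" "\<theta> < pi" for \<theta> \<phi>
    using B[of \<theta>] g(2) that by (simp add: separatedD[OF swsh_separated[OF assms(1)] that] norm_mult)
  then show ?thesis using that by blast
qed

section \<open>Termwise differentiation and the mode equations\<close>

text \<open>Vanishing is known only for small positive real arguments. Convergence at r/2 gives a
  complex disc, on which the sum is continuous at 0, and the limit from the right suffices.\<close>

lemma power_series_coeff_eq_0:
  fixes c :: "nat \<Rightarrow> complex"
  assumes "0 < r" "\<And>x. 0 < x \<Longrightarrow> x < r \<Longrightarrow> (\<lambda>p. c p * of_real (x ^ p)) sums 0"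
  shows "c 0 = 0"
proof -
  have sm: "summable (\<lambda>p. c p * z ^ p)" if "norm z < r / 2" for z
  proof -
    have "summable (\<lambda>p. c p * of_real (r / 2) ^ p)"
      using assms(2)[of "r / 2"] assms(1) by (auto simp: sums_iff)
    then show ?thesis by (rule powser_inside) (use that assms(1) in simp)
  qed
  have "((\<lambda>z. \<Sum>p. c p * z ^ p) \<longlongrightarrow> c 0) (at 0)"
    by (rule powser_limit_0[of "r / 2"]) (use assms(1) sm in \<open>auto intro: summable_sums\<close>)
  moreover have "filterlim complex_of_real (at 0) (at_right 0)"
    unfolding filterlim_at
    by (auto intro!: tendsto_eq_intros simp: eventually_at_filter)
  ultimately have "((\<lambda>x. \<Sum>p. c p * of_real x ^ p) \<longlongrightarrow> c 0) (at_right (0::real))"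
    by (rule filterlim_compose)
  moreover have "\<forall>\<^sub>F x in at_right (0::real). (\<Sum>p. c p * of_real x ^ p) = 0"
    unfolding eventually_at_right[OF assms(1)]
    by (intro exI[of _ r]) (use assms in \<open>auto simp: sums_iff\<close>)
  ultimately have "((\<lambda>x::real. 0) \<longlongrightarrow> c 0) (at_right 0)"
    by (rule Lim_transform_eventually)
  then show ?thesis by (simp add: tendsto_const_iff)
qed

lemma power_series_eq_0:
  fixes c :: "nat \<Rightarrow> complex"
  assumes "0 < r" "\<And>x. 0 < x \<Longrightarrow> x < r \<Longrightarrow> (\<lambda>p. c p * of_real (x ^ p)) sums 0"
  shows "c k = 0"
  using assms(2)
proof (induction k arbitrary: c)
  case 0
  then show ?case using power_series_coeff_eq_0[OF assms(1)] by blast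
next
  case (Suc k)
  have c0: "c 0 = 0" using power_series_coeff_eq_0[OF assms(1)] Suc.prems by blast
  have "(\<lambda>p. c (Suc p) * of_real (x ^ p)) sums 0" if "0 < x" "x < r" for x
  proof -
    have "(\<lambda>p. c (Suc p) * of_real (x ^ Suc p)) sums 0"
      using Suc.prems[OF that] c0 by (subst sums_Suc_iff) simp
    from sums_divide[OF this, of "of_real x"] show ?thesis using that(1) by (simp add: field_simps)
  qed
  then show ?case by (rule Suc.IH)
qed

text \<open>The Maxwell equations are phrased with the total function
  \<open>vector_derivative\<close>, which says nothing unless the field is differentiable. Uniform
  convergence of the differentiated series supplies differentiability together with the
  value.\<close>

lemma series_vector_derivative:
  fixes f :: "nat \<Rightarrow> real \<Rightarrow> complex"
  assumes S: "open S" "convex S" "x \<in> S"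
    and d: "\<And>p x. x \<in> S \<Longrightarrow> (f p has_vector_derivative f' p x) (at x)"
    and u: "uniformly_convergent_on S (\<lambda>N x. \<Sum>p<N. f' p x)"
    and s: "\<And>x. x \<in> S \<Longrightarrow> (\<lambda>p. f p x) sums F x"
  shows "(\<lambda>p. f' p x) sums vector_derivative F (at x)"
    and "(F has_vector_derivative vector_derivative F (at x)) (at x)"
proof -
  obtain g where g: "uniform_limit S (\<lambda>N x. \<Sum>p<N. f' p x) g sequentially"
    using u unfolding uniformly_convergent_on_def by blast
  have "\<exists>G. \<forall>x\<in>S. (\<lambda>n. f n x) sums (G x) \<and> (G has_derivative (\<lambda>h. h *\<^sub>R g x)) (at x within S)"
  proof (rule has_derivative_series[OF S(2)])
    show "(f p has_derivative (\<lambda>h. h *\<^sub>R f' p y)) (at y within S)" if "y \<in> S" for p y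
      using d[OF that] unfolding has_vector_derivative_def by (rule has_derivative_at_withinI)
    show "\<forall>\<^sub>F n in sequentially. \<forall>y\<in>S. \<forall>h. norm ((\<Sum>i<n. h *\<^sub>R f' i y) - h *\<^sub>R g y) \<le> e * norm h" if "e > 0" for e
    proof -
      have "\<forall>\<^sub>F n in sequentially. \<forall>y\<in>S. dist (\<Sum>p<n. f' p y) (g y) < e"
        using g that unfolding uniform_limit_iff by blast
      then show ?thesis
      proof eventually_elim
        case (elim n)
        show ?case
        proof (intro ballI allI)
          fix y and h :: real assume "y \<in> S"
          then have "norm ((\<Sum>p<n. f' p y) - g y) \<le> e" using elim by (auto simp: dist_norm less_imp_le)
          moreover have "(\<Sum>i<n. h *\<^sub>R f' i y) - h *\<^sub>R g y = h *\<^sub>R ((\<Sum>p<n. f' p y) - g y)"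
            by (simp add: scaleR_sum_right scaleR_diff_right)
          ultimately show "norm ((\<Sum>i<n. h *\<^sub>R f' i y) - h *\<^sub>R g y) \<le> e * norm h"
            using mult_left_mono[of "norm ((\<Sum>p<n. f' p y) - g y)" e "norm h"]
            by (simp only: norm_scaleR mult.commute[of e] real_norm_def abs_ge_zero)
        qed
      qed
    qed
  qed (use S s in auto)
  then obtain G where G: "\<And>x. x \<in> S \<Longrightarrow> (\<lambda>n. f n x) sums (G x)"
    "\<And>x. x \<in> S \<Longrightarrow> (G has_derivative (\<lambda>h. h *\<^sub>R g x)) (at x within S)" by blast
  have GF: "G y = F y" if "y \<in> S" for y by (rule sums_unique2[OF G(1)[OF that] s[OF that]])
  have "(G has_vector_derivative g x) (at x)"
    using G(2)[OF S(3)] unfolding has_vector_derivative_def at_within_open[OF S(3,1)] .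
  then have F: "(F has_vector_derivative g x) (at x)"
    by (rule has_vector_derivative_transform_within_open[OF _ S(1,3)]) (rule GF)
  have "(\<lambda>N. \<Sum>p<N. f' p x) \<longlonglongrightarrow> g x" using g S(3) by (rule tendsto_uniform_limitI)
  then show "(\<lambda>p. f' p x) sums vector_derivative F (at x)"
    unfolding sums_def vector_derivative_at[OF F] .
  show "(F has_vector_derivative vector_derivative F (at x)) (at x)"
    unfolding vector_derivative_at[OF F] by (rule F)
qed

lemma uniformly_convergent_on_reparam:
  assumes "uniformly_convergent_on Y F" "\<And>x. x \<in> X \<Longrightarrow> g x \<in> Y"
  shows "uniformly_convergent_on X (\<lambda>N x. F N (g x))"
proof -
  obtain l where "uniform_limit Y F l sequentially" using assms(1) unfolding uniformly_convergent_on_def by blast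
  then have "uniform_limit X (\<lambda>N x. F N (g x)) (\<lambda>x. l (g x)) sequentially"
    unfolding uniform_limit_iff using assms(2) by (fast elim: eventually_mono)
  then show ?thesis unfolding uniformly_convergent_on_def by blast
qed

text \<open>Uniform convergence is given for the invariant operators, termwise differentiation needs
  the coordinate derivatives. These are recovered by inverting the definitions: the sum of
  \<open>eth\<close> and \<open>ethbar\<close> isolates the polar derivative, their difference the
  azimuthal one. At fixed \<theta> the factors sin \<theta> and cot \<theta> are constants, so they
  do not spoil uniformity.\<close>

lemma eth_ethbar_series:
  fixes u :: "nat \<Rightarrow> sphere_fun"
  assumes dt: "\<And>p \<theta> \<phi>. 0 < \<theta> \<Longrightarrow> \<theta> < pi \<Longrightarrow> ((\<lambda>x. u p x \<phi>) has_vector_derivative vector_derivative (\<lambda>x. u p x \<phi>) (at \<theta>)) (at \<theta>)"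
    and dp: "\<And>p \<theta> \<phi>. 0 < \<theta> \<Longrightarrow> \<theta> < pi \<Longrightarrow> ((\<lambda>y. u p \<theta> y) has_vector_derivative vector_derivative (\<lambda>y. u p \<theta> y) (at \<phi>)) (at \<phi>)"
    and s: "\<And>\<theta> \<phi>. 0 < \<theta> \<Longrightarrow> \<theta> < pi \<Longrightarrow> (\<lambda>p. u p \<theta> \<phi>) sums U \<theta> \<phi>"
    and c0: "uniformly_convergent_on ({0<..<pi} \<times> UNIV) (\<lambda>N (\<theta>, \<phi>). \<Sum>p<N. u p \<theta> \<phi>)"
    and c1: "uniformly_convergent_on ({0<..<pi} \<times> UNIV) (\<lambda>N (\<theta>, \<phi>). \<Sum>p<N. eth s (u p) \<theta> \<phi>)"
    and c2: "uniformly_convergent_on ({0<..<pi} \<times> UNIV) (\<lambda>N (\<theta>, \<phi>). \<Sum>p<N. ethbar s (u p) \<theta> \<phi>)"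
    and th: "0 < \<theta>" "\<theta> < pi"
  shows "(\<lambda>p. eth s (u p) \<theta> \<phi>) sums eth s U \<theta> \<phi>" "(\<lambda>p. ethbar s (u p) \<theta> \<phi>) sums ethbar s U \<theta> \<phi>"
proof -
  have vt: "vector_derivative (\<lambda>x. u p x \<phi>) (at t) = - (1/2) * (eth s (u p) t \<phi> + ethbar s (u p) t \<phi>)" for p t
    by (simp add: eth_def ethbar_def)
  have vp: "vector_derivative (\<lambda>y. u p \<theta> y) (at y) = \<i> * of_real (sin \<theta>) / 2 *
     (eth s (u p) \<theta> y - ethbar s (u p) \<theta> y - 2 * of_int s * of_real (cot \<theta>) * u p \<theta> y)" for p y
    using sin_gt_zero[OF th] by (simp add: eth_def ethbar_def field_simps)
  have "uniformly_convergent_on {0<..<pi} (\<lambda>N t. - (1/2) * ((\<Sum>p<N. eth s (u p) t \<phi>) + (\<Sum>p<N. ethbar s (u p) t \<phi>)))"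
    by (intro uniformly_convergent_mult uniformly_convergent_add)
      (use uniformly_convergent_on_reparam[OF c1, of "{0<..<pi}" "\<lambda>t. (t, \<phi>)"]
        uniformly_convergent_on_reparam[OF c2, of "{0<..<pi}" "\<lambda>t. (t, \<phi>)"] in auto)
  then have uT: "uniformly_convergent_on {0<..<pi} (\<lambda>N t. \<Sum>p<N. vector_derivative (\<lambda>x. u p x \<phi>) (at t))"
    unfolding vt sum_distrib_left[symmetric] sum.distrib .
  have "uniformly_convergent_on UNIV (\<lambda>N y. \<i> * of_real (sin \<theta>) / 2 *
     ((\<Sum>p<N. eth s (u p) \<theta> y) - (\<Sum>p<N. ethbar s (u p) \<theta> y) - 2 * of_int s * of_real (cot \<theta>) * (\<Sum>p<N. u p \<theta> y)))"
    by (intro uniformly_convergent_mult uniformly_convergent_minus)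
      (use uniformly_convergent_on_reparam[OF c1, of UNIV "\<lambda>y. (\<theta>, y)"]
        uniformly_convergent_on_reparam[OF c2, of UNIV "\<lambda>y. (\<theta>, y)"]
        uniformly_convergent_on_reparam[OF c0, of UNIV "\<lambda>y. (\<theta>, y)"] th in auto)
  then have uP: "uniformly_convergent_on UNIV (\<lambda>N y. \<Sum>p<N. vector_derivative (\<lambda>y. u p \<theta> y) (at y))"
    unfolding vp sum_distrib_left[symmetric] sum_subtractf .
  have T: "(\<lambda>p. vector_derivative (\<lambda>x. u p x \<phi>) (at \<theta>)) sums vector_derivative (\<lambda>x. U x \<phi>) (at \<theta>)"
    by (rule series_vector_derivative(1)[OF _ _ _ _ uT]) (use dt s th in auto)
  have P: "(\<lambda>p. vector_derivative (\<lambda>y. u p \<theta> y) (at \<phi>)) sums vector_derivative (\<lambda>y. U \<theta> y) (at \<phi>)"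
    by (rule series_vector_derivative(1)[OF _ _ _ _ uP]) (use dp s th in auto)
  show "(\<lambda>p. eth s (u p) \<theta> \<phi>) sums eth s U \<theta> \<phi>" "(\<lambda>p. ethbar s (u p) \<theta> \<phi>) sums ethbar s U \<theta> \<phi>"
    unfolding eth_def ethbar_def
    by (intro sums_minus sums_add sums_diff sums_mult T P s[OF th])+
qed

section \<open>Termwise action of the differential operators on the expansion\<close>

lemma spin_weight_simps [simp]: "spin_weight 0 = 1" "spin_weight (Suc 0) = 0" "spin_weight 1 = 0" "spin_weight 2 = -1"
  by (simp_all add: spin_weight_def)

lemma spin_weight_range: "n \<le> 2 \<Longrightarrow> spin_weight n \<in> {-1, 0, 1}"
  unfolding spin_weight_def by auto

text \<open>The operator stands inside the sum, as it does in \<open>term_deriv\<close>;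
  \<open>eth_harm_sum\<close> pulls it out.\<close>

definition harm_sum_op :: "(sphere_fun \<Rightarrow> sphere_fun) \<Rightarrow> int \<Rightarrow> nat \<Rightarrow> nat \<Rightarrow> (nat \<Rightarrow> int \<Rightarrow> complex) \<Rightarrow> sphere_fun" where
  "harm_sum_op L s i p c \<theta> \<phi> = (\<Sum>l = i..p. \<Sum>m = - int l..int l. c l m * L (swsh s l m) \<theta> \<phi>)"

lemma harm_sum_cmult: "harm_sum s i p (\<lambda>l m. k * c l m) \<theta> \<phi> = k * harm_sum s i p c \<theta> \<phi>"
  unfolding harm_sum_def by (simp only: sum_distrib_left mult.assoc)

lemma harm_sum_theta_derivative:
  assumes "s \<in> {-1, 0, 1}" "0 < \<theta>" "\<theta> < pi"
  shows "((\<lambda>x. harm_sum s i p c x \<phi>) has_vector_derivative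
     (\<Sum>l = i..p. \<Sum>m = - int l..int l. c l m * vector_derivative (\<lambda>x. swsh s l m x \<phi>) (at \<theta>))) (at \<theta>)"
  unfolding harm_sum_def
  by (intro has_vector_derivative_sum has_vector_derivative_mult_right)
    (use vector_derivative_at[OF swsh_derivs(1)] swsh_derivs(1) assms in auto)

lemma harm_sum_phi_derivative:
  assumes "s \<in> {-1, 0, 1}" "0 < \<theta>" "\<theta> < pi"
  shows "((\<lambda>y. harm_sum s i p c \<theta> y) has_vector_derivative
     (\<Sum>l = i..p. \<Sum>m = - int l..int l. c l m * vector_derivative (\<lambda>y. swsh s l m \<theta> y) (at \<phi>))) (at \<phi>)"
  unfolding harm_sum_def
  by (intro has_vector_derivative_sum has_vector_derivative_mult_right)
    (use vector_derivative_at[OF swsh_derivs(2)] swsh_derivs(2) assms in auto)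

lemma eth_harm_sum:
  assumes "s \<in> {-1, 0, 1}" "0 < \<theta>" "\<theta> < pi"
  shows "eth k (harm_sum s i p c) \<theta> \<phi> = harm_sum_op (eth k) s i p c \<theta> \<phi>"
    and "ethbar k (harm_sum s i p c) \<theta> \<phi> = harm_sum_op (ethbar k) s i p c \<theta> \<phi>"
  unfolding eth_def ethbar_def harm_sum_op_def
  by (simp_all only: vector_derivative_at[OF harm_sum_theta_derivative[OF assms]]
      vector_derivative_at[OF harm_sum_phi_derivative[OF assms]])
    (simp_all add: harm_sum_def sum_distrib_left sum.distrib sum_subtractf algebra_simps flip: sum_negf)

definition expansion_coeff :: "coeffs \<Rightarrow> nat \<Rightarrow> nat \<Rightarrow> real \<Rightarrow> nat \<Rightarrow> nat \<Rightarrow> int \<Rightarrow> complex" where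
  "expansion_coeff a n i \<tau> p l m = nth_deriv i (a n p l m) \<tau> / fact p"

abbreviation expansion_term :: "coeffs \<Rightarrow> nat \<Rightarrow> nat \<Rightarrow> real \<Rightarrow> nat \<Rightarrow> sphere_fun" where
  "expansion_term a n i \<tau> p \<equiv> harm_sum (spin_weight n) (nat \<bar>spin_weight n\<bar>) p (expansion_coeff a n i \<tau> p)"

lemma term_deriv_Nil:
  "term_deriv a n p i j [] \<tau> \<rho> \<theta> \<phi>
     = of_real ((deriv ^^ j) (\<lambda>x. x ^ p) \<rho>) * expansion_term a n i \<tau> p \<theta> \<phi>"
  unfolding term_deriv_def harm_sum_def expansion_coeff_def by (simp add: sum_distrib_left mult_ac)

lemma term_deriv_eth:
  "term_deriv a n p i j [True] \<tau> \<rho> \<theta> \<phi>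
     = of_real ((deriv ^^ j) (\<lambda>x. x ^ p) \<rho>) * harm_sum_op (eth (spin_weight n)) (spin_weight n) (nat \<bar>spin_weight n\<bar>) p (expansion_coeff a n i \<tau> p) \<theta> \<phi>"
  "term_deriv a n p i j [False] \<tau> \<rho> \<theta> \<phi>
     = of_real ((deriv ^^ j) (\<lambda>x. x ^ p) \<rho>) * harm_sum_op (ethbar (spin_weight n)) (spin_weight n) (nat \<bar>spin_weight n\<bar>) p (expansion_coeff a n i \<tau> p) \<theta> \<phi>"
  unfolding term_deriv_def harm_sum_op_def expansion_coeff_def by (simp_all add: sum_distrib_left mult_ac)

lemma eth_scale:
  "eth k (\<lambda>\<theta> \<phi>. c * f \<theta> \<phi>) \<theta> \<phi> = c * eth k f \<theta> \<phi>" "ethbar k (\<lambda>\<theta> \<phi>. c * f \<theta> \<phi>) \<theta> \<phi> = c * ethbar k f \<theta> \<phi>"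
  if "((\<lambda>x. f x \<phi>) has_vector_derivative d) (at \<theta>)" "((\<lambda>y. f \<theta> y) has_vector_derivative e) (at \<phi>)"
  unfolding eth_def ethbar_def
  by (simp_all only: vector_derivative_at[OF has_vector_derivative_mult_right[OF that(1)]]
    vector_derivative_at[OF has_vector_derivative_mult_right[OF that(2)]]
    vector_derivative_at[OF that(1)] vector_derivative_at[OF that(2)]) (simp_all add: algebra_simps)

lemma has_expansionD:
  assumes "has_expansion \<rho>0 F a" "n \<le> 2"
  shows "\<And>p l m i. nat \<bar>spin_weight n\<bar> \<le> l \<Longrightarrow> l \<le> p \<Longrightarrow> \<bar>m\<bar> \<le> int l \<Longrightarrow> nth_deriv i (a n p l m) differentiable_on {-1<..<1}"
    "\<And>r. 0 < r \<Longrightarrow> r < \<rho>0 \<Longrightarrow> uniform_limit ({-1..1} \<times> {0..r} \<times> {0<..<pi} \<times> UNIV)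
             (\<lambda>N (\<tau>, \<rho>, \<theta>, \<phi>). \<Sum>p<N. term_deriv a n p 0 0 [] \<tau> \<rho> \<theta> \<phi>)
             (\<lambda>(\<tau>, \<rho>, \<theta>, \<phi>). F n \<tau> \<rho> \<theta> \<phi>) sequentially"
    "\<And>r i j w. 0 < r \<Longrightarrow> r < \<rho>0 \<Longrightarrow> uniformly_convergent_on ({-1<..<1} \<times> {0..r} \<times> {0<..<pi} \<times> UNIV)
             (\<lambda>N (\<tau>, \<rho>, \<theta>, \<phi>). \<Sum>p<N. term_deriv a n p i j w \<tau> \<rho> \<theta> \<phi>)"
  using assms unfolding has_expansion_def by blast+

lemma nth_deriv_has_vector_derivative:
  assumes "nth_deriv i f differentiable_on {-1<..<1}" "-1 < t" "t < 1"
  shows "(nth_deriv i f has_vector_derivative nth_deriv (Suc i) f t) (at t)"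
proof -
  have "nth_deriv i f differentiable (at t)"
    using assms differentiable_on_eq_differentiable_at[of "{-1<..<1}" "nth_deriv i f"] by auto
  then show ?thesis unfolding nth_deriv_def by (simp add: vector_derivative_works)
qed

context
  fixes \<rho>0 F a n
  assumes ex: "has_expansion \<rho>0 F a" and n: "n \<le> (2::nat)"
begin

lemma expansion_sums:
  assumes "\<tau> \<in> {-1..1}" "0 < \<rho>" "\<rho> < \<rho>0" "0 < \<theta>" "\<theta> < pi"
  shows "(\<lambda>p. of_real (\<rho> ^ p) * expansion_term a n 0 \<tau> p \<theta> \<phi>) sums F n \<tau> \<rho> \<theta> \<phi>"
proof -
  have "(\<lambda>N. \<Sum>p<N. term_deriv a n p 0 0 [] \<tau> \<rho> \<theta> \<phi>) \<longlonglongrightarrow> F n \<tau> \<rho> \<theta> \<phi>"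
    using tendsto_uniform_limitI[OF has_expansionD(2)[OF ex n assms(2,3)], of "(\<tau>, \<rho>, \<theta>, \<phi>)"] assms by auto
  then show ?thesis unfolding sums_def term_deriv_Nil by simp
qed

lemma expansion_tau_sums:
  assumes "-1 < \<tau>" "\<tau> < 1" "0 < \<rho>" "\<rho> < \<rho>0" "0 < \<theta>" "\<theta> < pi"
  shows "(\<lambda>p. of_real (\<rho> ^ p) * expansion_term a n 1 \<tau> p \<theta> \<phi>) sums d_tau (F n) \<tau> \<rho> \<theta> \<phi>"
  unfolding d_tau_def
proof (rule series_vector_derivative(1)[of "{-1<..<1}"])
  fix p t assume t: "t \<in> {-1<..<1::real}"
  have "((\<lambda>t. nth_deriv 0 (a n p l m) t) has_vector_derivative nth_deriv 1 (a n p l m) t) (at t)"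
    if "l \<in> {nat \<bar>spin_weight n\<bar>..p}" "m \<in> {- int l..int l}" for l m
    using nth_deriv_has_vector_derivative[OF has_expansionD(1)[OF ex n, of l p m 0], of t] that t by auto
  then show "((\<lambda>t. of_real (\<rho> ^ p) * expansion_term a n 0 t p \<theta> \<phi>)
     has_vector_derivative of_real (\<rho> ^ p) * expansion_term a n 1 t p \<theta> \<phi>) (at t)"
    unfolding harm_sum_def expansion_coeff_def
    by (intro has_vector_derivative_mult_right has_vector_derivative_sum has_vector_derivative_mult_left has_vector_derivative_divide) auto
next
  show "uniformly_convergent_on {-1<..<1} (\<lambda>N t. \<Sum>p<N. of_real (\<rho> ^ p) * expansion_term a n 1 t p \<theta> \<phi>)"
    using uniformly_convergent_on_reparam[OF has_expansionD(3)[OF ex n assms(3,4), of 1 0 "[]"], of "{-1<..<1}" "\<lambda>t. (t, \<rho>, \<theta>, \<phi>)"] assms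
    by (simp add: term_deriv_Nil)
qed (use assms expansion_sums in auto)

lemma expansion_rho_sums:
  assumes "-1 < \<tau>" "\<tau> < 1" "0 < \<rho>" "\<rho> < \<rho>0" "0 < \<theta>" "\<theta> < pi"
  shows "(\<lambda>p. of_real (\<rho> ^ p) * harm_sum (spin_weight n) (nat \<bar>spin_weight n\<bar>) p (\<lambda>l m. of_nat p * expansion_coeff a n 0 \<tau> p l m) \<theta> \<phi>)
     sums (of_real \<rho> * d_rho (F n) \<tau> \<rho> \<theta> \<phi>)"
proof -
  \<comment> \<open>Uniform convergence holds on [0, r] only for r < \<rho>0, and differentiation at
    \<rho> needs an open interval around it. After multiplication by \<rho> the derivative acts on
    the degree p term as multiplication by p.\<close>
  obtain r where r: "\<rho> < r" "r < \<rho>0" using dense assms by blast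
  let ?h = "\<lambda>p. expansion_term a n 0 \<tau> p \<theta> \<phi>"
  have dr: "((\<lambda>x::real. x ^ p) has_real_derivative of_nat p * x ^ (p - 1)) (at x)" for x p
    by (rule derivative_eq_intros refl)+ simp
  have "(\<lambda>p. of_real (of_nat p * \<rho> ^ (p - 1)) * ?h p) sums d_rho (F n) \<tau> \<rho> \<theta> \<phi>"
    unfolding d_rho_def
  proof (rule series_vector_derivative(1)[of "{0<..<r}"])
    fix p x assume "x \<in> {0<..<r}"
    show "((\<lambda>x. of_real (x ^ p) * ?h p) has_vector_derivative of_real (of_nat p * x ^ (p - 1)) * ?h p) (at x)"
      by (intro has_vector_derivative_mult_left has_vector_derivative_of_real)
        (use dr in \<open>simp add: has_real_derivative_iff_has_vector_derivative\<close>)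
  next
    have "uniformly_convergent_on {0<..<r} (\<lambda>N x. \<Sum>p<N. term_deriv a n p 0 1 [] \<tau> x \<theta> \<phi>)"
      using uniformly_convergent_on_reparam[OF has_expansionD(3)[OF ex n, of r 0 1 "[]"], of "{0<..<r}" "\<lambda>x. (\<tau>, x, \<theta>, \<phi>)"] assms r
      by simp
    then show "uniformly_convergent_on {0<..<r} (\<lambda>N x. \<Sum>p<N. of_real (of_nat p * x ^ (p - 1)) * ?h p)"
      unfolding term_deriv_Nil by (simp add: DERIV_imp_deriv[OF dr])
  qed (use assms r expansion_sums in auto)
  from sums_mult[OF this, of "of_real \<rho>"]
  have "(\<lambda>p. of_real \<rho> * (of_real (of_nat p * \<rho> ^ (p - 1)) * ?h p)) sums (of_real \<rho> * d_rho (F n) \<tau> \<rho> \<theta> \<phi>)" .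
  moreover have "of_real \<rho> * (of_real (of_nat p * \<rho> ^ (p - 1)) * ?h p)
    = of_real (\<rho> ^ p) * harm_sum (spin_weight n) (nat \<bar>spin_weight n\<bar>) p (\<lambda>l m. of_nat p * expansion_coeff a n 0 \<tau> p l m) \<theta> \<phi>" for p
    unfolding harm_sum_cmult by (cases p) (simp_all add: mult_ac)
  ultimately show ?thesis by simp
qed

lemma expansion_eth_sums:
  assumes "-1 < \<tau>" "\<tau> < 1" "0 < \<rho>" "\<rho> < \<rho>0" "0 < \<theta>" "\<theta> < pi"
  shows "(\<lambda>p. of_real (\<rho> ^ p) * harm_sum_op (eth (spin_weight n)) (spin_weight n) (nat \<bar>spin_weight n\<bar>) p (expansion_coeff a n 0 \<tau> p) \<theta> \<phi>)
      sums eth (spin_weight n) (F n \<tau> \<rho>) \<theta> \<phi>"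
    and "(\<lambda>p. of_real (\<rho> ^ p) * harm_sum_op (ethbar (spin_weight n)) (spin_weight n) (nat \<bar>spin_weight n\<bar>) p (expansion_coeff a n 0 \<tau> p) \<theta> \<phi>)
      sums ethbar (spin_weight n) (F n \<tau> \<rho>) \<theta> \<phi>"
proof -
  let ?s = "spin_weight n"
  let ?h = "\<lambda>p. harm_sum ?s (nat \<bar>?s\<bar>) p (expansion_coeff a n 0 \<tau> p)"
  define u where "u = (\<lambda>p \<theta> \<phi>. complex_of_real (\<rho> ^ p) * ?h p \<theta> \<phi>)"
  note s = spin_weight_range[OF n]
  note dt = harm_sum_theta_derivative[OF s] and dp = harm_sum_phi_derivative[OF s]
  have eu: "eth ?s (u p) \<theta> \<phi> = term_deriv a n p 0 0 [True] \<tau> \<rho> \<theta> \<phi>"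
    "ethbar ?s (u p) \<theta> \<phi> = term_deriv a n p 0 0 [False] \<tau> \<rho> \<theta> \<phi>" if "0 < \<theta>" "\<theta> < pi" for p \<theta> \<phi>
    unfolding u_def eth_scale[OF dt[OF that] dp[OF that]] eth_harm_sum[OF s that] term_deriv_eth by simp_all
  have unil: "uniformly_convergent_on ({0<..<pi} \<times> UNIV) (\<lambda>N (\<theta>, \<phi>). \<Sum>p<N. term_deriv a n p 0 0 w \<tau> \<rho> \<theta> \<phi>)" for w
    using uniformly_convergent_on_reparam[OF has_expansionD(3)[OF ex n assms(3,4), of 0 0 w], of "{0<..<pi} \<times> UNIV"
       "\<lambda>z. (\<tau>, \<rho>, z)"] assms by (auto simp: case_prod_unfold)
  have cong: "uniformly_convergent_on ({0<..<pi} \<times> UNIV) (\<lambda>N (\<theta>, \<phi>). \<Sum>p<N. f p \<theta> \<phi>)"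
    if "\<And>p \<theta> \<phi>. 0 < \<theta> \<Longrightarrow> \<theta> < pi \<Longrightarrow> f p \<theta> \<phi> = term_deriv a n p 0 0 w \<tau> \<rho> \<theta> \<phi>" for f w
  proof -
    have "\<forall>\<^sub>F N in sequentially. \<forall>z\<in>{0<..<pi} \<times> UNIV. (case z of (\<theta>, \<phi>) \<Rightarrow> \<Sum>p<N. f p \<theta> \<phi>)
       = (case z of (\<theta>, \<phi>) \<Rightarrow> \<Sum>p<N. term_deriv a n p 0 0 w \<tau> \<rho> \<theta> \<phi>)"
      by (intro always_eventually allI ballI) (auto intro!: sum.cong that)
    from uniformly_convergent_cong[OF this refl] unil[of w] show ?thesis by (rule iffD2)
  qed
  have vd: "(f has_vector_derivative vector_derivative f (at x)) (at x)" if "(f has_vector_derivative d) (at x)" for f :: "real \<Rightarrow> complex" and d x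
    using that by (simp add: vector_derivative_at)
  have d1: "((\<lambda>x. u p x \<phi>) has_vector_derivative vector_derivative (\<lambda>x. u p x \<phi>) (at \<theta>)) (at \<theta>)"
    if "0 < \<theta>" "\<theta> < pi" for p \<theta> \<phi>
    unfolding u_def by (rule vd[OF has_vector_derivative_mult_right[OF dt[OF that]]])
  have d2: "((\<lambda>y. u p \<theta> y) has_vector_derivative vector_derivative (\<lambda>y. u p \<theta> y) (at \<phi>)) (at \<phi>)"
    if "0 < \<theta>" "\<theta> < pi" for p \<theta> \<phi>
    unfolding u_def by (rule vd[OF has_vector_derivative_mult_right[OF dp[OF that]]])
  have us: "(\<lambda>p. u p \<theta> \<phi>) sums F n \<tau> \<rho> \<theta> \<phi>" if "0 < \<theta>" "\<theta> < pi" for \<theta> \<phi>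
    unfolding u_def using expansion_sums assms that by auto
  have u0: "u p \<theta> \<phi> = term_deriv a n p 0 0 [] \<tau> \<rho> \<theta> \<phi>" for p \<theta> \<phi>
    unfolding u_def term_deriv_Nil by simp
  note E = eth_ethbar_series[of u "F n \<tau> \<rho>" ?s \<theta> \<phi>, OF d1 d2 us cong[OF u0] cong[OF eu(1)] cong[OF eu(2)] assms(5,6)]
  have "(\<lambda>p. eth ?s (u p) \<theta> \<phi>) sums eth ?s (F n \<tau> \<rho>) \<theta> \<phi> \<and> (\<lambda>p. ethbar ?s (u p) \<theta> \<phi>) sums ethbar ?s (F n \<tau> \<rho>) \<theta> \<phi>"
    using E by blast
  then show "(\<lambda>p. of_real (\<rho> ^ p) * harm_sum_op (eth ?s) ?s (nat \<bar>?s\<bar>) p (expansion_coeff a n 0 \<tau> p) \<theta> \<phi>) sums eth ?s (F n \<tau> \<rho>) \<theta> \<phi>"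
    "(\<lambda>p. of_real (\<rho> ^ p) * harm_sum_op (ethbar ?s) ?s (nat \<bar>?s\<bar>) p (expansion_coeff a n 0 \<tau> p) \<theta> \<phi>) sums ethbar ?s (F n \<tau> \<rho>) \<theta> \<phi>"
    unfolding eu[OF assms(5,6)] term_deriv_eth by simp_all
qed

end

section \<open>The Maxwell equations mode by mode\<close>

abbreviation mode_freq :: "nat \<Rightarrow> complex" where
  "mode_freq l \<equiv> of_real (sqrt (real l * (real l + 1)))"

lemma harm_sum_add: "harm_sum s i p c \<theta> \<phi> + harm_sum s i p d \<theta> \<phi> = harm_sum s i p (\<lambda>l m. c l m + d l m) \<theta> \<phi>"
  unfolding harm_sum_def sum.distrib[symmetric] by (simp only: distrib_right)

text \<open>Since \<open>mode_freq 0 = 0\<close>, the mode l = 0 drops out after applying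
  \<open>eth\<close> or \<open>ethbar\<close>. This reconciles sums from l = 0 (weight 0) with sums
  from l = 1 (weights 1 and -1).\<close>

lemma harm_sum_drop_0:
  assumes "\<And>m. c 0 m = 0"
  shows "harm_sum s 0 p c \<theta> \<phi> = harm_sum s 1 p c \<theta> \<phi>"
  unfolding harm_sum_def by (subst sum.atLeast_Suc_atMost) (use assms in auto)

lemma harm_sum_cong:
  "(\<And>l m. i \<le> l \<Longrightarrow> l \<le> p \<Longrightarrow> \<bar>m\<bar> \<le> int l \<Longrightarrow> c l m = d l m) \<Longrightarrow> harm_sum s i p c \<theta> \<phi> = harm_sum s i p d \<theta> \<phi>"
  unfolding harm_sum_def by (intro sum.cong refl) auto

lemma harm_sum_op_ethbar_0:
  assumes "0 < \<theta>" "\<theta> < pi"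
  shows "harm_sum_op (ethbar 0) 0 0 p c \<theta> \<phi> = harm_sum (-1) 1 p (\<lambda>l m. - mode_freq l * c l m) \<theta> \<phi>"
proof -
  have "harm_sum_op (ethbar 0) 0 0 p c \<theta> \<phi> = harm_sum (-1) 0 p (\<lambda>l m. - mode_freq l * c l m) \<theta> \<phi>"
    unfolding harm_sum_op_def harm_sum_def
    by (intro sum.cong refl) (use ethbar_swsh_0[OF assms] in \<open>auto simp del: of_real_mult real_sqrt_mult\<close>)
  then show ?thesis by (simp add: harm_sum_drop_0)
qed

lemma harm_sum_op_eth_minus1:
  assumes "0 < \<theta>" "\<theta> < pi"
  shows "harm_sum_op (eth (-1)) (-1) 1 p c \<theta> \<phi> = harm_sum 0 0 p (\<lambda>l m. mode_freq l * c l m) \<theta> \<phi>"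
proof -
  have "harm_sum_op (eth (-1)) (-1) 1 p c \<theta> \<phi> = harm_sum 0 1 p (\<lambda>l m. mode_freq l * c l m) \<theta> \<phi>"
    unfolding harm_sum_op_def harm_sum_def
    by (intro sum.cong refl) (use eth_swsh_minus1[OF assms] in \<open>auto simp del: of_real_mult real_sqrt_mult\<close>)
  then show ?thesis by (simp add: harm_sum_drop_0)
qed

lemma harm_sum_op_ethbar_1:
  assumes "0 < \<theta>" "\<theta> < pi"
  shows "harm_sum_op (ethbar 1) 1 1 p c \<theta> \<phi> = harm_sum 0 0 p (\<lambda>l m. - mode_freq l * c l m) \<theta> \<phi>"
proof -
  have "harm_sum_op (ethbar 1) 1 1 p c \<theta> \<phi> = harm_sum 0 1 p (\<lambda>l m. - mode_freq l * c l m) \<theta> \<phi>"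
    unfolding harm_sum_op_def harm_sum_def
    by (intro sum.cong refl) (use ethbar_swsh_1[OF assms] in \<open>auto simp del: of_real_mult real_sqrt_mult\<close>)
  then show ?thesis by (simp add: harm_sum_drop_0)
qed

text \<open>Two identity principles in succession: at fixed angles the power series in \<rho>
  isolates p, then orthogonality of the harmonics isolates l and m.\<close>

lemma mode_coeff_eq_0:
  assumes "0 < \<rho>0" "s = 0 \<or> s = -1 \<and> 1 \<le> i" "i \<le> l" "l \<le> p" "\<bar>m\<bar> \<le> int l"
    and "\<And>\<rho> \<theta> \<phi>. 0 < \<rho> \<Longrightarrow> \<rho> < \<rho>0 \<Longrightarrow> 0 < \<theta> \<Longrightarrow> \<theta> < pi \<Longrightarrow>
      (\<lambda>p. of_real (\<rho> ^ p) * harm_sum s i p (c p) \<theta> \<phi>) sums 0"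
  shows "c p l m = 0"
proof (rule harm_sum_eq_0_imp[OF assms(2-5)])
  fix \<theta> \<phi> :: real assume "0 < \<theta>" "\<theta> < pi"
  then show "harm_sum s i p (c p) \<theta> \<phi> = 0"
    by (intro power_series_eq_0[OF assms(1), of "\<lambda>p. harm_sum s i p (c p) \<theta> \<phi>"])
      (use assms(6) in \<open>simp add: mult.commute\<close>)
qed

context
  fixes \<rho>0 F a
  assumes r0: "0 < \<rho>0" and mx: "maxwell_equations \<rho>0 F" and ex: "has_expansion \<rho>0 F a"
begin

text \<open>These are the evolution equation of component 1, that of component 2, and the
  constraint. Their spin weights are 0, -1 and 0, the weights for which orthogonality is
  established.\<close>

lemma maxwell_mode_equations:
  assumes t: "-1 < \<tau>" "\<tau> < 1" and l: "1 \<le> l" "l \<le> p" "\<bar>m\<bar> \<le> int l"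
  defines "x \<equiv> \<lambda>n. a n p l m \<tau>" and "x' \<equiv> \<lambda>n. nth_deriv 1 (a n p l m) \<tau>"
  shows "x' 1 + 1/2 * (mode_freq l * x 2 - mode_freq l * x 0) = 0"
    and "(1 - of_real \<tau>) * x' 2 + of_nat p * x 2 - mode_freq l * x 1 - x 2 = 0"
    and "of_real \<tau> * x' 1 - of_nat p * x 1 + 1/2 * (mode_freq l * x 2 + mode_freq l * x 0) = 0"
proof -
  note ex0 = ex[THEN expansion_eth_sums(2), of 0 \<tau>, simplified, OF t]
  note ex1 = ex[THEN expansion_eth_sums(2), of 1 \<tau>, simplified, OF t]
  note ex2 = ex[THEN expansion_eth_sums(1), of 2 \<tau>, simplified, OF t]
  note dt1 = ex[THEN expansion_tau_sums, of 1 \<tau>, simplified, OF t]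
  note dt2 = ex[THEN expansion_tau_sums, of 2 \<tau>, simplified, OF t]
  note dr1 = ex[THEN expansion_rho_sums, of 1 \<tau>, simplified, OF t]
  note dr2 = ex[THEN expansion_rho_sums, of 2 \<tau>, simplified, OF t]
  have e2: "(\<lambda>p. of_real (\<rho> ^ p) * harm_sum (-1) 1 p (expansion_coeff a 2 0 \<tau> p) \<theta> \<phi>) sums F 2 \<tau> \<rho> \<theta> \<phi>"
    if "0 < \<rho>" "\<rho> < \<rho>0" "0 < \<theta>" "\<theta> < pi" for \<rho> \<theta> \<phi>
    using expansion_sums[OF ex, of 2 \<tau> \<rho> \<theta> \<phi>] that t by simp
  let ?e = "\<lambda>n i p l m. expansion_coeff a n i \<tau> p l m"
  have fp: "(fact p :: complex) \<noteq> 0" by simp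
  let ?c1 = "\<lambda>p l m. ?e 1 1 p l m + 1/2 * (mode_freq l * ?e 2 0 p l m + - mode_freq l * ?e 0 0 p l m)"
  have "?c1 p l m = 0"
  proof (rule mode_coeff_eq_0[OF r0, of 0 0 l p m ?c1])
    fix \<rho> \<theta> \<phi> :: real assume h: "0 < \<rho>" "\<rho> < \<rho>0" "0 < \<theta>" "\<theta> < pi"
    have "(\<lambda>p. of_real (\<rho> ^ p) * harm_sum 0 0 p (?e 1 1 p) \<theta> \<phi>
        + 1/2 * (of_real (\<rho> ^ p) * harm_sum 0 0 p (\<lambda>l m. mode_freq l * ?e 2 0 p l m) \<theta> \<phi>
        + of_real (\<rho> ^ p) * harm_sum 0 0 p (\<lambda>l m. - mode_freq l * ?e 0 0 p l m) \<theta> \<phi>))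
       sums (d_tau (F 1) \<tau> \<rho> \<theta> \<phi> + 1/2 * (eth (-1) (F 2 \<tau> \<rho>) \<theta> \<phi> + ethbar 1 (F 0 \<tau> \<rho>) \<theta> \<phi>))"
      using dt1[OF h] ex2[OF h] ex0[OF h] h
      by (intro sums_add sums_mult) (simp_all add: harm_sum_op_eth_minus1[simplified] harm_sum_op_ethbar_1[simplified])
    also have "d_tau (F 1) \<tau> \<rho> \<theta> \<phi> + 1/2 * (eth (-1) (F 2 \<tau> \<rho>) \<theta> \<phi> + ethbar 1 (F 0 \<tau> \<rho>) \<theta> \<phi>) = 0"
      using mx h t unfolding maxwell_equations_def by blast
    finally show "(\<lambda>p. of_real (\<rho> ^ p) * harm_sum 0 0 p (?c1 p) \<theta> \<phi>) sums 0"
      unfolding harm_sum_add[symmetric] harm_sum_cmult by (simp only: distrib_left mult.left_commute)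
  qed (use l in auto)
  then have "(x' 1 + 1/2 * (mode_freq l * x 2 - mode_freq l * x 0)) / fact p = 0"
    unfolding x_def x'_def expansion_coeff_def nth_deriv_def by (simp add: add_divide_distrib diff_divide_distrib mult.commute[of "fact p :: complex" 2])
  then show "x' 1 + 1/2 * (mode_freq l * x 2 - mode_freq l * x 0) = 0" using fp by simp
  let ?c2 = "\<lambda>p l m. (1 - of_real \<tau>) * ?e 2 1 p l m + of_nat p * ?e 2 0 p l m + - mode_freq l * ?e 1 0 p l m + (-1) * ?e 2 0 p l m"
  have "?c2 p l m = 0"
  proof (rule mode_coeff_eq_0[OF r0, of "-1" 1 l p m ?c2])
    fix \<rho> \<theta> \<phi> :: real assume h: "0 < \<rho>" "\<rho> < \<rho>0" "0 < \<theta>" "\<theta> < pi"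
    have "(\<lambda>p. (1 - of_real \<tau>) * (of_real (\<rho> ^ p) * harm_sum (-1) 1 p (?e 2 1 p) \<theta> \<phi>)
        + of_real (\<rho> ^ p) * harm_sum (-1) 1 p (\<lambda>l m. of_nat p * ?e 2 0 p l m) \<theta> \<phi>
        + of_real (\<rho> ^ p) * harm_sum (-1) 1 p (\<lambda>l m. - mode_freq l * ?e 1 0 p l m) \<theta> \<phi>
        + (-1) * (of_real (\<rho> ^ p) * harm_sum (-1) 1 p (?e 2 0 p) \<theta> \<phi>))
       sums ((1 - of_real \<tau>) * d_tau (F 2) \<tau> \<rho> \<theta> \<phi> + of_real \<rho> * d_rho (F 2) \<tau> \<rho> \<theta> \<phi>
          + ethbar 0 (F 1 \<tau> \<rho>) \<theta> \<phi> + (-1) * F 2 \<tau> \<rho> \<theta> \<phi>)"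
      using dt2[OF h] dr2[OF h] ex1[OF h] e2[OF h] h
      by (intro sums_add sums_mult) (simp_all add: harm_sum_op_ethbar_0[simplified])
    also have "(1 - of_real \<tau>) * d_tau (F 2) \<tau> \<rho> \<theta> \<phi> + of_real \<rho> * d_rho (F 2) \<tau> \<rho> \<theta> \<phi>
          + ethbar 0 (F 1 \<tau> \<rho>) \<theta> \<phi> + (-1) * F 2 \<tau> \<rho> \<theta> \<phi> = 0"
      using mx h t unfolding maxwell_equations_def by simp
    finally show "(\<lambda>p. of_real (\<rho> ^ p) * harm_sum (-1) 1 p (?c2 p) \<theta> \<phi>) sums 0"
      unfolding harm_sum_add[symmetric] harm_sum_cmult by (simp only: distrib_left mult.left_commute)
  qed (use l in auto)
  then have "((1 - of_real \<tau>) * x' 2 + of_nat p * x 2 - mode_freq l * x 1 - x 2) / fact p = 0"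
    unfolding x_def x'_def expansion_coeff_def nth_deriv_def by (simp add: add_divide_distrib diff_divide_distrib mult.commute[of "fact p :: complex" 2])
  then show "(1 - of_real \<tau>) * x' 2 + of_nat p * x 2 - mode_freq l * x 1 - x 2 = 0" using fp by simp
  let ?c3 = "\<lambda>p l m. of_real \<tau> * ?e 1 1 p l m + (-1) * (of_nat p * ?e 1 0 p l m) + 1/2 * (mode_freq l * ?e 2 0 p l m + (-1) * (- mode_freq l * ?e 0 0 p l m))"
  have "?c3 p l m = 0"
  proof (rule mode_coeff_eq_0[OF r0, of 0 0 l p m ?c3])
    fix \<rho> \<theta> \<phi> :: real assume h: "0 < \<rho>" "\<rho> < \<rho>0" "0 < \<theta>" "\<theta> < pi"
    have "(\<lambda>p. of_real \<tau> * (of_real (\<rho> ^ p) * harm_sum 0 0 p (?e 1 1 p) \<theta> \<phi>)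
        + (-1) * (of_real (\<rho> ^ p) * harm_sum 0 0 p (\<lambda>l m. of_nat p * ?e 1 0 p l m) \<theta> \<phi>)
        + 1/2 * (of_real (\<rho> ^ p) * harm_sum 0 0 p (\<lambda>l m. mode_freq l * ?e 2 0 p l m) \<theta> \<phi>
        + (-1) * (of_real (\<rho> ^ p) * harm_sum 0 0 p (\<lambda>l m. - mode_freq l * ?e 0 0 p l m) \<theta> \<phi>)))
       sums (of_real \<tau> * d_tau (F 1) \<tau> \<rho> \<theta> \<phi> + (-1) * (of_real \<rho> * d_rho (F 1) \<tau> \<rho> \<theta> \<phi>)
          + 1/2 * (eth (-1) (F 2 \<tau> \<rho>) \<theta> \<phi> + (-1) * ethbar 1 (F 0 \<tau> \<rho>) \<theta> \<phi>))"
      by (intro sums_add sums_mult)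
       (use dt1[OF h] dr1[OF h] ex2[OF h] ex0[OF h] h in \<open>simp_all add: harm_sum_op_eth_minus1[simplified] harm_sum_op_ethbar_1[simplified]\<close>)
    also have "of_real \<tau> * d_tau (F 1) \<tau> \<rho> \<theta> \<phi> + (-1) * (of_real \<rho> * d_rho (F 1) \<tau> \<rho> \<theta> \<phi>)
          + 1/2 * (eth (-1) (F 2 \<tau> \<rho>) \<theta> \<phi> + (-1) * ethbar 1 (F 0 \<tau> \<rho>) \<theta> \<phi>) = 0"
      using mx h t unfolding maxwell_equations_def by simp
    finally show "(\<lambda>p. of_real (\<rho> ^ p) * harm_sum 0 0 p (?c3 p) \<theta> \<phi>) sums 0"
      unfolding harm_sum_add[symmetric] harm_sum_cmult by (simp only: distrib_left mult.left_commute)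
  qed (use l in auto)
  then have "(of_real \<tau> * x' 1 - of_nat p * x 1 + 1/2 * (mode_freq l * x 2 + mode_freq l * x 0)) / fact p = 0"
    unfolding x_def x'_def expansion_coeff_def nth_deriv_def by (simp add: add_divide_distrib diff_divide_distrib mult.commute[of "fact p :: complex" 2])
  then show "of_real \<tau> * x' 1 - of_nat p * x 1 + 1/2 * (mode_freq l * x 2 + mode_freq l * x 0) = 0" using fp by simp
qed

text \<open>Evolution and constraint together express \<open>a 1\<close> algebraically through
  \<open>a 0\<close> and \<open>a 2\<close>. Substituting this into the equation for
  \<open>a 2\<close> gives one line of the system; differentiating it and comparing with the
  evolution of \<open>a 1\<close> gives the other.\<close>

lemma maxwell_mode_system:
  assumes l: "1 \<le> l" "l \<le> p" "\<bar>m\<bar> \<le> int l"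
  shows "mode_system p l (a 0 p l m) (a 2 p l m)"
  unfolding mode_system_def
proof safe
  fix t :: real assume t: "-1 < t" "t < 1"
  define x where "x = (\<lambda>n t. a n p l m t)"
  define x' where "x' = (\<lambda>n t. nth_deriv 1 (a n p l m) t)"
  have d: "(x n has_vector_derivative x' n s) (at s)" if "n \<le> 2" "-1 < s" "s < 1" for n s
  proof -
    have "nat \<bar>spin_weight n\<bar> \<le> l" using l that unfolding spin_weight_def by auto
    from nth_deriv_has_vector_derivative[OF has_expansionD(1)[OF ex that(1) this l(2,3), of 0] that(2,3)]
    show ?thesis unfolding x_def x'_def by (simp add: nth_deriv_def)
  qed
  define P :: complex where "P = of_nat p"
  have P: "P \<noteq> 0" unfolding P_def using l by simp
  define c where "c = mode_freq l"
  have "c * c = of_real (sqrt (real l * (real l + 1)) * sqrt (real l * (real l + 1)))"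
    unfolding c_def of_real_mult ..
  then have c2: "c * c = of_real (real l * (real l + 1))" by (simp add: real_sqrt_mult_self)
  have c: "c \<noteq> 0" unfolding c_def using l by simp
  have E: "x' 1 s + 1/2 * (c * x 2 s - c * x 0 s) = 0"
    "(1 - of_real s) * x' 2 s + P * x 2 s - c * x 1 s - x 2 s = 0"
    "of_real s * x' 1 s - P * x 1 s + 1/2 * (c * x 2 s + c * x 0 s) = 0" if "-1 < s" "s < 1" for s
    using maxwell_mode_equations[OF that l] unfolding x_def x'_def P_def c_def by blast+
  have rel: "x 1 s = c / (2 * P) * ((1 + of_real s) * x 0 s + (1 - of_real s) * x 2 s)" if "-1 < s" "s < 1" for s
  proof -
    have x1: "x' 1 s = c / 2 * (x 0 s - x 2 s)" using E(1)[OF that] by (simp add: field_simps eq_neg_iff_add_eq_0)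
    have "P * x 1 s = of_real s * x' 1 s + c / 2 * (x 2 s + x 0 s)" using E(3)[OF that] by (simp add: field_simps)
    also have "\<dots> = c / 2 * ((1 + of_real s) * x 0 s + (1 - of_real s) * x 2 s)" unfolding x1 by (simp add: field_simps)
    finally show ?thesis using P by (simp add: field_simps)
  qed
  have "((\<lambda>s. c / (2 * P) * ((1 + of_real s) * x 0 s + (1 - of_real s) * x 2 s)) has_vector_derivative
      c / (2 * P) * (((1 + of_real t) * x' 0 t + of_real 1 * x 0 t) + ((1 - of_real t) * x' 2 t + of_real (- 1) * x 2 t))) (at t)"
    by (intro has_vector_derivative_mult_right has_vector_derivative_add has_vector_derivative_mult d t)
      (auto intro!: derivative_eq_intros)
  then have "(x 1 has_vector_derivative
      c / (2 * P) * (((1 + of_real t) * x' 0 t + of_real 1 * x 0 t) + ((1 - of_real t) * x' 2 t + of_real (- 1) * x 2 t))) (at t)"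
    by (rule has_vector_derivative_transform_within_open[of _ _ _ "{-1<..<1}"]) (use t rel in auto)
  \<comment> \<open>The relation \<open>rel\<close> holds on the whole open interval, so its two
    sides have the same derivative. As c is nonzero for l >= 1, it can be cancelled against the
    evolution equation of \<open>a 1\<close>.\<close>
  then have x1': "x' 1 t = c / (2 * P) * ((1 + of_real t) * x' 0 t + x 0 t + (1 - of_real t) * x' 2 t - x 2 t)"
    using vector_derivative_unique_at[OF d[of 1, OF _ t]] by fastforce
  have x1: "x' 1 t = c / 2 * (x 0 t - x 2 t)" using E(1)[OF t] by (simp add: field_simps eq_neg_iff_add_eq_0)
  have G: "(1 - of_real t) * x' 2 t = - (P - 1) * x 2 t + c * x 1 t"
    using E(2)[OF t] by (simp add: algebra_simps)
  have "c / 2 * (P * (x 0 t - x 2 t)) = c / 2 * ((1 + of_real t) * x' 0 t + x 0 t + (1 - of_real t) * x' 2 t - x 2 t)"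
    using x1' P unfolding x1 by (simp add: field_simps)
  then have "P * (x 0 t - x 2 t) = (1 + of_real t) * x' 0 t + x 0 t + (1 - of_real t) * x' 2 t - x 2 t"
    using c by (simp only: mult_cancel_left) simp
  then have H: "(1 + of_real t) * x' 0 t = (P - 1) * x 0 t - c * x 1 t"
    unfolding G by (simp add: algebra_simps)
  have cx: "c * x 1 t = of_real (mode_coupling p l) * ((1 + of_real t) * x 0 t + (1 - of_real t) * x 2 t)"
  proof -
    have "c * x 1 t = c * c / (2 * P) * ((1 + of_real t) * x 0 t + (1 - of_real t) * x 2 t)"
      unfolding rel[OF t] by simp
    then show ?thesis unfolding c2 P_def by simp
  qed
  show "\<exists>f' g'. mode_system_at p l (a 0 p l m) (a 2 p l m) t f' g'"
    using d[of 0 t] d[of 2 t] t G[unfolded cx] H[unfolded cx]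
    by (intro exI[of _ "x' 0 t"] exI[of _ "x' 2 t"])
      (simp add: scaleR_conv_of_real x_def P_def)
qed

end

section \<open>Taylor coefficients along the null curve\<close>

text \<open>Successive derivatives are carried as explicit formulas, which keeps closed forms
  available for estimates. The set may be a segment as well as an open set, since the derivatives
  are full complex derivatives at each of its points.\<close>

definition deriv_chain :: "complex set \<Rightarrow> (nat \<Rightarrow> complex \<Rightarrow> complex) \<Rightarrow> bool" where
  "deriv_chain U f \<longleftrightarrow> (\<forall>i. \<forall>z\<in>U. (f i has_field_derivative f (Suc i) z) (at z))"

lemma deriv_chainD: "deriv_chain U f \<Longrightarrow> z \<in> U \<Longrightarrow> (f i has_field_derivative f (Suc i) z) (at z)"
  unfolding deriv_chain_def by blast

text \<open>It allows the derivatives of a function to be evaluated from whichever factorisation is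
  convenient.\<close>

lemma deriv_chain_unique:
  assumes "open U" "deriv_chain U f" "deriv_chain U g" "\<And>z. z \<in> U \<Longrightarrow> f 0 z = g 0 z" "z \<in> U"
  shows "f i z = g i z"
  using assms(5)
proof (induction i arbitrary: z)
  case (Suc i)
  have "(g i has_field_derivative f (Suc i) z) (at z)"
    by (rule has_field_derivative_transform_within_open[OF deriv_chainD[OF assms(2) Suc.prems] assms(1) Suc.prems])
      (rule Suc.IH)
  then show ?case using deriv_chainD[OF assms(3) Suc.prems] DERIV_unique by blast
qed (use assms in auto)

lemma deriv_chain_add: "deriv_chain U f \<Longrightarrow> deriv_chain U g \<Longrightarrow> deriv_chain U (\<lambda>i z. f i z + g i z)"
  unfolding deriv_chain_def by (blast intro: DERIV_add)

lemma deriv_chain_cmult: "deriv_chain U f \<Longrightarrow> deriv_chain U (\<lambda>i z. c * f i z)"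
  unfolding deriv_chain_def by (blast intro: DERIV_cmult)

lemma deriv_chain_mult:
  assumes "deriv_chain U f" "deriv_chain U g"
  shows "deriv_chain U (\<lambda>i z. \<Sum>j\<le>i. of_nat (i choose j) * (f j z * g (i - j) z))"
  unfolding deriv_chain_def
proof (intro allI ballI)
  fix i z assume z: "z \<in> U"
  note f = deriv_chainD[OF assms(1) z] and g = deriv_chainD[OF assms(2) z]
  have "((\<lambda>z. \<Sum>j\<le>i. of_nat (i choose j) * (f j z * g (i - j) z)) has_field_derivative
    (\<Sum>j\<le>i. of_nat (i choose j) * (f (Suc j) z * g (i - j) z + g (Suc (i - j)) z * f j z))) (at z)"
    by (intro DERIV_sum DERIV_cmult DERIV_mult f g)
  moreover have "(\<Sum>j\<le>i. of_nat (i choose j) * (f (Suc j) z * g (i - j) z + g (Suc (i - j)) z * f j z))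
    = (\<Sum>j\<le>Suc i. of_nat (Suc i choose j) * (f j z * g (Suc i - j) z))"
  proof -
    have "(\<Sum>j\<le>Suc i. of_nat (i choose j) * (f j z * g (Suc i - j) z))
       = (\<Sum>j\<le>i. of_nat (i choose j) * (g (Suc (i - j)) z * f j z))"
      by (simp add: Suc_diff_le mult.commute[of "g _ _"])
    moreover have "(\<Sum>j\<le>Suc i. of_nat (i choose j) * (f j z * g (Suc i - j) z))
       = f 0 z * g (Suc i) z + (\<Sum>j\<le>i. of_nat (i choose Suc j) * (f (Suc j) z * g (i - j) z))"
      by (subst sum.atMost_Suc_shift) simp
    moreover have "(\<Sum>j\<le>Suc i. of_nat (Suc i choose j) * (f j z * g (Suc i - j) z))
       = f 0 z * g (Suc i) z + (\<Sum>j\<le>i. of_nat (Suc i choose Suc j) * (f (Suc j) z * g (i - j) z))"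
      by (subst sum.atMost_Suc_shift) simp
    ultimately show ?thesis by (simp add: distrib_left distrib_right sum.distrib)
  qed
  ultimately show "((\<lambda>z. \<Sum>j\<le>i. of_nat (i choose j) * (f j z * g (i - j) z)) has_field_derivative
      (\<Sum>j\<le>Suc i. of_nat (Suc i choose j) * (f j z * g (Suc i - j) z))) (at z)" by simp
qed

lemma deriv_chain_poly: "deriv_chain U (\<lambda>j z. poly ((pderiv ^^ j) A) z)"
  unfolding deriv_chain_def by (auto intro: poly_DERIV)

lemma deriv_chain_poly_reflect: "deriv_chain U (\<lambda>j z. (-1) ^ j * poly ((pderiv ^^ j) A) (1 - z))"
  unfolding deriv_chain_def
proof (intro allI ballI)
  fix i z
  have "((\<lambda>z. poly ((pderiv ^^ i) A) (1 - z)) has_field_derivative poly (pderiv ((pderiv ^^ i) A)) (1 - z) * (-1)) (at z)"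
    by (rule DERIV_chain2[OF poly_DERIV]) (auto intro!: derivative_eq_intros)
  from DERIV_cmult[OF this, of "(-1) ^ i"]
  show "((\<lambda>z. (-1) ^ i * poly ((pderiv ^^ i) A) (1 - z)) has_field_derivative (-1) ^ Suc i * poly ((pderiv ^^ Suc i) A) (1 - z)) (at z)"
    by simp
qed

lemma deriv_chain_inverse_power:
  assumes "2 \<notin> U"
  shows "deriv_chain U (\<lambda>k z. pochhammer (of_nat p) k * inverse ((2 - z) ^ (p + k)))"
  unfolding deriv_chain_def
proof (intro allI ballI)
  fix k z assume "z \<in> U"
  then have z: "2 - z \<noteq> 0" using assms by auto
  have "((\<lambda>z. inverse ((2 - z) ^ (p + k))) has_field_derivative of_nat (p + k) * inverse ((2 - z) ^ Suc (p + k))) (at z)"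
  proof (cases "p + k")
    case (Suc q)
    have "((\<lambda>z. inverse ((2 - z) ^ Suc q)) has_field_derivative of_nat (Suc q) * inverse ((2 - z) ^ Suc (Suc q))) (at z)"
    proof -
      have "((\<lambda>z. 2 - z) has_field_derivative -1) (at z)" by (auto intro!: derivative_eq_intros)
      note D = DERIV_inverse_fun[OF DERIV_power[OF this, of "Suc q"]]
      have eq: "- (of_nat (Suc q) * (- 1 * u ^ (Suc q - Suc 0)) * inverse ((u ^ Suc q) ^ Suc (Suc 0)))
          = of_nat (Suc q) * inverse (u ^ Suc (Suc q))" if "u \<noteq> 0" for u :: complex
        using that by (simp add: field_simps)
      show ?thesis by (rule DERIV_cong[OF D], use z in simp) (rule eq[OF z])
    qed
    then show ?thesis unfolding Suc .
  qed simp
  from DERIV_cmult[OF this, of "pochhammer (of_nat p) k"]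
  show "((\<lambda>z. pochhammer (of_nat p) k * inverse ((2 - z) ^ (p + k))) has_field_derivative
      pochhammer (of_nat p) (Suc k) * inverse ((2 - z) ^ (p + Suc k))) (at z)"
    by (simp only: pochhammer_Suc of_nat_add mult.assoc add_Suc_right)
qed

lemma higher_pderiv_eq_0: "degree (A :: complex poly) < n \<Longrightarrow> (pderiv ^^ n) A = 0"
  by (rule poly_eqI) (simp add: coeff_higher_pderiv coeff_eq_0)

lemma poly_higher_pderiv_monom_0:
  "poly ((pderiv ^^ j) (monom 1 q :: complex poly)) 0 = (if j = q then fact q else 0)"
  unfolding poly_0_coeff_0 coeff_higher_pderiv by (auto simp: pochhammer_fact)

text \<open>Repeated differentiation of the geometric series. The Pochhammer factor is the one
  produced by the derivatives of (2 - z)^(-p-1).\<close>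

lemma summable_pochhammer_geometric:
  fixes q :: real
  assumes "\<bar>q\<bar> < 1"
  shows "summable (\<lambda>p. pochhammer (real p + 1) k * q ^ p)"
  using assms
proof (induction k arbitrary: q)
  case 0
  then show ?case by (simp add: summable_geometric)
next
  case (Suc k)
  have "summable (\<lambda>p. diffs (\<lambda>p. pochhammer (real p + 1) k) p * q ^ p)"
    by (rule termdiff_converges[of q 1]) (use Suc in auto)
  moreover have "diffs (\<lambda>p. pochhammer (real p + 1) k) p = pochhammer (real p + 1) (Suc k)" for p
    by (simp add: diffs_def pochhammer_rec add_ac)
  ultimately show ?case by simp
qed

text \<open>Taylor's theorem is applied to each term separately with remainder controlled by
  \<open>M (Suc N) p\<close>. Summability of these majorants in p permits summing the expansions,
  and the final bound is uniform in x.\<close>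

lemma taylor_series_sum:
  fixes h :: "nat \<Rightarrow> nat \<Rightarrow> complex \<Rightarrow> complex" and M :: "nat \<Rightarrow> nat \<Rightarrow> real"
  assumes d: "\<And>p. deriv_chain (closed_segment 0 (of_real \<delta>)) (h p)"
    and b: "\<And>p i x. 0 \<le> x \<Longrightarrow> x \<le> \<delta> \<Longrightarrow> norm (h p i (of_real x)) \<le> M i p"
    and s: "\<And>i. summable (M i)" and x: "0 \<le> x" "x \<le> \<delta>"
  shows "norm ((\<Sum>p. h p 0 (of_real x)) - (\<Sum>i\<le>N. (\<Sum>p. h p i 0) / fact i * of_real (x ^ i)))
     \<le> (\<Sum>p. M (Suc N) p) * (x ^ Suc N / fact N)"
proof -
  let ?S = "closed_segment 0 (complex_of_real \<delta>)"
  have seg: "\<exists>y. z = of_real y \<and> 0 \<le> y \<and> y \<le> \<delta>" if zS: "z \<in> ?S" for z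
  proof -
    obtain u where u: "0 \<le> u" "u \<le> 1" "z = u *\<^sub>R complex_of_real \<delta>"
      using zS by (auto simp: in_segment)
    have "\<delta> \<ge> 0" using x by simp
    then show ?thesis using u by (intro exI[of _ "u * \<delta>"]) (auto simp: scaleR_conv_of_real mult_left_le_one_le)
  qed
  have x_in: "of_real x \<in> ?S" and zero_in: "0 \<in> ?S"
    using x by (cases "\<delta> = 0") (auto simp: divide_le_eq_1 in_segment scaleR_conv_of_real intro!: exI[of _ "x / \<delta>"])
  have sh: "summable (\<lambda>p. h p i (of_real y))" if "0 \<le> y" "y \<le> \<delta>" for i y
    by (rule summable_comparison_test[OF _ s[of i]]) (use b that in auto)
  have t: "norm (h p 0 (of_real x) - (\<Sum>i\<le>N. h p i 0 * of_real x ^ i / fact i)) \<le> M (Suc N) p * (x ^ Suc N / fact N)" for p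
  proof -
    have "norm (h p 0 (of_real x) - (\<Sum>i\<le>N. h p i 0 * (of_real x - 0) ^ i / fact i)) \<le> M (Suc N) p * norm (of_real x - (0::complex)) ^ Suc N / fact N"
    proof (rule complex_Taylor[of ?S N "h p"])
      show "(h p i has_field_derivative h p (Suc i) z) (at z within ?S)" if "z \<in> ?S" for i z
        using deriv_chainD[OF d that] by (rule has_field_derivative_at_within)
      show "norm (h p (Suc N) z) \<le> M (Suc N) p" if "z \<in> ?S" for z
        using seg[OF that] b by auto
    qed (use x_in zero_in in auto)
    then show ?thesis using x by simp
  qed
  have s0: "summable (\<lambda>p. h p i 0)" for i using sh[of 0 i] x by simp
  have sR: "summable (\<lambda>p. \<Sum>i\<le>N. h p i 0 * of_real x ^ i / fact i)"
    by (intro summable_sum summable_divide summable_mult2 s0)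
  have "(\<Sum>p. h p 0 (of_real x)) - (\<Sum>i\<le>N. (\<Sum>p. h p i 0) / fact i * of_real (x ^ i))
     = (\<Sum>p. h p 0 (of_real x) - (\<Sum>i\<le>N. h p i 0 * of_real x ^ i / fact i))"
  proof -
    have "(\<Sum>i\<le>N. (\<Sum>p. h p i 0) / fact i * of_real (x ^ i)) = (\<Sum>i\<le>N. \<Sum>p. h p i 0 * of_real x ^ i / fact i)"
      using s0 by (intro sum.cong refl) (simp add: suminf_divide suminf_mult summable_mult summable_mult2 mult.commute)
    also have "\<dots> = (\<Sum>p. \<Sum>i\<le>N. h p i 0 * of_real x ^ i / fact i)"
      by (intro suminf_sum[symmetric] summable_divide summable_mult2 s0)
    finally show ?thesis using suminf_diff[OF sh[OF x] sR] by simp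
  qed
  also have "norm \<dots> \<le> (\<Sum>p. M (Suc N) p * (x ^ Suc N / fact N))"
    by (rule norm_suminf_le[OF t]) (intro summable_mult2 s)
  also have "\<dots> = (\<Sum>p. M (Suc N) p) * (x ^ Suc N / fact N)"
    by (rule suminf_mult2[OF s, symmetric])
  finally show ?thesis .
qed

text \<open>At the least index where two expansions differ, a power of r would be negligible
  compared with itself. This makes the description in \<open>phi0_phys_coeff\<close> denote
  something.\<close>

lemma asymptotic_expansion_unique:
  assumes "is_asymptotic_expansion f c" "is_asymptotic_expansion f d"
  shows "c = d"
proof (rule ccontr)
  assume "c \<noteq> d"
  then have "\<exists>k. c k \<noteq> d k" by auto
  define k where "k = (LEAST k. c k \<noteq> d k)"
  have k: "c k \<noteq> d k" unfolding k_def using \<open>\<exists>k. c k \<noteq> d k\<close> by (rule LeastI_ex)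
  have lt: "c j = d j" if "j < k" for j using that not_less_Least unfolding k_def by blast
  define g where "g = (\<lambda>r. complex_of_real (r powi (- 3 - int k)))"
  have "(\<lambda>r. (f r - (\<Sum>j\<le>k. d j * complex_of_real (r powi (-3 - int j))))
       - (f r - (\<Sum>j\<le>k. c j * complex_of_real (r powi (-3 - int j))))) \<in> o[at_top](g)"
    unfolding g_def
    by (rule sum_in_smallo(2)[OF assms(2)[unfolded is_asymptotic_expansion_def, rule_format, of k]
        assms(1)[unfolded is_asymptotic_expansion_def, rule_format, of k]])
  moreover have "(f r - (\<Sum>j\<le>k. d j * complex_of_real (r powi (-3 - int j))))
       - (f r - (\<Sum>j\<le>k. c j * complex_of_real (r powi (-3 - int j)))) = (c k - d k) * g r" for r
  proof -
    have "(\<Sum>j\<le>k. c j * complex_of_real (r powi (-3 - int j))) - (\<Sum>j\<le>k. d j * complex_of_real (r powi (-3 - int j)))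
      = (\<Sum>j\<le>k. if j = k then (c k - d k) * g r else 0)"
      unfolding sum_subtractf[symmetric] g_def
      by (intro sum.cong refl) (auto simp: left_diff_distrib lt)
    then show ?thesis by simp
  qed
  ultimately have "(\<lambda>r. (c k - d k) * g r) \<in> o[at_top](g)" by simp
  then have "g \<in> o[at_top](g)" using k by simp
  then have "\<forall>\<^sub>F r in at_top. g r = 0" by (simp add: landau_o.small_refl_iff)
  moreover have "\<forall>\<^sub>F r :: real in at_top. r > 0" by (rule eventually_gt_at_top)
  ultimately have "\<forall>\<^sub>F r :: real in at_top. False"
    by eventually_elim (simp add: g_def)
  then show False by simp
qed

section \<open>Modes as polynomials and their Taylor coefficients at future null infinity\<close>

definition jacobi_poly :: "nat \<Rightarrow> real \<Rightarrow> real \<Rightarrow> complex poly" where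
  "jacobi_poly k \<alpha> \<beta> = (\<Sum>s = 0..k. smult (of_real (((real k + \<alpha>) gchoose (k - s)) * ((real k + \<beta>) gchoose s)))
     ([:-1/2, 1/2:] ^ s * [:1/2, 1/2:] ^ (k - s)))"

lemma poly_jacobi_poly: "poly (jacobi_poly k \<alpha> \<beta>) (of_real x) = of_real (jacobi k \<alpha> \<beta> x)"
proof -
  have "poly [:-1/2, 1/2:] (complex_of_real x) = of_real ((x - 1) / 2)"
    "poly [:1/2, 1/2:] (complex_of_real x) = of_real ((x + 1) / 2)"
    by (simp_all add: field_simps)
  then show ?thesis unfolding jacobi_poly_def jacobi_def
    by (simp only: poly_sum poly_smult poly_mult poly_power of_real_sum of_real_mult of_real_power mult.assoc)
qed

lemma degree_jacobi_poly: "degree (jacobi_poly k \<alpha> \<beta>) \<le> k"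
  unfolding jacobi_poly_def
proof (intro degree_sum_le)
  fix s assume s: "s \<in> {0..k}"
  have "degree ([:-1/2, 1/2:] ^ s * [:1/2, 1/2::complex:] ^ (k - s)) \<le> s + (k - s)"
    by (intro order.trans[OF degree_mult_le] add_mono order.trans[OF degree_power_le]) auto
  then show "degree (smult (of_real (((real k + \<alpha>) gchoose (k - s)) * ((real k + \<beta>) gchoose s)))
     ([:-1/2, 1/2:] ^ s * [:1/2, 1/2:] ^ (k - s)) :: complex poly) \<le> k"
    using s by (intro order.trans[OF degree_smult_le]) auto
qed simp

text \<open>
  On the curve \<open>\<rho> (1 + \<tau>) = const\<close> followed at fixed retarded time, the factor \<open>\<rho>\<^sup>p / (1 + \<tau>)\<close>
  cancels \<open>(1 + \<tau>)\<^sup>p\<^sup>+\<^sup>1\<close>: the \<open>B\<close> part becomes a polynomial of degree less than \<open>l\<close>, while the \<open>W\<close> part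
  vanishes to order \<open>p - 1\<close> at \<open>\<tau> = 1\<close>.
\<close>

lemma mode_decomposition:
  assumes ms: "mode_system p l (a 0 p l m) (a 2 p l m)"
    and top: "top_mode_constants a E Es J Js" and reg: "\<And>p m. 1 \<le> p \<Longrightarrow> \<bar>m\<bar> \<le> int p \<Longrightarrow> Es p m = 0 \<and> Js p m = 0"
    and l: "1 \<le> l" "l \<le> p" "\<bar>m\<bar> \<le> int l"
  obtains B W :: "complex poly" where
    "\<And>t. -1 < t \<Longrightarrow> t < 1 \<Longrightarrow> a 2 p l m t = poly ([:1/2, 1/2:] ^ (p + 1) * B + [:1/2, -1/2:] ^ (p - 1) * W) (of_real t)"
    "degree B < l" "l = p \<Longrightarrow> W = 0"
    "l < p \<Longrightarrow> poly W 1 = C_const a p l m * of_real ((real l + real p) gchoose (l + 1))"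
proof (cases "l = p")
  case True
  \<comment> \<open>In a regular mode the power of 1 - \<tau> is put into \<open>B\<close>, whose
    degree p - 1 is still below l = p; this leaves W = 0.\<close>
  have "a 2 p l m t = poly ([:1/2, 1/2:] ^ (p + 1) * smult (J p m) ([:1/2, -1/2:] ^ (p - 1)) + [:1/2, -1/2:] ^ (p - 1) * 0) (of_real t)"
    if "-1 < t" "t < 1" for t
  proof -
    have "a 2 p l m t = complex_of_real (((1 + t) / 2) ^ (p + 1) * ((1 - t) / 2) ^ (p - 1)) * J p m"
      using top reg[of p m] l that True unfolding top_mode_constants_def by auto
    moreover have "poly [:1/2, 1/2:] (complex_of_real t) = of_real ((1 + t) / 2)"
      "poly [:1/2, -1/2:] (complex_of_real t) = of_real ((1 - t) / 2)" by (simp_all add: field_simps)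
    ultimately show ?thesis
      by (simp only: poly_add poly_mult poly_smult poly_power of_real_mult of_real_power mult_zero_left mult_zero_right add_0_right poly_0 mult_ac)
  qed
  moreover have "degree (smult (J p m) ([:1/2, -1/2:] ^ (p - 1))) < l"
  proof -
    have "degree (smult (J p m) ([:1/2, -1/2:] ^ (p - 1))) \<le> 1 * (p - 1)"
      by (intro order.trans[OF degree_smult_le] order.trans[OF degree_power_le]) auto
    then show ?thesis using l True by linarith
  qed
  ultimately show ?thesis using that True by blast
next
  case False
  then have lp: "l < p" using l by simp
  \<comment> \<open>\<open>B\<close> comes from \<open>Q1\<close> at -t, and
    \<open>jacobi_minus\<close> accounts for its sign. In \<open>W\<close> the sign of the matrix
    entry cancels by \<open>Q3_minus\<close>; the value of \<open>W\<close> at 1 is a Jacobi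
    polynomial at its right end, hence a binomial coefficient.\<close>
  define B where "B = smult (CD_vec a p l m $ 2 * (-1) ^ (l - 1)) (jacobi_poly (l - 1) (- real p + 1) (real p + 1))"
  define W where "W = smult (CD_vec a p l m $ 1) (jacobi_poly (l + 1) (real p - 1) (- real p - 1))"
  have "a 2 p l m t = poly ([:1/2, 1/2:] ^ (p + 1) * B + [:1/2, -1/2:] ^ (p - 1) * W) (of_real t)"
    if t: "-1 < t" "t < 1" for t
  proof -
    have h: "poly [:1/2, 1/2:] (complex_of_real t) = of_real ((1 + t) / 2)"
      "poly [:1/2, -1/2:] (complex_of_real t) = of_real ((1 - t) / 2)" by (simp_all add: field_simps)
    have Q1m: "Q1 p l (- t) = ((1 + t) / 2) ^ (p + 1) * ((-1) ^ (l - 1) * jacobi (l - 1) (- real p + 1) (real p + 1) t)"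
      unfolding Q1_def jacobi_minus by simp
    show ?thesis
      unfolding mode_system_solution[OF ms l(1) lp t] Q3_minus Q1m CD_vec_def[symmetric] B_def W_def
        poly_add poly_mult poly_smult poly_power h poly_jacobi_poly
      by (simp only: of_real_mult of_real_power of_real_minus of_real_1) (simp only: mult_ac add.commute)
  qed
  moreover have "degree B < l" unfolding B_def
    using degree_jacobi_poly[of "l - 1" "- real p + 1" "real p + 1"] l(1)
    by (intro le_less_trans[OF degree_smult_le]) linarith
  moreover have "poly W 1 = C_const a p l m * of_real ((real l + real p) gchoose (l + 1))"
    using poly_jacobi_poly[of "l + 1" "real p - 1" "- real p - 1" 1]
    unfolding W_def C_const_def jacobi_at_1 by (simp add: add.commute)
  ultimately show ?thesis using that lp by blast
qed

text \<open>The k-th derivative of (2 - z)^(-p-1). With z = 1 - \<tau> the base is 1 +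
  \<tau>.\<close>

definition inv_chain :: "nat \<Rightarrow> nat \<Rightarrow> complex \<Rightarrow> complex" where
  "inv_chain p k z = pochhammer (of_nat (p + 1)) k * inverse ((2 - z) ^ (p + 1 + k))"

text \<open>The i-th derivative, by Leibniz' rule, of A(1 - z) / (2 - z)^(p+1), which is how a mode
  depends on x = z along the null curve up to a constant.\<close>

definition curve_chain :: "complex poly \<Rightarrow> nat \<Rightarrow> nat \<Rightarrow> complex \<Rightarrow> complex" where
  "curve_chain A p i z = (\<Sum>j\<le>i. of_nat (i choose j) * ((-1) ^ j * poly ((pderiv ^^ j) A) (1 - z) * inv_chain p (i - j) z))"

lemma deriv_chain_inv: "2 \<notin> U \<Longrightarrow> deriv_chain U (inv_chain p)"
  using deriv_chain_inverse_power[of U "p + 1"] unfolding inv_chain_def[abs_def] by simp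

lemma deriv_chain_curve: "2 \<notin> U \<Longrightarrow> deriv_chain U (curve_chain A p)"
  using deriv_chain_mult[OF deriv_chain_poly_reflect deriv_chain_inv] unfolding curve_chain_def[abs_def] by simp

lemma curve_chain_at_0:
  assumes p: "1 \<le> p" and B: "degree B < n" and n: "n \<le> p" "n = p \<Longrightarrow> W = 0"
  shows "curve_chain ([:1/2, 1/2:] ^ (p + 1) * B + [:1/2, -1/2:] ^ (p - 1) * W) p n 0
     = (if p = n + 1 then fact n * poly W 1 / 4 ^ p else 0)"
proof -
  define A where "A = [:1/2, 1/2:] ^ (p + 1) * B + [:1/2, -1/2:] ^ (p - 1) * W"
  define U where "U = ball (0::complex) 1"
  have U: "open U" "2 \<notin> U" "0 \<in> U" unfolding U_def by auto
  define g1 where "g1 = (\<lambda>j z. (-1) ^ j * poly ((pderiv ^^ j) B) (1 - z))"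
  define g2 where "g2 = (\<lambda>i z. \<Sum>j\<le>i. of_nat (i choose j) * (poly ((pderiv ^^ j) (monom 1 (p - 1))) z * curve_chain W p (i - j) z))"
  have g: "deriv_chain U (\<lambda>i z. 1 / 2 ^ (p + 1) * g1 i z + 1 / 2 ^ (p - 1) * g2 i z)"
    unfolding g1_def g2_def
    by (intro deriv_chain_add deriv_chain_cmult deriv_chain_poly_reflect deriv_chain_mult deriv_chain_poly deriv_chain_curve U)
  have c: "curve_chain A p n 0 = 1 / 2 ^ (p + 1) * g1 n 0 + 1 / 2 ^ (p - 1) * g2 n 0"
  proof (rule deriv_chain_unique[OF U(1) deriv_chain_curve[OF U(2)] g _ U(3)])
    fix z assume "z \<in> U"
    then have z: "2 - z \<noteq> 0" using U(2) by auto
    define v where "v = 2 - z"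
    have v: "v \<noteq> 0" using z unfolding v_def .
    have "poly [:1/2, 1/2:] (1 - z) = v / 2" "poly [:1/2, -1/2:] (1 - z) = z / 2"
      unfolding v_def by (simp_all add: field_simps)
    then have "poly A (1 - z) = (v / 2) ^ (p + 1) * poly B (1 - z) + (z / 2) ^ (p - 1) * poly W (1 - z)"
      unfolding A_def by (simp only: poly_add poly_mult poly_power)
    then have "poly A (1 - z) * inverse (v ^ (p + 1)) = 1 / 2 ^ (p + 1) * poly B (1 - z) + 1 / 2 ^ (p - 1) * (z ^ (p - 1) * (poly W (1 - z) * inverse (v ^ (p + 1))))"
      using v by (simp add: distrib_right power_divide field_simps)
    then show "curve_chain A p 0 z = 1 / 2 ^ (p + 1) * g1 0 z + 1 / 2 ^ (p - 1) * g2 0 z"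
      unfolding curve_chain_def g1_def g2_def inv_chain_def v_def by (simp add: poly_monom)
  qed
  have g1: "g1 n 0 = 0" unfolding g1_def higher_pderiv_eq_0[OF B] by simp
  have g2: "g2 n 0 = (if p = n + 1 then fact n * poly W 1 / 2 ^ (p + 1) else 0)"
  proof -
    have "g2 n 0 = (\<Sum>j\<le>n. if j = p - 1 then of_nat (n choose j) * (fact (p - 1) * curve_chain W p (n - j) 0) else 0)"
      unfolding g2_def by (intro sum.cong refl) (simp add: poly_higher_pderiv_monom_0)
    also have "\<dots> = (if p - 1 \<le> n then of_nat (n choose (p - 1)) * (fact (p - 1) * curve_chain W p (n - (p - 1)) 0) else 0)"
      by (simp add: sum.delta)
    \<comment> \<open>Since n <= p, the condition p - 1 <= n leaves p = n, where W = 0, and p = n +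
      1, where all n derivatives fall on the power of z.\<close>
    also have "\<dots> = (if p = n + 1 then fact n * poly W 1 / 2 ^ (p + 1) else 0)"
    proof (cases "p = n")
      case True
      then have "W = 0" using n(2) by simp
      then have "curve_chain W p i 0 = 0" for i unfolding curve_chain_def by simp
      then show ?thesis using True by simp
    next
      case False
      then show ?thesis using n(1) p by (auto simp: curve_chain_def inv_chain_def field_simps)
    qed
    finally show ?thesis .
  qed
  have e: "(2::complex) ^ (p - 1) * 2 ^ (p + 1) = 4 ^ p"
  proof -
    obtain q where q: "p = Suc q" using p by (cases p) auto
    have "(4::complex) ^ q = 2 ^ q * 2 ^ q" by (simp flip: power_mult_distrib)
    then show ?thesis unfolding q by simp
  qed
  show ?thesis unfolding A_def[symmetric] c g1 g2 e[symmetric] by simp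
qed

section \<open>Bounds uniform in the angles up to null infinity\<close>

lemma nth_deriv_poly:
  assumes "\<And>t. -1 < t \<Longrightarrow> t < 1 \<Longrightarrow> f t = poly A (of_real t)" "-1 < t" "t < 1"
  shows "nth_deriv j f t = poly ((pderiv ^^ j) A) (of_real t)"
  using assms(2,3)
proof (induction j arbitrary: t)
  case 0
  then show ?case using assms(1) by (simp add: nth_deriv_def)
next
  case (Suc j)
  have "((\<lambda>t. poly ((pderiv ^^ j) A) (complex_of_real t)) has_vector_derivative poly ((pderiv ^^ Suc j) A) (of_real t)) (at t)"
    by (rule has_vector_derivative_real_field) (simp add: poly_DERIV)
  then have "(nth_deriv j f has_vector_derivative poly ((pderiv ^^ Suc j) A) (of_real t)) (at t)"
    by (rule has_vector_derivative_transform_within_open[of _ _ _ "{-1<..<1}"]) (use Suc in auto)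
  then show ?case unfolding nth_deriv_def by (simp add: vector_derivative_at)
qed

lemma harm_sum_poly_bounded:
  fixes D :: "nat \<Rightarrow> int \<Rightarrow> complex poly"
  shows "\<exists>K. \<forall>t\<in>{-1..1}. \<forall>\<theta>\<in>{0<..<pi}. \<forall>\<phi>. norm (harm_sum (-1) i p (\<lambda>l m. poly (D l m) (of_real t)) \<theta> \<phi>) \<le> K"
proof -
  have "\<exists>b. \<forall>t\<in>{-1..1}. \<forall>\<theta>\<in>{0<..<pi}. \<forall>\<phi>. norm (poly (D l m) (of_real t) * swsh (-1) l m \<theta> \<phi>) \<le> b"
    if "\<bar>m\<bar> \<le> int l" for l m
  proof -
    obtain b where b: "\<And>\<theta> \<phi>. 0 < \<theta> \<Longrightarrow> \<theta> < pi \<Longrightarrow> norm (swsh (-1) l m \<theta> \<phi>) \<le> b"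
      using swsh_bounded[of "-1" m l] \<open>\<bar>m\<bar> \<le> int l\<close> by auto
    have "compact ((\<lambda>t. poly (D l m) (complex_of_real t)) ` {-1..1})"
      by (intro compact_continuous_image continuous_intros) simp
    then obtain d where d: "\<And>t. t \<in> {-1..1} \<Longrightarrow> norm (poly (D l m) (complex_of_real t)) \<le> d"
      using compact_imp_bounded bounded_iff by (metis imageI)
    show ?thesis
    proof (intro exI ballI allI)
      fix t \<theta> \<phi> :: real assume "t \<in> {-1..1}" "\<theta> \<in> {0<..<pi}"
      then show "norm (poly (D l m) (complex_of_real t) * swsh (-1) l m \<theta> \<phi>) \<le> d * b"
        unfolding norm_mult using b[of \<theta> \<phi>] d[of t] by (intro mult_mono) (auto intro: order_trans[OF norm_ge_zero])
    qed
  qed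
  then have "\<forall>x. \<exists>b. \<bar>snd x\<bar> \<le> int (fst x) \<longrightarrow> (\<forall>t\<in>{-1..1}. \<forall>\<theta>\<in>{0<..<pi}. \<forall>\<phi>.
      norm (poly (D (fst x) (snd x)) (of_real t) * swsh (-1) (fst x) (snd x) \<theta> \<phi>) \<le> b)"
    by blast
  from choice[OF this] obtain b0 where b0: "\<forall>x. \<bar>snd x\<bar> \<le> int (fst x) \<longrightarrow> (\<forall>t\<in>{-1..1}. \<forall>\<theta>\<in>{0<..<pi}. \<forall>\<phi>.
      norm (poly (D (fst x) (snd x)) (of_real t) * swsh (-1) (fst x) (snd x) \<theta> \<phi>) \<le> b0 x)" ..
  define b where "b = (\<lambda>l m. b0 (l, m))"
  have b: "norm (poly (D l m) (of_real t) * swsh (-1) l m \<theta> \<phi>) \<le> b l m"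
    if "\<bar>m\<bar> \<le> int l" "t \<in> {-1..1}" "\<theta> \<in> {0<..<pi}" for l m t \<theta> \<phi>
    using b0[rule_format, of "(l, m)"] that unfolding b_def by simp
  show ?thesis
  proof (intro exI ballI allI)
    fix t \<theta> \<phi> :: real assume "t \<in> {-1..1}" "\<theta> \<in> {0<..<pi}"
    then show "norm (harm_sum (-1) i p (\<lambda>l m. poly (D l m) (of_real t)) \<theta> \<phi>) \<le> (\<Sum>l = i..p. \<Sum>m = - int l..int l. b l m)"
      unfolding harm_sum_def by (intro order_trans[OF norm_sum] sum_mono b) auto
  qed
qed

text \<open>Uniformly Cauchy partial sums have uniformly bounded terms: from some \<open>P\<close>
  on, consecutive partial sums differ by less than 1. The finitely many earlier terms are bounded
  one by one by compactness.\<close>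

lemma expansion_tau_deriv_bounded:
  fixes A :: "nat \<Rightarrow> nat \<Rightarrow> int \<Rightarrow> complex poly"
  assumes ex: "has_expansion \<rho>0 F a" and r: "0 < r" "r < \<rho>0"
    and A: "\<And>p l m t. 1 \<le> l \<Longrightarrow> l \<le> p \<Longrightarrow> \<bar>m\<bar> \<le> int l \<Longrightarrow> -1 < t \<Longrightarrow> t < 1 \<Longrightarrow> a 2 p l m t = poly (A p l m) (of_real t)"
  shows "\<exists>K. \<forall>p. \<forall>t\<in>{-1..1}. \<forall>\<theta>\<in>{0<..<pi}. \<forall>\<phi>.
    norm (harm_sum (-1) 1 p (\<lambda>l m. poly ((pderiv ^^ j) (A p l m)) (of_real t)) \<theta> \<phi>) * (r ^ p / fact p) \<le> K"
proof -
  define f where "f = (\<lambda>p t \<theta> \<phi>. harm_sum (-1) 1 p (\<lambda>l m. poly ((pderiv ^^ j) (A p l m)) (of_real t)) \<theta> \<phi>)"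
  define w where "w = (\<lambda>p. r ^ p / fact p)"
  have w: "w p \<ge> 0" for p unfolding w_def using r by simp
  have td: "term_deriv a 2 p j 0 [] t r \<theta> \<phi> = of_real (w p) * f p t \<theta> \<phi>" if "-1 < t" "t < 1" for p t \<theta> \<phi>
  proof -
    have "term_deriv a 2 p j 0 [] t r \<theta> \<phi> = of_real (r ^ p) * harm_sum (-1) 1 p (\<lambda>l m. (1 / fact p) * poly ((pderiv ^^ j) (A p l m)) (of_real t)) \<theta> \<phi>"
      unfolding term_deriv_Nil
      by (simp, intro disjI2 harm_sum_cong)
        (use nth_deriv_poly[OF A that] in \<open>simp add: expansion_coeff_def\<close>)
    then show ?thesis unfolding harm_sum_cmult f_def w_def by simp
  qed
  have "uniformly_convergent_on ({-1<..<1} \<times> {0..r} \<times> {0<..<pi} \<times> UNIV)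
             (\<lambda>N (\<tau>, \<rho>, \<theta>, \<phi>). \<Sum>p<N. term_deriv a 2 p j 0 [] \<tau> \<rho> \<theta> \<phi>)"
    by (rule has_expansionD(3)[OF ex _ r]) simp
  then have "uniformly_Cauchy_on ({-1<..<1} \<times> {0..r} \<times> {0<..<pi} \<times> UNIV)
             (\<lambda>N (\<tau>, \<rho>, \<theta>, \<phi>). \<Sum>p<N. term_deriv a 2 p j 0 [] \<tau> \<rho> \<theta> \<phi>)"
    by (rule uniformly_convergent_Cauchy)
  then obtain P where P: "\<forall>z\<in>{-1<..<1} \<times> {0..r} \<times> {0<..<pi} \<times> UNIV. \<forall>i\<ge>P. \<forall>k\<ge>P.
      dist (case z of (\<tau>, \<rho>, \<theta>, \<phi>) \<Rightarrow> \<Sum>p<i. term_deriv a 2 p j 0 [] \<tau> \<rho> \<theta> \<phi>)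
        (case z of (\<tau>, \<rho>, \<theta>, \<phi>) \<Rightarrow> \<Sum>p<k. term_deriv a 2 p j 0 [] \<tau> \<rho> \<theta> \<phi>) < 1"
    unfolding uniformly_Cauchy_on_def using zero_less_one by blast
  have tail0: "norm (f p t \<theta> \<phi>) * w p \<le> 1" if "p \<ge> P" "t \<in> {-1<..<1}" "\<theta> \<in> {0<..<pi}" for p t \<theta> \<phi>
  proof -
    have "dist (\<Sum>p<Suc p. term_deriv a 2 p j 0 [] t r \<theta> \<phi>) (\<Sum>p<p. term_deriv a 2 p j 0 [] t r \<theta> \<phi>) < 1"
      using P[rule_format, of "(t, r, \<theta>, \<phi>)" "Suc p" p] that r by auto
    then have "norm (term_deriv a 2 p j 0 [] t r \<theta> \<phi>) < 1" by (simp add: dist_norm)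
    then show ?thesis using td[of t p \<theta> \<phi>] that w[of p] by (simp add: norm_mult mult.commute)
  qed
  \<comment> \<open>The derivative series is controlled only for |t| < 1. The terms are polynomial
    in t, so the bound extends by continuity to t = 1, where the Taylor coefficients are
    taken.\<close>
  have tail: "norm (f p t \<theta> \<phi>) * w p \<le> 1" if "p \<ge> P" "t \<in> {-1..1}" "\<theta> \<in> {0<..<pi}" for p t \<theta> \<phi>
  proof (rule continuous_le_on_closure[of "{-1<..<1}" "\<lambda>t. norm (f p t \<theta> \<phi>) * w p"])
    show "continuous_on (closure {-1<..<1}) (\<lambda>t. norm (f p t \<theta> \<phi>) * w p)"
      unfolding f_def harm_sum_def by (intro continuous_intros)
  qed (use that tail0 in auto)
  have "\<exists>K. \<forall>t\<in>{-1..1}. \<forall>\<theta>\<in>{0<..<pi}. \<forall>\<phi>. norm (f p t \<theta> \<phi>) \<le> K" for p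
    unfolding f_def by (rule harm_sum_poly_bounded)
  then obtain K where K: "\<And>p t \<theta> \<phi>. t \<in> {-1..1} \<Longrightarrow> \<theta> \<in> {0<..<pi} \<Longrightarrow> norm (f p t \<theta> \<phi>) \<le> K p"
    by metis
  have K0: "K p \<ge> 0" for p
    using K[of 0 "pi/2" p 0] pi_gt_zero by (force intro: order_trans[OF norm_ge_zero])
  have "norm (f p t \<theta> \<phi>) * w p \<le> 1 + (\<Sum>p<P. K p * w p)" if "t \<in> {-1..1}" "\<theta> \<in> {0<..<pi}" for p t \<theta> \<phi>
  proof (cases "p \<ge> P")
    case True
    then show ?thesis using tail[OF True that, of \<phi>] by (intro add_increasing2 sum_nonneg mult_nonneg_nonneg K0 w) auto
  next
    case False
    have "norm (f p t \<theta> \<phi>) * w p \<le> K p * w p" by (intro mult_right_mono K that w)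
    also have "\<dots> \<le> (\<Sum>p<P. K p * w p)"
      by (rule member_le_sum) (use False K0 w in \<open>auto intro: mult_nonneg_nonneg\<close>)
    finally show ?thesis by simp
  qed
  then show ?thesis unfolding f_def w_def by blast
qed

text \<open>The constants left after 4 / (\<rho> (1 + \<tau>)^2) becomes 2 / (\<rho>s (2 - x)) and
  \<rho>^p becomes (2 \<rho>s)^p / (2 - x)^p, together with the 1 / p! of the expansion.\<close>

abbreviation curve_weight :: "real \<Rightarrow> nat \<Rightarrow> real" where
  "curve_weight \<rho>s p \<equiv> 2 / \<rho>s * (2 * \<rho>s) ^ p / fact p"

text \<open>The degree p part of \<open>phi0_prime\<close> along the curve, differentiated i times
  in x. The argument is complex because Taylor's theorem is used in its complex form.\<close>

definition curve_term :: "real \<Rightarrow> (nat \<Rightarrow> nat \<Rightarrow> int \<Rightarrow> complex poly) \<Rightarrow> nat \<Rightarrow> nat \<Rightarrow> real \<Rightarrow> real \<Rightarrow> complex \<Rightarrow> complex" where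
  "curve_term \<rho>s A p i \<theta> \<phi> z =
     harm_sum (-1) 1 p (\<lambda>l m. of_real (curve_weight \<rho>s p) * curve_chain (A p l m) p i z) \<theta> \<phi>"

lemma deriv_chain_curve_term:
  assumes "2 \<notin> U"
  shows "deriv_chain U (\<lambda>i. curve_term \<rho>s A p i \<theta> \<phi>)"
  unfolding deriv_chain_def curve_term_def harm_sum_def
proof (intro allI ballI)
  fix i z assume "z \<in> U"
  then show "((\<lambda>z. \<Sum>l = 1..p. \<Sum>m = - int l..int l. of_real (curve_weight \<rho>s p) * curve_chain (A p l m) p i z * swsh (-1) l m \<theta> \<phi>)
     has_field_derivative (\<Sum>l = 1..p. \<Sum>m = - int l..int l. of_real (curve_weight \<rho>s p) * curve_chain (A p l m) p (Suc i) z * swsh (-1) l m \<theta> \<phi>)) (at z)"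
    by (intro DERIV_sum DERIV_cmult_right DERIV_cmult deriv_chainD[OF deriv_chain_curve[OF assms]])
qed

text \<open>Pulling the Leibniz sum outside exposes whole harmonic sums, which are what the uniform
  convergence bounds; individual modes are not estimated separately.\<close>

lemma curve_term_regroup:
  "curve_term \<rho>s A p i \<theta> \<phi> z = (\<Sum>j\<le>i. of_real (curve_weight \<rho>s p) * of_nat (i choose j) * (-1) ^ j * inv_chain p (i - j) z
      * harm_sum (-1) 1 p (\<lambda>l m. poly ((pderiv ^^ j) (A p l m)) (1 - z)) \<theta> \<phi>)"
proof -
  have "curve_term \<rho>s A p i \<theta> \<phi> z = (\<Sum>l = 1..p. \<Sum>m = - int l..int l. \<Sum>j\<le>i.
      of_real (curve_weight \<rho>s p) * of_nat (i choose j) * (-1) ^ j * inv_chain p (i - j) z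
      * (poly ((pderiv ^^ j) (A p l m)) (1 - z) * swsh (-1) l m \<theta> \<phi>))"
    unfolding curve_term_def harm_sum_def curve_chain_def sum_distrib_left sum_distrib_right
    by (intro sum.cong refl) (simp only: mult_ac)
  also have "\<dots> = (\<Sum>l = 1..p. \<Sum>j\<le>i. \<Sum>m = - int l..int l.
      of_real (curve_weight \<rho>s p) * of_nat (i choose j) * (-1) ^ j * inv_chain p (i - j) z
      * (poly ((pderiv ^^ j) (A p l m)) (1 - z) * swsh (-1) l m \<theta> \<phi>))"
    by (intro sum.cong refl sum.swap)
  also have "\<dots> = (\<Sum>j\<le>i. \<Sum>l = 1..p. \<Sum>m = - int l..int l.
      of_real (curve_weight \<rho>s p) * of_nat (i choose j) * (-1) ^ j * inv_chain p (i - j) z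
      * (poly ((pderiv ^^ j) (A p l m)) (1 - z) * swsh (-1) l m \<theta> \<phi>))"
    by (rule sum.swap)
  finally show ?thesis unfolding harm_sum_def sum_distrib_left .
qed

text \<open>The terms are bounded at the larger radius \<open>r\<close>, while the curve stays below
  q r with q < 1 as long as x <= \<delta>. The ratio gives q^p, multiplied by Pochhammer symbols
  that grow only polynomially in p.\<close>

lemma curve_term_bounded:
  fixes A :: "nat \<Rightarrow> nat \<Rightarrow> int \<Rightarrow> complex poly"
  assumes ex: "has_expansion \<rho>0 F a" and rs: "0 < \<rho>s" "\<rho>s < \<rho>0"
    and A: "\<And>p l m t. 1 \<le> l \<Longrightarrow> l \<le> p \<Longrightarrow> \<bar>m\<bar> \<le> int l \<Longrightarrow> -1 < t \<Longrightarrow> t < 1 \<Longrightarrow> a 2 p l m t = poly (A p l m) (of_real t)"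
  obtains M \<delta> where "0 < \<delta>" "\<delta> < 1" "2 * \<rho>s / (2 - \<delta>) < \<rho>0" "\<And>i. summable (M i)"
    "\<And>p i x \<theta> \<phi>. 0 \<le> x \<Longrightarrow> x \<le> \<delta> \<Longrightarrow> \<theta> \<in> {0<..<pi} \<Longrightarrow> norm (curve_term \<rho>s A p i \<theta> \<phi> (of_real x)) \<le> M i p"
proof -
  define r where "r = (\<rho>s + \<rho>0) / 2"
  have r: "0 < r" "r < \<rho>0" "\<rho>s < r" unfolding r_def using rs by auto
  \<comment> \<open>With this choice (2 - \<delta>) r = r + \<rho>s, so q = 2 \<rho>s / (r +
    \<rho>s), which is below 1 exactly because \<rho>s < r.\<close>
  define \<delta> where "\<delta> = 1 - \<rho>s / r"
  have \<delta>: "0 < \<delta>" "\<delta> < 1" unfolding \<delta>_def using r rs by auto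
  define q where "q = 2 * \<rho>s / ((2 - \<delta>) * r)"
  have q0: "0 < q" unfolding q_def using rs r \<delta> by simp
  have dr: "(2 - \<delta>) * r = r + \<rho>s" unfolding \<delta>_def using r by (simp add: field_simps)
  have q1: "q < 1" unfolding q_def dr using rs r by simp
  have "\<exists>K. \<forall>p. \<forall>t\<in>{-1..1}. \<forall>\<theta>\<in>{0<..<pi}. \<forall>\<phi>.
    norm (harm_sum (-1) 1 p (\<lambda>l m. poly ((pderiv ^^ j) (A p l m)) (of_real t)) \<theta> \<phi>) * (r ^ p / fact p) \<le> K" for j
    by (rule expansion_tau_deriv_bounded[OF ex r(1,2) A])
  then obtain K where K: "\<And>j p t \<theta> \<phi>. t \<in> {-1..1} \<Longrightarrow> \<theta> \<in> {0<..<pi} \<Longrightarrow>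
    norm (harm_sum (-1) 1 p (\<lambda>l m. poly ((pderiv ^^ j) (A p l m)) (of_real t)) \<theta> \<phi>) * (r ^ p / fact p) \<le> K j"
    by metis
  define M where "M = (\<lambda>i p. \<Sum>j\<le>i. (2 / \<rho>s * real (i choose j) * K j) * (pochhammer (real p + 1) (i - j) * q ^ p))"
  have "summable (M i)" for i
    unfolding M_def by (intro summable_sum summable_mult summable_pochhammer_geometric) (use q0 q1 in auto)
  moreover have "norm (curve_term \<rho>s A p i \<theta> \<phi> (of_real x)) \<le> M i p"
    if x: "0 \<le> x" "x \<le> \<delta>" and th: "\<theta> \<in> {0<..<pi}" for p i x \<theta> \<phi>
  proof -
    have inv: "norm (inv_chain p k (of_real x)) \<le> pochhammer (real p + 1) k * inverse ((2 - \<delta>) ^ p)" for k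
    proof -
      have pn: "pochhammer (real p + 1) k \<ge> 0" by (intro pochhammer_nonneg) simp
      have "norm (inv_chain p k (of_real x)) = pochhammer (real p + 1) k * inverse ((2 - x) ^ (p + 1 + k))"
      proof -
        have "inv_chain p k (of_real x) = of_real (pochhammer (real p + 1) k * inverse ((2 - x) ^ (p + 1 + k)))"
          unfolding inv_chain_def by (simp add: pochhammer_of_real[symmetric] add.commute)
        moreover have "pochhammer (real p + 1) k * inverse ((2 - x) ^ (p + 1 + k)) \<ge> 0"
          using pn x \<delta> by simp
        ultimately show ?thesis by (simp only: norm_of_real abs_of_nonneg)
      qed
      also have "inverse ((2 - x) ^ (p + 1 + k)) \<le> inverse ((2 - \<delta>) ^ p)"
      proof (rule le_imp_inverse_le)
        have "(2 - \<delta>) ^ p \<le> (2 - x) ^ p" by (intro power_mono) (use x \<delta> in auto)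
        also have "\<dots> \<le> (2 - x) ^ (p + 1 + k)" by (intro power_increasing) (use x \<delta> in auto)
        finally show "(2 - \<delta>) ^ p \<le> (2 - x) ^ (p + 1 + k)" .
      qed (use \<delta> in simp)
      finally show ?thesis using pn by (simp add: mult_left_mono)
    qed
    have "norm (curve_term \<rho>s A p i \<theta> \<phi> (of_real x)) \<le> (\<Sum>j\<le>i. (2 / \<rho>s * real (i choose j) * K j) * (pochhammer (real p + 1) (i - j) * q ^ p))"
      unfolding curve_term_regroup
    proof (rule order_trans[OF norm_sum], rule sum_mono)
      fix j
      define H where "H = norm (harm_sum (-1) 1 p (\<lambda>l m. poly ((pderiv ^^ j) (A p l m)) (1 - of_real x)) \<theta> \<phi>)"
      have H: "H * (r ^ p / fact p) \<le> K j" unfolding H_def using K[of "1 - x" \<theta> p j \<phi>] x \<delta> th by simp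
      have "norm (of_real (curve_weight \<rho>s p) * of_nat (i choose j) * (-1) ^ j * inv_chain p (i - j) (of_real x)
          * harm_sum (-1) 1 p (\<lambda>l m. poly ((pderiv ^^ j) (A p l m)) (1 - of_real x)) \<theta> \<phi>)
        = (curve_weight \<rho>s p) * real (i choose j) * norm (inv_chain p (i - j) (of_real x)) * H"
        unfolding H_def norm_mult norm_power norm_of_real using rs by simp
      also have "\<dots> \<le> (curve_weight \<rho>s p) * real (i choose j) * (pochhammer (real p + 1) (i - j) * inverse ((2 - \<delta>) ^ p)) * H"
        by (intro mult_right_mono mult_left_mono inv) (use rs in \<open>auto simp: H_def\<close>)
      also have "\<dots> = (2 / \<rho>s * real (i choose j) * (pochhammer (real p + 1) (i - j) * q ^ p)) * (H * (r ^ p / fact p))"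
      proof -
        have "q * r = 2 * \<rho>s * inverse (2 - \<delta>)" unfolding q_def using r \<delta> by (simp add: divide_inverse)
        then have e: "(2 * \<rho>s) ^ p * inverse ((2 - \<delta>) ^ p) = q ^ p * r ^ p"
          by (metis power_inverse power_mult_distrib)
        have "(curve_weight \<rho>s p) * real (i choose j) * (pochhammer (real p + 1) (i - j) * inverse ((2 - \<delta>) ^ p)) * H
          = 2 / \<rho>s * real (i choose j) * pochhammer (real p + 1) (i - j) * ((2 * \<rho>s) ^ p * inverse ((2 - \<delta>) ^ p)) * H / fact p"
          by (simp only: divide_inverse mult_ac)
        then show ?thesis unfolding e by (simp only: divide_inverse mult_ac)
      qed
      also have "\<dots> \<le> (2 / \<rho>s * real (i choose j) * (pochhammer (real p + 1) (i - j) * q ^ p)) * K j"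
        by (intro mult_left_mono H mult_nonneg_nonneg pochhammer_nonneg) (use rs q0 in auto)
      finally show "norm (of_real (curve_weight \<rho>s p) * of_nat (i choose j) * (-1) ^ j * inv_chain p (i - j) (of_real x)
          * harm_sum (-1) 1 p (\<lambda>l m. poly ((pderiv ^^ j) (A p l m)) (1 - of_real x)) \<theta> \<phi>)
        \<le> (2 / \<rho>s * real (i choose j) * K j) * (pochhammer (real p + 1) (i - j) * q ^ p)"
        by (simp only: mult_ac)
    qed
    then show ?thesis unfolding M_def .
  qed
  moreover have "2 * \<rho>s / (2 - \<delta>) < \<rho>0"
  proof -
    have "2 * \<rho>s / (2 - \<delta>) = q * r" unfolding q_def using r \<delta> by simp
    also have "\<dots> < r" using q1 r by simp
    finally show ?thesis using r by simp
  qed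
  ultimately show ?thesis using that \<delta> by blast
qed

section \<open>The Newman--Penrose constants\<close>

lemma physical_curve_sums:
  fixes A :: "nat \<Rightarrow> nat \<Rightarrow> int \<Rightarrow> complex poly"
  assumes ex: "has_expansion \<rho>0 F a" and rs: "0 < \<rho>s" "\<rho>s < \<rho>0" and \<delta>: "\<delta> < 1" "2 * \<rho>s / (2 - \<delta>) < \<rho>0"
    and A: "\<And>p l m t. 1 \<le> l \<Longrightarrow> l \<le> p \<Longrightarrow> \<bar>m\<bar> \<le> int l \<Longrightarrow> -1 < t \<Longrightarrow> t < 1 \<Longrightarrow> a 2 p l m t = poly (A p l m) (of_real t)"
    and r: "0 < r" "1 / (2 * \<rho>s * r) \<le> \<delta>" and th: "0 < \<theta>" "\<theta> < pi"
  shows "phi0_phys F (- 1 / (2 * \<rho>s)) r \<theta> \<phi>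
    = of_real (r powi (-3)) * (\<Sum>p. curve_term \<rho>s A p 0 \<theta> \<phi> (of_real (1 / (2 * \<rho>s * r))))"
proof -
  define x where "x = 1 / (2 * \<rho>s * r)"
  have x: "0 < x" "x \<le> \<delta>" unfolding x_def using rs r by auto
  define \<rho> where "\<rho> = 2 * \<rho>s / (2 - x)"
  have x2: "2 - x > 0" using x \<delta> by simp
  have tau: "tau_of (- 1 / (2 * \<rho>s)) r = 1 - x"
    unfolding tau_of_def x_def using rs r by (simp add: field_simps)
  have u: "- 1 / (2 * \<rho>s) = - (x * r)" unfolding x_def using rs r by simp
  have rho: "rho_of (- 1 / (2 * \<rho>s)) r = \<rho>"
  proof -
    have "rho_of (- 1 / (2 * \<rho>s)) r = r / (r\<^sup>2 * (x * (2 - x)))"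
      unfolding rho_of_def u by (simp add: power2_eq_square algebra_simps)
    also have "\<dots> = (1 / (x * r)) / (2 - x)" using r x x2 by (simp add: power2_eq_square field_simps)
    also have "1 / (x * r) = 2 * \<rho>s" unfolding x_def using rs r by simp
    finally show ?thesis unfolding \<rho>_def .
  qed
  have rho0: "0 < \<rho>" "\<rho> < \<rho>0"
  proof -
    show "0 < \<rho>" unfolding \<rho>_def using rs x2 by simp
    have "\<rho> \<le> 2 * \<rho>s / (2 - \<delta>)" unfolding \<rho>_def using rs x \<delta> by (intro divide_left_mono) auto
    then show "\<rho> < \<rho>0" using \<delta> by simp
  qed
  have t: "-1 < 1 - x" "1 - x < 1" using x \<delta> by auto
  have pre: "4 / (\<rho> * (1 + (1 - x))\<^sup>2) = 2 / \<rho>s / (2 - x)"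
  proof -
    have "4 / (2 * \<rho>s / y * y\<^sup>2) = 2 / \<rho>s / y" if "y > 0" for y
      using rs that by (simp add: power2_eq_square field_simps)
    from this[OF x2] show ?thesis unfolding \<rho>_def by (simp only: add_diff_eq one_add_one)
  qed
  have S: "(\<lambda>p. of_real (\<rho> ^ p) * harm_sum (-1) 1 p (expansion_coeff a 2 0 (1 - x) p) \<theta> \<phi>) sums F 2 (1 - x) \<rho> \<theta> \<phi>"
    using expansion_sums[OF ex, of 2 "1 - x" \<rho> \<theta> \<phi>] t rho0 th by simp
  have "complex_of_real (2 / \<rho>s / (2 - x)) * (of_real (\<rho> ^ p) * harm_sum (-1) 1 p (expansion_coeff a 2 0 (1 - x) p) \<theta> \<phi>)
      = curve_term \<rho>s A p 0 \<theta> \<phi> (of_real x)" for p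
  proof -
    have e: "harm_sum (-1) 1 p (expansion_coeff a 2 0 (1 - x) p) \<theta> \<phi>
      = harm_sum (-1) 1 p (\<lambda>l m. 1 / fact p * poly (A p l m) (of_real (1 - x))) \<theta> \<phi>"
      by (rule harm_sum_cong) (simp add: expansion_coeff_def nth_deriv_def A[OF _ _ _ t])
    have c: "of_real (curve_weight \<rho>s p) * curve_chain (A p l m) p 0 (of_real x)
      = of_real (curve_weight \<rho>s p * inverse ((2 - x) ^ (p + 1))) * poly (A p l m) (of_real (1 - x))" for l m
      unfolding curve_chain_def inv_chain_def by simp
    have "complex_of_real (2 / \<rho>s / (2 - x)) * (of_real (\<rho> ^ p) * (1 / fact p)) = of_real (2 / \<rho>s / (2 - x) * \<rho> ^ p / fact p)"
      by simp
    also have "2 / \<rho>s / (2 - x) * \<rho> ^ p / fact p = curve_weight \<rho>s p * inverse ((2 - x) ^ (p + 1))"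
      unfolding \<rho>_def using x2 rs by (simp add: power_divide divide_inverse power_mult_distrib power_inverse)
    finally have q: "complex_of_real (2 / \<rho>s / (2 - x)) * (of_real (\<rho> ^ p) * (1 / fact p))
       = of_real (curve_weight \<rho>s p * inverse ((2 - x) ^ (p + 1)))" .
    show ?thesis unfolding e curve_term_def c harm_sum_cmult q[symmetric] by (simp only: mult.assoc)
  qed
  then have "(\<lambda>p. curve_term \<rho>s A p 0 \<theta> \<phi> (of_real x)) sums (of_real (2 / \<rho>s / (2 - x)) * F 2 (1 - x) \<rho> \<theta> \<phi>)"
    using sums_mult[OF S, of "of_real (2 / \<rho>s / (2 - x))"] by simp
  then have "(\<Sum>p. curve_term \<rho>s A p 0 \<theta> \<phi> (of_real x)) = of_real (2 / \<rho>s / (2 - x)) * F 2 (1 - x) \<rho> \<theta> \<phi>"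
    by (rule sums_unique[symmetric])
  then show ?thesis unfolding phi0_phys_def phi0_prime_def tau rho pre x_def[symmetric] by simp
qed

text \<open>With x = b / r the Taylor expansion in x becomes an expansion in 1 / r. Its remainder of
  order x^(N+1), with a constant independent of r, is one power of r better than the required
  little-o.\<close>

lemma phi0_phys_expansion:
  fixes A :: "nat \<Rightarrow> nat \<Rightarrow> int \<Rightarrow> complex poly" and M :: "nat \<Rightarrow> nat \<Rightarrow> real"
  assumes ex: "has_expansion \<rho>0 F a" and rs: "0 < \<rho>s" "\<rho>s < \<rho>0" and \<delta>: "0 < \<delta>" "\<delta> < 1" "2 * \<rho>s / (2 - \<delta>) < \<rho>0"
    and A: "\<And>p l m t. 1 \<le> l \<Longrightarrow> l \<le> p \<Longrightarrow> \<bar>m\<bar> \<le> int l \<Longrightarrow> -1 < t \<Longrightarrow> t < 1 \<Longrightarrow> a 2 p l m t = poly (A p l m) (of_real t)"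
    and M: "\<And>i. summable (M i)"
      "\<And>p i x \<theta> \<phi>. 0 \<le> x \<Longrightarrow> x \<le> \<delta> \<Longrightarrow> \<theta> \<in> {0<..<pi} \<Longrightarrow> norm (curve_term \<rho>s A p i \<theta> \<phi> (of_real x)) \<le> M i p"
    and th: "0 < \<theta>" "\<theta> < pi"
  shows "is_asymptotic_expansion (\<lambda>r. phi0_phys F (- 1 / (2 * \<rho>s)) r \<theta> \<phi>)
      (\<lambda>k. (\<Sum>p. curve_term \<rho>s A p k \<theta> \<phi> 0) / fact k * of_real ((1 / (2 * \<rho>s)) ^ k))" (is "is_asymptotic_expansion _ ?c")
  unfolding is_asymptotic_expansion_def
proof (intro allI landau_o.smallI)
  fix N and e :: real assume e: "e > 0"
  define b where "b = 1 / (2 * \<rho>s)"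
  have b: "b > 0" unfolding b_def using rs by simp
  define S where "S = (\<Sum>p. M (Suc N) p) * (b ^ Suc N / fact N)"
  \<comment> \<open>The first threshold places x in the interval [0, \<delta>]; the second lets the
    spare factor 1 / r absorb the constant \<open>S\<close> into e.\<close>
  have "\<forall>\<^sub>F r in at_top. r \<ge> b / \<delta>" "\<forall>\<^sub>F r in at_top. r \<ge> S / e" "\<forall>\<^sub>F r :: real in at_top. r > 0"
    by (rule eventually_ge_at_top eventually_gt_at_top)+
  then show "\<forall>\<^sub>F r in at_top. norm (phi0_phys F (- 1 / (2 * \<rho>s)) r \<theta> \<phi> - (\<Sum>k\<le>N. ?c k * complex_of_real (r powi (-3 - int k))))
      \<le> e * norm (complex_of_real (r powi (-3 - int N)))"
  proof eventually_elim
    case (elim r)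
    then have r: "r > 0" "b / r \<le> \<delta>" "S \<le> e * r" using \<delta> e by (auto simp: field_simps)
    define x where "x = b / r"
    have x: "0 \<le> x" "x \<le> \<delta>" unfolding x_def using r b by auto
    have xb: "1 / (2 * \<rho>s * r) = x" unfolding x_def b_def by simp
    have pw: "r powi (-3 - int k) = r powi (-3) * inverse (r ^ k)" for k
      using r(1) power_int_add[of r "-3" "- int k"] by (simp add: power_int_minus)
    have ck: "?c k * complex_of_real (r powi (-3 - int k)) = of_real (r powi (-3)) * ((\<Sum>p. curve_term \<rho>s A p k \<theta> \<phi> 0) / fact k * of_real (x ^ k))" for k
      unfolding pw x_def b_def[symmetric] by (simp add: divide_inverse power_mult_distrib power_inverse)
    have phi: "phi0_phys F (- 1 / (2 * \<rho>s)) r \<theta> \<phi> = of_real (r powi (-3)) * (\<Sum>p. curve_term \<rho>s A p 0 \<theta> \<phi> (of_real x))"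
      using physical_curve_sums[OF ex rs \<delta>(2,3) A r(1) _ th, unfolded xb] x by simp
    \<comment> \<open>The point 2 is the pole of \<open>inv_chain\<close>, i.e. past null infinity
      \<tau> = -1; as \<delta> < 1 the segment stays away from it.\<close>
    have seg: "2 \<notin> closed_segment 0 (complex_of_real \<delta>)"
    proof
      assume "2 \<in> closed_segment 0 (complex_of_real \<delta>)"
      then obtain v where v: "0 \<le> v" "v \<le> 1" "2 = v *\<^sub>R complex_of_real \<delta>" by (auto simp: in_segment)
      then have "v * \<delta> = 2" by (metis of_real_eq_iff of_real_mult of_real_numeral scaleR_conv_of_real)
      moreover have "v * \<delta> \<le> 1 * 1" using v \<delta> by (intro mult_mono) auto
      ultimately show False by simp
    qed
    have T: "norm ((\<Sum>p. curve_term \<rho>s A p 0 \<theta> \<phi> (of_real x)) - (\<Sum>i\<le>N. (\<Sum>p. curve_term \<rho>s A p i \<theta> \<phi> 0) / fact i * of_real (x ^ i)))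
       \<le> (\<Sum>p. M (Suc N) p) * (x ^ Suc N / fact N)"
      by (rule taylor_series_sum[where M = M, OF deriv_chain_curve_term[OF seg] _ M(1) x]) (use M(2) th in auto)
    have "norm (phi0_phys F (- 1 / (2 * \<rho>s)) r \<theta> \<phi> - (\<Sum>k\<le>N. ?c k * complex_of_real (r powi (-3 - int k))))
      = r powi (-3) * norm ((\<Sum>p. curve_term \<rho>s A p 0 \<theta> \<phi> (of_real x)) - (\<Sum>i\<le>N. (\<Sum>p. curve_term \<rho>s A p i \<theta> \<phi> 0) / fact i * of_real (x ^ i)))"
      unfolding phi ck sum_distrib_left[symmetric] right_diff_distrib[symmetric] norm_mult norm_of_real using r(1) by simp
    also have "\<dots> \<le> r powi (-3) * ((\<Sum>p. M (Suc N) p) * (x ^ Suc N / fact N))"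
      by (intro mult_left_mono T) (use r in simp)
    also have "\<dots> = r powi (-3) * (S * inverse (r ^ Suc N))"
      unfolding S_def x_def by (simp add: divide_inverse power_mult_distrib power_inverse)
    also have "\<dots> \<le> r powi (-3) * ((e * r) * inverse (r ^ Suc N))"
      by (intro mult_left_mono mult_right_mono r) (use r in simp_all)
    also have "\<dots> = e * norm (complex_of_real (r powi (-3 - int N)))"
      unfolding pw norm_of_real using r(1) by (simp add: abs_mult)
    finally show ?case .
  qed
qed

text \<open>The coordinate rectangle has finite measure and the harmonic is bounded, so summable sup
  bounds on the terms justify integrating term by term.\<close>

lemma projection_of_series:
  fixes h :: "nat \<Rightarrow> sphere_fun" and M :: "nat \<Rightarrow> real"
  assumes n: "1 \<le> n" "\<bar>m\<bar> \<le> int n"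
    and i: "\<And>p. set_integrable lborel sphere_dom (proj_integrand (-1) n m (h p))"
    and b: "\<And>p \<theta> \<phi>. \<theta> \<in> {0<..<pi} \<Longrightarrow> norm (h p \<theta> \<phi>) \<le> M p" and s: "summable M"
  shows "set_lebesgue_integral lborel sphere_dom (proj_integrand (-1) n m (\<lambda>\<theta> \<phi>. \<Sum>p. h p \<theta> \<phi>))
     = (\<Sum>p. set_lebesgue_integral lborel sphere_dom (proj_integrand (-1) n m (h p)))"
proof -
  obtain B where B: "\<And>\<theta> \<phi>. 0 < \<theta> \<Longrightarrow> \<theta> < pi \<Longrightarrow> norm (swsh (-1) n m \<theta> \<phi>) \<le> B"
    using swsh_bounded[of "-1" m n] n by auto
  have B0: "B \<ge> 0" using B[of "pi/2" 0] by (auto intro: order_trans[OF norm_ge_zero])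
  have M0: "M p \<ge> 0" for p using b[of "pi/2" p 0] by (auto intro: order_trans[OF norm_ge_zero])
  define f where "f = (\<lambda>p z. indicator sphere_dom z *\<^sub>R proj_integrand (-1) n m (h p) z)"
  have bd: "norm (f p z) \<le> indicator sphere_dom z * (B * M p)" for p z
  proof (cases "z \<in> sphere_dom")
    case True
    obtain \<theta> \<phi> where z: "z = (\<theta>, \<phi>)" by (cases z)
    have th: "0 < \<theta>" "\<theta> < pi" using True z by auto
    have "norm (f p z) = \<bar>sin \<theta>\<bar> * (norm (swsh (-1) n m \<theta> \<phi>) * norm (h p \<theta> \<phi>))"
      unfolding f_def proj_integrand_def z using True z by (simp add: norm_mult)
    also have "\<dots> \<le> 1 * (B * M p)"
      using th by (intro mult_mono B b) (auto simp: B0 M0)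
    finally show ?thesis using True by simp
  qed (simp add: f_def)
  have fin: "emeasure lborel sphere_dom < \<infinity>"
    by (intro emeasure_bounded_finite bounded_Times) auto
  have meas: "sphere_dom \<in> sets lborel" by (auto intro!: borel_open open_Times)
  have ii: "integrable lborel (\<lambda>z. indicator sphere_dom z * (B * M p))" for p
    using fin meas by (intro integrable_mult_left integrable_real_indicator) auto
  have fi: "integrable lborel (f p)" for p using i[of p] unfolding f_def set_integrable_def .
  have e: "indicator sphere_dom z *\<^sub>R proj_integrand (-1) n m (\<lambda>\<theta> \<phi>. \<Sum>p. h p \<theta> \<phi>) z = (\<Sum>p. f p z)" for z
  proof (cases "z \<in> sphere_dom")
    case True
    obtain \<theta> \<phi> where z: "z = (\<theta>, \<phi>)" by (cases z)
    have "summable (\<lambda>p. h p \<theta> \<phi>)"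
      by (rule summable_comparison_test[OF _ s]) (use b True z in auto)
    then show ?thesis using True
      unfolding f_def proj_integrand_def z by (simp add: suminf_mult scaleR_conv_of_real summable_mult)
  qed (simp add: f_def)
  have "(LINT z|lborel. (\<Sum>p. f p z)) = (\<Sum>p. LINT z|lborel. f p z)"
  proof (rule integral_suminf[OF fi])
    show "AE z in lborel. summable (\<lambda>p. norm (f p z))"
    proof (rule AE_I2)
      fix z
      show "summable (\<lambda>p. norm (f p z))"
        by (rule summable_comparison_test[OF _ summable_mult[OF summable_mult[OF s, of B], of "indicator sphere_dom z"]])
          (use bd in auto)
    qed
    show "summable (\<lambda>p. LINT z|lborel. norm (f p z))"
    proof (rule summable_comparison_test[OF _ summable_mult[OF summable_mult[OF s, of B], of "measure lborel sphere_dom"]], intro exI allI impI)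
      fix p
      have "(LINT z|lborel. norm (f p z)) \<le> (LINT z|lborel. indicator sphere_dom z * (B * M p))"
        by (intro integral_mono integrable_norm fi ii bd)
      also have "\<dots> = measure lborel sphere_dom * (B * M p)" using meas by simp
      finally show "norm (LINT z|lborel. norm (f p z)) \<le> measure lborel sphere_dom * (B * M p)"
        by (simp add: integral_nonneg_AE)
    qed
  qed
  then show ?thesis unfolding set_lebesgue_integral_def e f_def .
qed

text \<open>Here 2 pi \<open>harm_norm n\<close> is the squared norm of the harmonic, and the
  remaining 4 is what the powers of \<rho>s leave behind. The binomial is \<open>W\<close> at 1 for
  p = n + 1, the power of 4 comes from the halves in (1 + \<tau>)/2 and (1 - \<tau>)/2, and the
  factorial from the expansion in \<rho>.\<close>

abbreviation NP_factor :: "nat \<Rightarrow> real" where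
  "NP_factor n \<equiv> 8 * pi * harm_norm n * ((real n + real (n + 1)) gchoose (n + 1)) / (fact (n + 1) * 4 ^ (n + 1))"

lemma NP_const_value:
  assumes r0: "0 < \<rho>0" and mx: "maxwell_equations \<rho>0 F" and ex: "has_expansion \<rho>0 F a"
    and top: "top_mode_constants a E Es J Js" and reg: "\<And>p m. 1 \<le> p \<Longrightarrow> \<bar>m\<bar> \<le> int p \<Longrightarrow> Es p m = 0 \<and> Js p m = 0"
    and n: "1 \<le> n" "\<bar>m\<bar> \<le> int n" and rs: "0 < \<rho>s" "\<rho>s < \<rho>0"
  shows "NP_const F \<rho>s (n - 1) m = of_real (NP_factor n)
     * C_const a (n + 1) n m"
proof -
  \<comment> \<open>The Taylor order is taken equal to l, because projecting the n-th coefficient on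
    the n-th harmonics only ever pairs equal indices.\<close>
  define val where "val = (\<lambda>p l m. if p = l + 1 then fact l * (C_const a p l m * of_real ((real l + real p) gchoose (l + 1))) / 4 ^ p else 0)"
  define ok where "ok = (\<lambda>p l m A. (\<forall>t. -1 < t \<and> t < 1 \<longrightarrow> a 2 p l m t = poly A (of_real t)) \<and> curve_chain A p l 0 = val p l m)"
  have "\<exists>A. (\<forall>t. -1 < t \<and> t < 1 \<longrightarrow> a 2 p l m t = poly A (of_real t)) \<and> curve_chain A p l 0 = val p l m"
    if l: "1 \<le> l" "l \<le> p" "\<bar>m\<bar> \<le> int l" for p l m
  proof -
    obtain B W :: "complex poly" where BW:
      "\<And>t. -1 < t \<Longrightarrow> t < 1 \<Longrightarrow> a 2 p l m t = poly ([:1/2, 1/2:] ^ (p + 1) * B + [:1/2, -1/2:] ^ (p - 1) * W) (of_real t)"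
      "degree B < l" "l = p \<Longrightarrow> W = 0"
      "l < p \<Longrightarrow> poly W 1 = C_const a p l m * of_real ((real l + real p) gchoose (l + 1))"
      using mode_decomposition[OF maxwell_mode_system[OF r0 mx ex l] top reg l] by blast
    have "curve_chain ([:1/2, 1/2:] ^ (p + 1) * B + [:1/2, -1/2:] ^ (p - 1) * W) p l 0 = val p l m"
      using curve_chain_at_0[of p B l W] BW(2-4) l unfolding val_def by auto
    then show ?thesis using BW(1) by blast
  qed
  then have ok: "\<exists>A. ok p l m A" if "1 \<le> l" "l \<le> p" "\<bar>m\<bar> \<le> int l" for p l m
    unfolding ok_def using that by blast
  \<comment> \<open>One polynomial per mode is fixed here, since the bounds refer to the whole
    family at once.\<close>
  define A where "A = (\<lambda>p l m. SOME A. ok p l m A)"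
  have "ok p l m (A p l m)" if "1 \<le> l" "l \<le> p" "\<bar>m\<bar> \<le> int l" for p l m
    unfolding A_def by (rule someI_ex[OF ok[OF that]])
  then have A: "a 2 p l m t = poly (A p l m) (of_real t)" and Aval: "curve_chain (A p l m) p l 0 = val p l m"
    if "1 \<le> l" "l \<le> p" "\<bar>m\<bar> \<le> int l" "-1 < t" "t < 1" for p l m t
    unfolding ok_def using that by blast+
  have "\<exists>M \<delta>. 0 < \<delta> \<and> \<delta> < 1 \<and> 2 * \<rho>s / (2 - \<delta>) < \<rho>0 \<and> (\<forall>i. summable (M i)) \<and>
    (\<forall>p i x \<theta> \<phi>. 0 \<le> x \<longrightarrow> x \<le> \<delta> \<longrightarrow> \<theta> \<in> {0<..<pi} \<longrightarrow> norm (curve_term \<rho>s A p i \<theta> \<phi> (of_real x)) \<le> M i p)"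
  proof (rule curve_term_bounded[OF ex rs, of A])
    fix M :: "nat \<Rightarrow> nat \<Rightarrow> real" and \<delta>
    assume "0 < \<delta>" "\<delta> < 1" "2 * \<rho>s / (2 - \<delta>) < \<rho>0" "\<And>i. summable (M i)"
      "\<And>p i x \<theta> \<phi>. 0 \<le> x \<Longrightarrow> x \<le> \<delta> \<Longrightarrow> \<theta> \<in> {0<..<pi} \<Longrightarrow> norm (curve_term \<rho>s A p i \<theta> \<phi> (of_real x)) \<le> M i p"
    then show ?thesis by (intro exI[of _ M] exI[of _ \<delta>] conjI allI impI)
  qed (rule A)
  then obtain M \<delta> where \<delta>: "0 < \<delta>" "\<delta> < 1" "2 * \<rho>s / (2 - \<delta>) < \<rho>0" and M0: "\<forall>i. summable (M i)"
    "\<forall>p i x \<theta> \<phi>. 0 \<le> x \<longrightarrow> x \<le> \<delta> \<longrightarrow> \<theta> \<in> {0<..<pi} \<longrightarrow> norm (curve_term \<rho>s A p i \<theta> \<phi> (of_real x)) \<le> M i p"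
    by (elim exE conjE)
  note M = M0[rule_format]
  define K where "K = complex_of_real ((1 / (2 * \<rho>s)) ^ n) / fact n"
  have coeff: "phi0_phys_coeff F (- 1 / (2 * \<rho>s)) n \<theta> \<phi> = K * (\<Sum>p. curve_term \<rho>s A p n \<theta> \<phi> 0)"
    if "0 < \<theta>" "\<theta> < pi" for \<theta> \<phi>
  proof -
    have exp: "is_asymptotic_expansion (\<lambda>r. phi0_phys F (- 1 / (2 * \<rho>s)) r \<theta> \<phi>)
      (\<lambda>k. (\<Sum>p. curve_term \<rho>s A p k \<theta> \<phi> 0) / fact k * of_real ((1 / (2 * \<rho>s)) ^ k))"
      by (rule phi0_phys_expansion[OF ex rs \<delta>, of A M]) (rule A M that; assumption)+
    have "(THE c. is_asymptotic_expansion (\<lambda>r. phi0_phys F (- 1 / (2 * \<rho>s)) r \<theta> \<phi>) c)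
      = (\<lambda>k. (\<Sum>p. curve_term \<rho>s A p k \<theta> \<phi> 0) / fact k * of_real ((1 / (2 * \<rho>s)) ^ k))"
      by (rule the_equality[where P = "is_asymptotic_expansion (\<lambda>r. phi0_phys F (- 1 / (2 * \<rho>s)) r \<theta> \<phi>)", OF exp])
        (rule asymptotic_expansion_unique[OF _ exp])
    then show ?thesis unfolding phi0_phys_coeff_def K_def by simp
  qed
  define h where "h = (\<lambda>p \<theta> \<phi>. K * curve_term \<rho>s A p n \<theta> \<phi> 0)"
  have h: "h p = harm_sum (-1) 1 p (\<lambda>l m. K * (of_real (curve_weight \<rho>s p) * curve_chain (A p l m) p n 0))" for p
    unfolding h_def curve_term_def harm_sum_cmult[symmetric] ..
  have hb: "norm (h p \<theta> \<phi>) \<le> norm K * M n p" if "\<theta> \<in> {0<..<pi}" for p \<theta> \<phi>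
    using M(2)[of 0 \<theta> p n \<phi>] that \<delta> unfolding h_def norm_mult by (intro mult_left_mono) auto
  have hs: "summable (\<lambda>p. norm K * M n p)" by (intro summable_mult M)
  have meas: "sphere_dom \<in> sets lborel" by (auto intro!: borel_open open_Times)
  have "NP_const F \<rho>s (n - 1) m = set_lebesgue_integral lborel sphere_dom
      (proj_integrand (-1) n m (phi0_phys_coeff F (- 1 / (2 * \<rho>s)) n))"
    unfolding NP_const_def sphere_integral_def proj_integrand_def using n(1) by simp
  also have "\<dots> = set_lebesgue_integral lborel sphere_dom (proj_integrand (-1) n m (\<lambda>\<theta> \<phi>. \<Sum>p. h p \<theta> \<phi>))"
  proof (rule set_lebesgue_integral_cong[OF meas], intro allI impI)
    fix z assume "z \<in> sphere_dom"
    then obtain \<theta> \<phi> where z: "z = (\<theta>, \<phi>)" "0 < \<theta>" "\<theta> < pi" by (cases z) auto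
    have "summable (\<lambda>p. curve_term \<rho>s A p n \<theta> \<phi> 0)"
      by (rule summable_comparison_test[OF _ M(1)[of n]]) (use M(2)[of 0 \<theta> _ n \<phi>] z \<delta> in auto)
    then show "proj_integrand (-1) n m (phi0_phys_coeff F (- 1 / (2 * \<rho>s)) n) z
        = proj_integrand (-1) n m (\<lambda>\<theta> \<phi>. \<Sum>p. h p \<theta> \<phi>) z"
      unfolding proj_integrand_def z(1) h_def prod.case coeff[OF z(2,3)] by (simp add: suminf_mult)
  qed
  also have "\<dots> = (\<Sum>p. set_lebesgue_integral lborel sphere_dom (proj_integrand (-1) n m (h p)))"
    by (rule projection_of_series[OF n _ hb hs]) (use harm_sum_projection(1)[of "-1" 1 n m] n in \<open>simp add: h\<close>)
  also have "\<dots> = (\<Sum>p. if p = n + 1 then of_real (2 * pi * harm_norm n) * (K * (of_real (curve_weight \<rho>s p) * val p n m)) else 0)"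
  proof (rule suminf_cong)
    fix p
    have "set_lebesgue_integral lborel sphere_dom (proj_integrand (-1) n m (h p))
      = (if 1 \<le> n \<and> n \<le> p then of_real (2 * pi * harm_norm n) * (K * (of_real (curve_weight \<rho>s p) * curve_chain (A p n m) p n 0)) else 0)"
      unfolding h by (rule harm_sum_projection(2)) (use n in auto)
    \<comment> \<open>The projection keeps the mode l = n of each p >= n, and \<open>val\<close> is
      zero for all of them except p = n + 1. The argument 0 given to \<open>Aval\<close> is a dummy
      value of t.\<close>
    then show "set_lebesgue_integral lborel sphere_dom (proj_integrand (-1) n m (h p))
      = (if p = n + 1 then of_real (2 * pi * harm_norm n) * (K * (of_real (curve_weight \<rho>s p) * val p n m)) else 0)"
      using Aval[of n p m 0] n by (auto simp: val_def)
  qed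
  also have "\<dots> = of_real (2 * pi * harm_norm n) * (K * (of_real (2 / \<rho>s * (2 * \<rho>s) ^ (n + 1) / fact (n + 1)) * val (n + 1) n m))"
    by (subst suminf_finite[of "{n + 1}"]) auto
  also have "\<dots> = of_real (NP_factor n)
     * C_const a (n + 1) n m"
  proof -
    define G where "G = (real n + real (n + 1)) gchoose (n + 1)"
    have "2 * pi * harm_norm n * ((1 / (2 * \<rho>s)) ^ n / fact n * (2 / \<rho>s * (2 * \<rho>s) ^ (n + 1) / fact (n + 1) * (fact n * G / 4 ^ (n + 1))))
      = 8 * pi * harm_norm n * G / (fact (n + 1) * 4 ^ (n + 1))"
    proof -
      \<comment> \<open>Here \<rho>s cancels, so the result does not depend on the cut.\<close>
      have "(1 / (2 * \<rho>s)) ^ n * (2 / \<rho>s * (2 * \<rho>s) ^ (n + 1)) = 4"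
        using rs by (simp add: power_divide)
      moreover have "2 * pi * harm_norm n * ((1 / (2 * \<rho>s)) ^ n / fact n * (2 / \<rho>s * (2 * \<rho>s) ^ (n + 1) / fact (n + 1) * (fact n * G / 4 ^ (n + 1))))
        = 2 * pi * harm_norm n * ((1 / (2 * \<rho>s)) ^ n * (2 / \<rho>s * (2 * \<rho>s) ^ (n + 1))) * G / (fact (n + 1) * 4 ^ (n + 1))"
        by (simp del: fact_Suc power_Suc)
      ultimately show ?thesis by (simp only:)
    qed
    from arg_cong[OF this, of "\<lambda>y. complex_of_real y * C_const a (n + 1) n m"]
    show ?thesis unfolding K_def val_def G_def[symmetric]
      by (simp add: mult_ac del: fact_Suc power_Suc)
  qed
  finally show ?thesis .
qed

theorem proposition6:
  shows "\<exists>Q :: nat \<Rightarrow> real.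
    \<forall>(\<rho>0 :: real) (F :: field) (a :: coeffs) E Es J Js.
      0 < \<rho>0 \<and> maxwell_equations \<rho>0 F \<and> has_expansion \<rho>0 F a
      \<and> top_mode_constants a E Es J Js
      \<and> (\<forall>p m. 1 \<le> p \<and> \<bar>m\<bar> \<le> int p \<longrightarrow> Es p m = 0 \<and> Js p m = 0)
      \<longrightarrow> (\<forall>n m \<rho>s. 1 \<le> n \<and> \<bar>m\<bar> \<le> int n \<and> 0 < \<rho>s \<and> \<rho>s < \<rho>0 \<longrightarrow>
            NP_const F \<rho>s (n - 1) m = complex_of_real (Q n) * C_const a (n + 1) n m)"
proof (intro exI[of _ NP_factor]
    allI impI, elim conjE)
  fix \<rho>0 :: real and F :: field and a :: coeffs and E Es J Js n m and \<rho>s :: real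
  assume "0 < \<rho>0" "maxwell_equations \<rho>0 F" "has_expansion \<rho>0 F a" "top_mode_constants a E Es J Js"
    and reg: "\<forall>p m. 1 \<le> p \<and> \<bar>m\<bar> \<le> int p \<longrightarrow> Es p m = 0 \<and> Js p m = 0"
    and "1 \<le> n" "\<bar>m\<bar> \<le> int n" "0 < \<rho>s" "\<rho>s < \<rho>0"
  then show "NP_const F \<rho>s (n - 1) m
      = complex_of_real (NP_factor n)
        * C_const a (n + 1) n m"
    by (intro NP_const_value[where E = E and Es = Es and J = J and Js = Js]) auto
qed

end
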